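(* Let $m\ge1$. If $D>1$, then almost all $w\in\mathrm{Sym}^D\mathbb{C}^m$ are polystable.
   Context: Work over $\mathbb{C}$. $\mathrm{Sym}^D\mathbb{C}^m$ is the space of homogeneous polynomials of degree $D$ in $m$ variables with the natural action of $\mathrm{GL}_m$. A form $w$ is polystable if its $\mathrm{SL}_m$-orbit is closed. "Almost all" means: for all $w$ in some nonempty Zariski open subset. *)

theory Defs
  imports "HOL-Analysis.Analysis" "HOL-Library.Poly_Mapping"
begin

text \<open>
  Multivariate polynomials over the complex numbers, as finitely supported functions from
  monomials (finitely supported exponent functions) to coefficients. Multiplication of such
  \<^type>\<open>poly_mapping\<close>s is convolution, i.e. the usual product.
\<close>

type_synonym 'v monom = "'v \<Rightarrow>\<^sub>0 nat"
type_synonym 'v cpoly = "'v monom \<Rightarrow>\<^sub>0 complex"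

definition mdeg :: "'v monom \<Rightarrow> nat" where
  "mdeg \<alpha> = (\<Sum>i\<in>Poly_Mapping.keys \<alpha>. Poly_Mapping.lookup \<alpha> i)"

definition Var :: "'v \<Rightarrow> 'v cpoly" where
  "Var i = Poly_Mapping.single (Poly_Mapping.single i 1) 1"

definition Const :: "complex \<Rightarrow> 'v cpoly" where
  "Const c = Poly_Mapping.single 0 c"

definition eval_cpoly :: "('v \<Rightarrow> complex) \<Rightarrow> 'v cpoly \<Rightarrow> complex" where
  "eval_cpoly a P = (\<Sum>\<alpha>\<in>Poly_Mapping.keys P. Poly_Mapping.lookup P \<alpha> * (\<Prod>i\<in>Poly_Mapping.keys \<alpha>. a i ^ Poly_Mapping.lookup \<alpha> i))"

definition subst_cpoly :: "('v \<Rightarrow> 'u cpoly) \<Rightarrow> 'v cpoly \<Rightarrow> 'u cpoly" where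
  "subst_cpoly \<sigma> P = (\<Sum>\<alpha>\<in>Poly_Mapping.keys P. Const (Poly_Mapping.lookup P \<alpha>) * (\<Prod>i\<in>Poly_Mapping.keys \<alpha>. \<sigma> i ^ Poly_Mapping.lookup \<alpha> i))"

text \<open>
  \<open>Sym_forms D\<close> is the space of homogeneous polynomials of degree \<open>D\<close> (including \<open>0\<close>) in the
  \<open>m = CARD('m)\<close> variables indexed by \<open>'m\<close>.
\<close>

definition Sym_forms :: "nat \<Rightarrow> 'm::finite cpoly set" where
  "Sym_forms D = {w. \<forall>\<alpha>\<in>Poly_Mapping.keys w. mdeg \<alpha> = D}"

text \<open>
  The variables are the standard basis of \<open>\<complex>\<^sup>m\<close>, so a matrix \<open>g\<close> sends the \<open>j\<close>-th variable to the
  linear form given by its \<open>j\<close>-th column, and acts on \<open>Sym_forms D\<close> by substitution.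
\<close>

definition mat_act :: "complex ^ 'm ^ 'm \<Rightarrow> 'm::finite cpoly \<Rightarrow> 'm cpoly" where
  "mat_act g w = subst_cpoly (\<lambda>j. \<Sum>i\<in>UNIV. Const (g $ i $ j) * Var i) w"

definition SL_orbit :: "'m::finite cpoly \<Rightarrow> 'm cpoly set" where
  "SL_orbit w = {mat_act g w | g. det g = 1}"

text \<open>
  Zariski topology of the vector space \<open>Sym_forms D\<close>. Its linear coordinates are the coefficients
  of a form, so a polynomial function on it is a polynomial whose variables are themselves
  indexed by monomials, evaluated at the coefficient function \<open>Poly_Mapping.lookup w\<close>. (Variables indexed by
  monomials of degree other than \<open>D\<close> evaluate to \<open>0\<close>.)
\<close>

definition zariski_closed :: "nat \<Rightarrow> 'm::finite cpoly set \<Rightarrow> bool" where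
  "zariski_closed D Z \<longleftrightarrow>
     (\<exists>S :: 'm monom cpoly set. Z = {w \<in> Sym_forms D. \<forall>P\<in>S. eval_cpoly (Poly_Mapping.lookup w) P = 0})"

definition zariski_open :: "nat \<Rightarrow> 'm::finite cpoly set \<Rightarrow> bool" where
  "zariski_open D U \<longleftrightarrow> U \<subseteq> Sym_forms D \<and> zariski_closed D (Sym_forms D - U)"

definition polystable :: "nat \<Rightarrow> 'm::finite cpoly \<Rightarrow> bool" where
  "polystable D w \<longleftrightarrow> w \<in> Sym_forms D \<and> zariski_closed D (SL_orbit w)"

definition almost_all_forms :: "nat \<Rightarrow> ('m::finite cpoly \<Rightarrow> bool) \<Rightarrow> bool" where
  "almost_all_forms D Q \<longleftrightarrow> (\<exists>U. U \<noteq> {} \<and> zariski_open D U \<and> (\<forall>w\<in>U. Q w))"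

end

theory Submission
  imports Defs "HOL-Computational_Algebra.Fundamental_Theorem_Algebra"
begin

text \<open>
  For \<open>D = 2\<close> a form is a symmetric matrix on which \<open>SL\<close> acts by congruence. Two symmetric
  matrices with the same nonzero determinant are congruent by a matrix of determinant one, so the
  orbit of a nondegenerate quadric is cut out by the single equation that fixes the determinant
  (\<open>SL_orbit_quadric\<close>).

  Let \<open>D \<ge> 3\<close>. The forms \<open>w\<close> of the open set have partial derivatives that generate all forms of
  some fixed large degree (\<open>partials_generate\<close>), which is smoothness of the hypersurface \<open>w = 0\<close> in a
  quantitative shape. A polynomial in the coefficients of \<open>w\<close> that does not vanish at the Fermat form
  guarantees this (\<open>generic_partials_generate\<close>).

  For such a \<open>w\<close>, let \<open>u\<close> be a point of the Zariski closure of its orbit. The proof that \<open>u\<close> lies in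
  the orbit is a valuative criterion, carried out inside the complex numbers. Choose a countable ring
  \<open>F\<close> that contains the coefficients of \<open>w\<close> and \<open>u\<close>, and a matrix \<open>g\<close> of determinant one that is generic
  over \<open>F\<close>: every polynomial relation over \<open>F\<close> between the coefficients of \<open>g w\<close> holds on the whole
  orbit, hence also at \<open>u\<close> (\<open>generic_SL_point\<close>, by Baire category). So sending the coefficients of
  \<open>g w\<close> to those of \<open>u\<close> is a ring homomorphism from a subring of the complex numbers to the complex
  numbers which fixes \<open>F\<close>. Since its target is algebraically closed, it extends to a homomorphism \<open>\<phi>\<close>
  on a valuation ring \<open>R\<close> (\<open>partial_hom_extend_to_valuation_ring\<close>). If the entries of \<open>g\<close> lie in \<open>R\<close>,
  then \<open>\<phi>(g)\<close> has determinant one and \<open>\<phi>(g) w = \<phi>(g w) = u\<close>.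

  It remains to bound \<open>g\<close>. Up to invertible matrices over \<open>R\<close> it is diagonal with entries \<open>t\<close>
  (\<open>smith_normal_form\<close>), and the resulting change of coordinates turns \<open>w\<close> into a form whose reduction
  under \<open>\<phi>\<close> still has generating partial derivatives. For two sets \<open>I\<close>, \<open>J\<close> with more than \<open>m\<close>
  variables in total such a form contains a monomial \<open>x\<^sub>i x\<^sup>\<beta>\<close> with \<open>i \<in> I\<close> and \<open>\<beta>\<close> supported on \<open>J\<close>;
  otherwise fewer than \<open>card J\<close> forms would generate all forms of large degree on the coordinate
  subspace of \<open>J\<close>, which a dimension count forbids (\<open>nonzero_mixed_coefficient\<close>). Each such monomial
  gives \<open>t\<^sub>i t\<^sup>\<beta> \<in> R\<close>. Sorting the \<open>t\<close> by size, these conditions together with the fact that the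
  product of all \<open>t\<close> is a unit force every \<open>t\<close> into \<open>R\<close> as soon as \<open>D \<ge> 3\<close> (\<open>integral_weights\<close>).
\<close>

section \<open>Polynomials as finitely supported coefficient functions\<close>

abbreviation cf :: "('a \<Rightarrow>\<^sub>0 'b::zero) \<Rightarrow> 'a \<Rightarrow> 'b" where
  "cf \<equiv> Poly_Mapping.lookup"

abbreviation mon :: "'v monom \<Rightarrow> 'v cpoly" where
  "mon \<alpha> \<equiv> Poly_Mapping.single \<alpha> 1"

abbreviation vexp :: "'v \<Rightarrow> 'v monom" where
  "vexp i \<equiv> Poly_Mapping.single i (Suc 0)"

lemma poly_mapping_sum_single:
  fixes P :: "'a \<Rightarrow>\<^sub>0 'b::comm_monoid_add"
  assumes "finite A" "Poly_Mapping.keys P \<subseteq> A"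
  shows "P = (\<Sum>\<alpha>\<in>A. Poly_Mapping.single \<alpha> (cf P \<alpha>))"
proof (rule poly_mapping_eqI)
  fix \<beta>
  have "(\<Sum>\<alpha>\<in>A. cf P \<alpha> when \<alpha> = \<beta>) = (\<Sum>\<alpha>\<in>A. if \<alpha> = \<beta> then cf P \<beta> else 0)"
    by (rule sum.cong) (auto simp: when_def)
  also have "\<dots> = cf P \<beta>"
    using assms by (auto simp: sum.delta in_keys_iff)
  finally show "cf P \<beta> = cf (\<Sum>\<alpha>\<in>A. Poly_Mapping.single \<alpha> (cf P \<alpha>)) \<beta>"
    by (simp add: lookup_sum lookup_single)
qed

lemma keys_add_monom: "Poly_Mapping.keys (\<alpha> + \<beta>) = Poly_Mapping.keys \<alpha> \<union> Poly_Mapping.keys (\<beta> :: 'v monom)"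
  by (auto simp: in_keys_iff lookup_add)

lemma power_product_add:
  fixes f :: "'v \<Rightarrow> 'r::comm_monoid_mult"
  shows "(\<Prod>i\<in>Poly_Mapping.keys (\<alpha> + \<beta>). f i ^ cf (\<alpha> + \<beta>) i) =
    (\<Prod>i\<in>Poly_Mapping.keys \<alpha>. f i ^ cf \<alpha> i) * (\<Prod>i\<in>Poly_Mapping.keys \<beta>. f i ^ cf \<beta> i)"
proof -
  let ?K = "Poly_Mapping.keys \<alpha> \<union> Poly_Mapping.keys \<beta>"
  have "(\<Prod>i\<in>Poly_Mapping.keys \<alpha>. f i ^ cf \<alpha> i) = (\<Prod>i\<in>?K. f i ^ cf \<alpha> i)"
    by (rule prod.mono_neutral_left) (auto simp: in_keys_iff)
  moreover have "(\<Prod>i\<in>Poly_Mapping.keys \<beta>. f i ^ cf \<beta> i) = (\<Prod>i\<in>?K. f i ^ cf \<beta> i)"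
    by (rule prod.mono_neutral_left) (auto simp: in_keys_iff)
  ultimately show ?thesis
    by (simp add: keys_add_monom lookup_add power_add prod.distrib)
qed

lemma linear_extension_sum:
  fixes c :: "complex \<Rightarrow> 'r::comm_ring_1"
  assumes "c 0 = 0" "finite A" "Poly_Mapping.keys P \<subseteq> A"
  shows "(\<Sum>\<alpha>\<in>Poly_Mapping.keys P. c (cf P \<alpha>) * M \<alpha>) = (\<Sum>\<alpha>\<in>A. c (cf P \<alpha>) * M \<alpha>)"
  by (rule sum.mono_neutral_left) (use assms in \<open>auto simp: in_keys_iff\<close>)

lemma linear_extension_add:
  fixes c :: "complex \<Rightarrow> 'r::comm_ring_1"
  assumes "c 0 = 0" "\<And>a b. c (a + b) = c a + c b"
  shows "(\<Sum>\<alpha>\<in>Poly_Mapping.keys (P + Q). c (cf (P + Q) \<alpha>) * M \<alpha>) =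
    (\<Sum>\<alpha>\<in>Poly_Mapping.keys P. c (cf P \<alpha>) * M \<alpha>) + (\<Sum>\<alpha>\<in>Poly_Mapping.keys Q. c (cf Q \<alpha>) * M \<alpha>)"
proof -
  let ?K = "Poly_Mapping.keys P \<union> Poly_Mapping.keys Q"
  have "Poly_Mapping.keys (P + Q) \<subseteq> ?K" by (rule keys_add)
  then show ?thesis
    using linear_extension_sum[where c = c and A = ?K and P = "P + Q" and M = M, OF assms(1)]
      linear_extension_sum[where c = c and A = ?K and P = P and M = M, OF assms(1)]
      linear_extension_sum[where c = c and A = ?K and P = Q and M = M, OF assms(1)]
    by (simp add: lookup_add assms(2) distrib_right sum.distrib)
qed

lemma additive_sum:
  fixes T :: "'v cpoly \<Rightarrow> 'r::comm_ring_1"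
  assumes "T 0 = 0" "\<And>P Q. T (P + Q) = T P + T Q"
  shows "T (\<Sum>x\<in>X. f x) = (\<Sum>x\<in>X. T (f x))"
  by (induction X rule: infinite_finite_induct) (auto simp: assms)

text \<open>
  Both evaluation and substitution are ring homomorphisms for this reason: a product of polynomials
  is bilinear, so multiplicativity can be tested on single terms.
\<close>

lemma multiplicative_if_on_singles:
  fixes T :: "'v cpoly \<Rightarrow> 'r::comm_ring_1"
  assumes T0: "T 0 = 0" and Tadd: "\<And>P Q. T (P + Q) = T P + T Q"
    and Ts: "\<And>\<alpha> a \<beta> b. T (Poly_Mapping.single (\<alpha> + \<beta>) (a * b)) =
       T (Poly_Mapping.single \<alpha> a) * T (Poly_Mapping.single \<beta> b)"
  shows "T (P * Q) = T P * T Q"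
proof -
  note S = additive_sum[of T, OF T0 Tadd]
  let ?p = "\<lambda>\<alpha>. Poly_Mapping.single \<alpha> (cf P \<alpha>)" and ?q = "\<lambda>\<alpha>. Poly_Mapping.single \<alpha> (cf Q \<alpha>)"
  have P: "P = sum ?p (Poly_Mapping.keys P)" and Q: "Q = sum ?q (Poly_Mapping.keys Q)"
    by (rule poly_mapping_sum_single; simp)+
  have "T (sum ?p (Poly_Mapping.keys P) * sum ?q (Poly_Mapping.keys Q)) =
      T (sum ?p (Poly_Mapping.keys P)) * T (sum ?q (Poly_Mapping.keys Q))"
    unfolding sum_product S mult_single Ts ..
  then show ?thesis using P Q by metis
qed

lemma eval_cpoly_add: "eval_cpoly a (P + Q) = eval_cpoly a P + eval_cpoly a Q"
  unfolding eval_cpoly_def by (rule linear_extension_add[of "\<lambda>x. x"]) auto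

lemma eval_cpoly_single: "eval_cpoly a (Poly_Mapping.single \<alpha> c) = c * (\<Prod>i\<in>Poly_Mapping.keys \<alpha>. a i ^ cf \<alpha> i)"
  by (simp add: eval_cpoly_def)

lemma eval_cpoly_mult: "eval_cpoly a (P * Q) = eval_cpoly a P * eval_cpoly a Q"
  by (rule multiplicative_if_on_singles)
     (simp_all add: eval_cpoly_add eval_cpoly_single power_product_add, simp add: eval_cpoly_def)

lemma eval_cpoly_Const [simp]: "eval_cpoly a (Const c) = c"
  by (simp add: Const_def eval_cpoly_single)

lemma eval_cpoly_Var [simp]: "eval_cpoly a (Var i) = a i"
  by (simp add: Var_def eval_cpoly_single)

lemma Const_0 [simp]: "Const 0 = 0" by (simp add: Const_def)
lemma Const_1 [simp]: "Const 1 = 1" by (simp add: Const_def)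
lemma Const_add: "Const (a + b) = Const a + Const b" by (simp add: Const_def single_add)
lemma Const_mult: "Const (a * b) = Const a * Const b" by (simp add: Const_def mult_single)
lemma Const_sum: "Const (sum f A) = (\<Sum>x\<in>A. Const (f x))"
  by (induction A rule: infinite_finite_induct) (auto simp: Const_add)
lemma Const_mult_single: "Const c * Poly_Mapping.single \<alpha> b = Poly_Mapping.single \<alpha> (c * b)"
  by (simp add: Const_def mult_single)

lemma lookup_Const_mult [simp]: "cf (Const c * P) \<alpha> = c * cf P \<alpha>"
proof -
  have P: "P = (\<Sum>\<alpha>\<in>Poly_Mapping.keys P. Poly_Mapping.single \<alpha> (cf P \<alpha>))"
    by (rule poly_mapping_sum_single) auto
  have "cf (Const c * (\<Sum>\<alpha>\<in>Poly_Mapping.keys P. Poly_Mapping.single \<alpha> (cf P \<alpha>))) \<alpha> =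
    c * cf (\<Sum>\<alpha>\<in>Poly_Mapping.keys P. Poly_Mapping.single \<alpha> (cf P \<alpha>)) \<alpha>"
    by (simp add: sum_distrib_left Const_mult_single lookup_sum lookup_single mult_when)
  then show ?thesis using P by metis
qed

lemma lookup_Var: "cf (Var i) \<alpha> = (1 when vexp i = \<alpha>)"
  by (simp add: Var_def lookup_single)

lemma eval_cpoly_0 [simp]: "eval_cpoly a 0 = 0" by (simp add: eval_cpoly_def)
lemma subst_cpoly_0 [simp]: "subst_cpoly \<sigma> 0 = 0" by (simp add: subst_cpoly_def)
lemma subst_cpoly_add: "subst_cpoly \<sigma> (P + Q) = subst_cpoly \<sigma> P + subst_cpoly \<sigma> Q"
  unfolding subst_cpoly_def by (rule linear_extension_add[of Const]) (auto simp: Const_add)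
lemma subst_cpoly_single:
  "subst_cpoly \<sigma> (Poly_Mapping.single \<alpha> c) = Const c * (\<Prod>i\<in>Poly_Mapping.keys \<alpha>. \<sigma> i ^ cf \<alpha> i)"
  by (simp add: subst_cpoly_def)
lemma subst_cpoly_mult: "subst_cpoly \<sigma> (P * Q) = subst_cpoly \<sigma> P * subst_cpoly \<sigma> Q"
  by (rule multiplicative_if_on_singles)
     (simp_all add: subst_cpoly_add subst_cpoly_single power_product_add Const_mult)
lemma subst_cpoly_Const [simp]: "subst_cpoly \<sigma> (Const c) = Const c"
  by (subst Const_def) (simp add: subst_cpoly_single)
lemma subst_cpoly_Var [simp]: "subst_cpoly \<sigma> (Var i) = \<sigma> i"
  by (simp add: Var_def subst_cpoly_single)
lemma subst_cpoly_sum: "subst_cpoly \<sigma> (sum f X) = (\<Sum>x\<in>X. subst_cpoly \<sigma> (f x))"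
  by (rule additive_sum) (auto simp: subst_cpoly_add)

lemma Var_power: "Var i ^ n = mon (Poly_Mapping.single i n)"
  by (induction n) (auto simp: Var_def mult_single simp flip: single_add)

lemma mon_sum: "mon (\<Sum>x\<in>X. f x) = (\<Prod>x\<in>X. mon (f x))"
  by (induction X rule: infinite_finite_induct) (auto simp: mult_single[of _ "1::complex" _ 1, simplified, symmetric])

lemma mon_eq_prod: "mon \<alpha> = (\<Prod>i\<in>Poly_Mapping.keys \<alpha>. Var i ^ cf \<alpha> i)"
proof -
  have "\<alpha> = (\<Sum>i\<in>Poly_Mapping.keys \<alpha>. Poly_Mapping.single i (cf \<alpha> i))"
    by (rule poly_mapping_sum_single) auto
  then have "mon \<alpha> = mon (\<Sum>i\<in>Poly_Mapping.keys \<alpha>. Poly_Mapping.single i (cf \<alpha> i))" by simp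
  then show ?thesis by (simp add: mon_sum Var_power)
qed

lemma cpoly_expand: "P = (\<Sum>\<alpha>\<in>Poly_Mapping.keys P. Const (cf P \<alpha>) * mon \<alpha>)"
  using poly_mapping_sum_single[of "Poly_Mapping.keys P" P] by (simp add: Const_mult_single)

text \<open>
  Constants and variables generate the polynomial ring. Most identities below compare two ring
  homomorphisms or two derivations, and for these the four cases are immediate.
\<close>

lemma cpoly_induct [case_names Const Var add mult]:
  assumes C: "\<And>c. R (Const c)" and V: "\<And>i. R (Var i)"
    and A: "\<And>P Q. R P \<Longrightarrow> R Q \<Longrightarrow> R (P + Q)" and M: "\<And>P Q. R P \<Longrightarrow> R Q \<Longrightarrow> R (P * Q)"
  shows "R P"
proof -
  have S: "R (sum f X)" if "\<And>x. x \<in> X \<Longrightarrow> R (f x)" for f :: "'b monom \<Rightarrow> _" and X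
    using that C[of 0] by (induction X rule: infinite_finite_induct) (auto intro: A)
  have W: "R (Var i ^ n)" for i n
    using C[of 1] by (induction n) (auto intro: M V)
  have Pr: "R (prod f X)" if "\<And>x. x \<in> X \<Longrightarrow> R (f x)" for f :: "'a \<Rightarrow> _" and X
    using that C[of 1] by (induction X rule: infinite_finite_induct) (auto intro: M)
  have "R (mon \<alpha>)" for \<alpha>
    unfolding mon_eq_prod by (rule Pr, rule W)
  then have "R (\<Sum>\<alpha>\<in>Poly_Mapping.keys P. Const (cf P \<alpha>) * mon \<alpha>)" 
    by (intro S M C)
  then show ?thesis using cpoly_expand[of P] by simp
qed

section \<open>Linear substitutions, homogeneous forms and partial derivatives\<close>

lemma mat_act_0 [simp]: "mat_act g 0 = 0" by (simp add: mat_act_def)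
lemma mat_act_add: "mat_act g (P + Q) = mat_act g P + mat_act g Q"
  by (simp add: mat_act_def subst_cpoly_add)
lemma mat_act_mult: "mat_act g (P * Q) = mat_act g P * mat_act g Q"
  by (simp add: mat_act_def subst_cpoly_mult)
lemma mat_act_Const [simp]: "mat_act g (Const c) = Const c" by (simp add: mat_act_def)
lemma mat_act_Var: "mat_act g (Var j) = (\<Sum>i\<in>UNIV. Const (g $ i $ j) * Var i)" by (simp add: mat_act_def)
lemma mat_act_sum: "mat_act g (sum f X) = (\<Sum>x\<in>X. mat_act g (f x))"
  by (simp add: mat_act_def subst_cpoly_sum)

lemma mat_act_mat_act:
  fixes g h :: "complex ^ 'm ^ 'm::finite"
  shows "mat_act g (mat_act h P) = mat_act (g ** h) P"
proof (induction P rule: cpoly_induct)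
  case (Var j)
  have "mat_act g (mat_act h (Var j)) =
      (\<Sum>i\<in>UNIV. \<Sum>l\<in>UNIV. Const (h $ i $ j) * (Const (g $ l $ i) * Var l))"
    by (simp add: mat_act_Var mat_act_sum mat_act_mult sum_distrib_left)
  also have "\<dots> = (\<Sum>l\<in>UNIV. \<Sum>i\<in>UNIV. Const (h $ i $ j) * (Const (g $ l $ i) * Var l))"
    by (rule sum.swap)
  also have "\<dots> = mat_act (g ** h) (Var j)"
    by (simp add: mat_act_Var matrix_matrix_mult_def Const_sum Const_mult sum_distrib_left sum_distrib_right mult_ac)
  finally show ?case .
qed (auto simp: mat_act_add mat_act_mult)

lemma mat_act_one [simp]: "mat_act (mat 1) P = (P :: 'm::finite cpoly)"
proof (induction P rule: cpoly_induct)
  case (Var j)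
  have "Const ((mat 1 :: complex^'m^'m) $ i $ j) * Var i = (if i = j then Var j else 0)" for i
    by (simp add: mat_def)
  then show ?case by (simp add: mat_act_Var)
qed (auto simp: mat_act_add mat_act_mult)

lemma mdeg_UNIV: "mdeg \<alpha> = (\<Sum>i\<in>UNIV. cf \<alpha> (i::'m::finite))"
  unfolding mdeg_def by (rule sum.mono_neutral_left) (auto simp: in_keys_iff)

lemma mdeg_add: "mdeg (\<alpha> + \<beta>) = mdeg \<alpha> + mdeg (\<beta> :: 'm::finite monom)"
  by (simp add: mdeg_UNIV lookup_add sum.distrib)

lemma mdeg_single [simp]: "mdeg (Poly_Mapping.single i n) = n" by (simp add: mdeg_def)
lemma mdeg_0 [simp]: "mdeg 0 = 0" by (simp add: mdeg_def)

lemma Sym_formsI: "(\<And>\<alpha>. cf w \<alpha> \<noteq> 0 \<Longrightarrow> mdeg \<alpha> = D) \<Longrightarrow> w \<in> Sym_forms D"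
  by (auto simp: Sym_forms_def in_keys_iff)

lemma Sym_formsD: "w \<in> Sym_forms D \<Longrightarrow> cf w \<alpha> \<noteq> 0 \<Longrightarrow> mdeg \<alpha> = D"
  by (auto simp: Sym_forms_def in_keys_iff)

lemma Sym_forms_0 [simp]: "0 \<in> Sym_forms D" by (simp add: Sym_forms_def)
lemma Sym_forms_add: "P \<in> Sym_forms D \<Longrightarrow> Q \<in> Sym_forms D \<Longrightarrow> P + Q \<in> Sym_forms D"
  unfolding Sym_forms_def using keys_add[of P Q] by auto
lemma Sym_forms_sum: "(\<And>x. x \<in> X \<Longrightarrow> f x \<in> Sym_forms D) \<Longrightarrow> sum f X \<in> Sym_forms D"
  by (induction X rule: infinite_finite_induct) (auto intro: Sym_forms_add)
lemma Sym_forms_mult: "P \<in> Sym_forms D \<Longrightarrow> Q \<in> Sym_forms E \<Longrightarrow> P * Q \<in> Sym_forms (D + E)"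
  unfolding Sym_forms_def using keys_mult[of P Q] by (force simp: mdeg_add)
lemma Sym_forms_Const_mult: "P \<in> Sym_forms D \<Longrightarrow> Const c * P \<in> Sym_forms D"
  by (rule Sym_formsI) (auto dest: Sym_formsD)
lemma Sym_forms_mult_Const: "P \<in> Sym_forms D \<Longrightarrow> P * Const c \<in> Sym_forms D"
  using Sym_forms_Const_mult by (metis mult.commute)
lemma Sym_forms_single: "mdeg \<alpha> = D \<Longrightarrow> Poly_Mapping.single \<alpha> c \<in> Sym_forms D"
  by (simp add: Sym_forms_def)
lemma Sym_forms_1: "1 \<in> Sym_forms 0" by (simp add: Sym_forms_def)
lemma Sym_forms_power: "P \<in> Sym_forms D \<Longrightarrow> P ^ n \<in> Sym_forms (n * D)"
  by (induction n) (auto simp: Sym_forms_1 intro: Sym_forms_mult)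
lemma Sym_forms_prod: "(\<And>x. x \<in> X \<Longrightarrow> f x \<in> Sym_forms (d x)) \<Longrightarrow> prod f X \<in> Sym_forms (sum d X)"
  by (induction X rule: infinite_finite_induct) (auto simp: Sym_forms_1 intro: Sym_forms_mult)
lemma Var_Sym_forms: "Var i \<in> Sym_forms 1"
  unfolding Var_def by (rule Sym_forms_single) simp

lemma mat_act_Sym_forms:
  assumes "w \<in> Sym_forms D"
  shows "mat_act g w \<in> Sym_forms D"
proof -
  let ?l = "\<lambda>j. \<Sum>i\<in>UNIV. Const (g $ i $ j) * Var i"
  have l: "?l j \<in> Sym_forms 1" for j
    by (intro Sym_forms_sum Sym_forms_Const_mult Var_Sym_forms)
  have "(\<Prod>j\<in>Poly_Mapping.keys \<alpha>. ?l j ^ cf \<alpha> j) \<in> Sym_forms D" if "\<alpha> \<in> Poly_Mapping.keys w" for \<alpha>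
  proof -
    have "(\<Prod>j\<in>Poly_Mapping.keys \<alpha>. ?l j ^ cf \<alpha> j) \<in> Sym_forms (\<Sum>j\<in>Poly_Mapping.keys \<alpha>. cf \<alpha> j)"
      by (rule Sym_forms_prod) (use Sym_forms_power[OF l] in simp)
    also have "(\<Sum>j\<in>Poly_Mapping.keys \<alpha>. cf \<alpha> j) = D"
      using assms that by (auto simp: mdeg_def Sym_forms_def)
    finally show ?thesis .
  qed
  then show ?thesis
    unfolding mat_act_def subst_cpoly_def by (intro Sym_forms_sum Sym_forms_Const_mult)
qed

definition diagm :: "('m \<Rightarrow> complex) \<Rightarrow> complex ^ 'm ^ 'm::finite" where
  "diagm t = (\<chi> i j. if i = j then t i else 0)"

text \<open>
  A diagonal matrix scales each monomial by its weight. This is how a condition on the coefficients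
  of a form becomes a condition on the diagonal entries.
\<close>

lemma lookup_mat_act_diagm:
  "cf (mat_act (diagm t) w) \<alpha> = (\<Prod>i\<in>UNIV. t i ^ cf \<alpha> i) * cf w \<alpha>"
proof -
  have V: "(\<Sum>i\<in>UNIV. Const (diagm t $ i $ j) * Var i) = Const (t j) * Var j" for j
  proof -
    have "Const (diagm t $ i $ j) * Var i = (if i = j then Const (t j) * Var j else 0)" for i
      by (simp add: diagm_def)
    then show ?thesis by simp
  qed
  have P: "Const c ^ n = Const (c ^ n)" for c and n :: nat
    by (induction n) (auto simp: Const_mult)
  have PP: "(\<Prod>j\<in>X. Const (f j)) = Const (\<Prod>j\<in>X. f j)" for f and X :: "'a set"
    by (induction X rule: infinite_finite_induct) (auto simp: Const_mult)
  have M: "(\<Prod>j\<in>Poly_Mapping.keys \<beta>. (Const (t j) * Var j) ^ cf \<beta> j) = Const (\<Prod>i\<in>UNIV. t i ^ cf \<beta> i) * mon \<beta>" for \<beta>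
  proof -
    have "(\<Prod>i\<in>UNIV. t i ^ cf \<beta> i) = (\<Prod>i\<in>Poly_Mapping.keys \<beta>. t i ^ cf \<beta> i)"
      by (rule prod.mono_neutral_right) (auto simp: in_keys_iff)
    then show ?thesis
      by (simp add: power_mult_distrib prod.distrib P PP mon_eq_prod)
  qed
  have "mat_act (diagm t) w = (\<Sum>\<beta>\<in>Poly_Mapping.keys w. Const (cf w \<beta>) * (Const (\<Prod>i\<in>UNIV. t i ^ cf \<beta> i) * mon \<beta>))"
    unfolding mat_act_def subst_cpoly_def V M ..
  also have "\<dots> = (\<Sum>\<beta>\<in>Poly_Mapping.keys w. Poly_Mapping.single \<beta> ((\<Prod>i\<in>UNIV. t i ^ cf \<beta> i) * cf w \<beta>))"
    by (rule sum.cong) (simp_all add: Const_mult_single, simp add: mult.commute)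
  also have "cf \<dots> \<alpha> = (\<Sum>\<beta>\<in>Poly_Mapping.keys w. if \<beta> = \<alpha> then (\<Prod>i\<in>UNIV. t i ^ cf \<alpha> i) * cf w \<alpha> else 0)"
    unfolding lookup_sum by (rule sum.cong) (auto simp: lookup_single when_def)
  also have "\<dots> = (\<Prod>i\<in>UNIV. t i ^ cf \<alpha> i) * cf w \<alpha>"
    by (auto simp: in_keys_iff sum.delta)
  finally show ?thesis .
qed

text \<open>
  The formal partial derivative. The truncated subtraction of exponents is harmless, since a monomial
  without the \<open>i\<close>-th variable gets the coefficient \<open>0\<close>.
\<close>

definition pd :: "'v \<Rightarrow> 'v cpoly \<Rightarrow> 'v cpoly" where
  "pd i P = (\<Sum>\<alpha>\<in>Poly_Mapping.keys P. Poly_Mapping.single (\<alpha> - vexp i) (of_nat (cf \<alpha> i) * cf P \<alpha>))"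

lemma pd_sum_superset:
  assumes "finite A" "Poly_Mapping.keys P \<subseteq> A"
  shows "pd i P = (\<Sum>\<alpha>\<in>A. Poly_Mapping.single (\<alpha> - vexp i) (of_nat (cf \<alpha> i) * cf P \<alpha>))"
  unfolding pd_def by (rule sum.mono_neutral_left) (use assms in \<open>auto simp: in_keys_iff\<close>)

lemma pd_0 [simp]: "pd i 0 = 0" by (simp add: pd_def)

lemma pd_add: "pd i (P + Q) = pd i P + pd i Q"
proof -
  let ?K = "Poly_Mapping.keys P \<union> Poly_Mapping.keys Q"
  have "Poly_Mapping.keys (P + Q) \<subseteq> ?K" by (rule keys_add)
  then show ?thesis
    using pd_sum_superset[of ?K "P + Q" i] pd_sum_superset[of ?K P i] pd_sum_superset[of ?K Q i]
    by (simp add: lookup_add distrib_left single_add sum.distrib)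
qed

lemma pd_sum: "pd i (sum f X) = (\<Sum>x\<in>X. pd i (f x))"
  by (induction X rule: infinite_finite_induct) (auto simp: pd_add)

lemma pd_single: "pd i (Poly_Mapping.single \<alpha> c) = Poly_Mapping.single (\<alpha> - vexp i) (of_nat (cf \<alpha> i) * c)"
  by (simp add: pd_def)

lemma monom_diff_add: "cf \<alpha> i \<noteq> 0 \<Longrightarrow> \<alpha> - vexp i + \<beta> = \<alpha> + \<beta> - vexp i" for \<alpha> \<beta> :: "'v monom"
  by (rule poly_mapping_eqI) (auto simp: lookup_add lookup_minus lookup_single when_def)

lemma pd_mult: "pd i (P * Q) = pd i P * Q + P * pd i Q"
proof -
  have s: "pd i (Poly_Mapping.single \<alpha> a * Poly_Mapping.single \<beta> b) =
     pd i (Poly_Mapping.single \<alpha> a) * Poly_Mapping.single \<beta> b + Poly_Mapping.single \<alpha> a * pd i (Poly_Mapping.single \<beta> b)"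
    for \<alpha> \<beta> a b
  proof -
    have 1: "Poly_Mapping.single (\<alpha> - vexp i + \<beta>) (of_nat (cf \<alpha> i) * a * b) = Poly_Mapping.single (\<alpha> + \<beta> - vexp i) (of_nat (cf \<alpha> i) * a * b)"
      by (cases "cf \<alpha> i = 0") (simp_all add: monom_diff_add)
    have 2: "Poly_Mapping.single (\<alpha> + (\<beta> - vexp i)) (a * (of_nat (cf \<beta> i) * b)) = Poly_Mapping.single (\<alpha> + \<beta> - vexp i) (a * (of_nat (cf \<beta> i) * b))"
      using monom_diff_add[of \<beta> i \<alpha>] by (cases "cf \<beta> i = 0") (simp_all add: add.commute)
    show ?thesis
      by (simp add: mult_single pd_single 1 2 flip: single_add) (simp add: lookup_add algebra_simps)
  qed
  let ?p = "\<lambda>\<alpha>. Poly_Mapping.single \<alpha> (cf P \<alpha>)" and ?q = "\<lambda>\<alpha>. Poly_Mapping.single \<alpha> (cf Q \<alpha>)"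
  have P: "P = sum ?p (Poly_Mapping.keys P)" and Q: "Q = sum ?q (Poly_Mapping.keys Q)"
    by (rule poly_mapping_sum_single; simp)+
  have "pd i (sum ?p (Poly_Mapping.keys P) * sum ?q (Poly_Mapping.keys Q)) =
      pd i (sum ?p (Poly_Mapping.keys P)) * sum ?q (Poly_Mapping.keys Q) +
      sum ?p (Poly_Mapping.keys P) * pd i (sum ?q (Poly_Mapping.keys Q))"
    unfolding sum_product pd_sum s sum.distrib ..
  then show ?thesis using P Q by metis
qed

lemma lookup_pd: "cf (pd i P) \<beta> = of_nat (Suc (cf \<beta> i)) * cf P (\<beta> + vexp i)"
proof -
  have "cf (pd i P) \<beta> = (\<Sum>\<alpha>\<in>Poly_Mapping.keys P. (of_nat (cf \<alpha> i) * cf P \<alpha>) when (\<alpha> - vexp i = \<beta>))"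
    by (simp add: pd_def lookup_sum lookup_single)
  also have "\<dots> = (\<Sum>\<alpha>\<in>Poly_Mapping.keys P. if \<alpha> = \<beta> + vexp i then of_nat (Suc (cf \<beta> i)) * cf P (\<beta> + vexp i) else 0)"
  proof (rule sum.cong)
    fix \<alpha> assume "\<alpha> \<in> Poly_Mapping.keys P"
    show "(of_nat (cf \<alpha> i) * cf P \<alpha> when \<alpha> - vexp i = \<beta>) = (if \<alpha> = \<beta> + vexp i then of_nat (Suc (cf \<beta> i)) * cf P (\<beta> + vexp i) else 0)"
    proof (cases "cf \<alpha> i = 0")
      case True
      then have "\<alpha> \<noteq> \<beta> + vexp i" by (auto simp: lookup_add)
      then show ?thesis using True by simp
    next
      case False
      have "\<alpha> - vexp i + vexp i = \<alpha>"
        using monom_diff_add[OF False, of "vexp i"] by simp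
      then have "\<alpha> - vexp i = \<beta> \<longleftrightarrow> \<alpha> = \<beta> + vexp i" by auto
      then show ?thesis by (auto simp: when_def lookup_add)
    qed
  qed simp
  also have "\<dots> = of_nat (Suc (cf \<beta> i)) * cf P (\<beta> + vexp i)"
    by (auto simp: in_keys_iff sum.delta)
  finally show ?thesis .
qed

lemma pd_Sym_forms: "w \<in> Sym_forms D \<Longrightarrow> pd i w \<in> Sym_forms (D - 1)" for w :: "'m::finite cpoly"
  by (rule Sym_formsI) (auto simp: lookup_pd mdeg_add dest: Sym_formsD)

lemma pd_Const [simp]: "pd i (Const c) = 0" by (simp add: Const_def pd_single)
lemma pd_Var: "pd i (Var j) = (if i = j then 1 else 0)"
  by (simp add: Var_def pd_single lookup_single when_def)

text \<open>
  The chain rule. Both sides are derivations along the homomorphism \<open>mat_act g\<close>, so it suffices that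
  they agree on constants and variables.
\<close>

lemma pd_mat_act:
  "pd l (mat_act g P) = (\<Sum>j\<in>UNIV. Const (g $ l $ j) * mat_act g (pd j P))"
proof (induction P rule: cpoly_induct)
  case (Var k)
  have 1: "mat_act g (if j = k then 1 else 0) = (if j = k then 1 else 0)" for j
    using mat_act_Const[of g 1] by auto
  have 2: "Const (g $ l $ j) * (if j = k then 1 else 0) = (if j = k then Const (g $ l $ k) else 0)" for j
    by auto
  have 3: "Const (g $ i $ k) * (if l = i then 1 else 0) = (if i = l then Const (g $ l $ k) else 0)" for i
    by auto
  show ?case
    by (simp add: mat_act_Var pd_sum pd_mult pd_Var 1 2 3)
next
  case (mult P Q)
  then show ?case
    by (simp add: mat_act_mult pd_mult mat_act_add sum.distrib algebra_simps sum_distrib_left sum_distrib_right)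
qed (auto simp: mat_act_add pd_add sum.distrib algebra_simps)

text \<open>
  For a form of degree \<open>d + 1\<close> this says that its Jacobian ideal contains every form of degree \<open>e + d\<close>.
  By the projective Nullstellensatz it holds for some \<open>e\<close> exactly if the partial derivatives have no
  common zero other than the origin; fixing \<open>e\<close> makes it accessible to linear algebra.
\<close>

definition partials_generate :: "nat \<Rightarrow> nat \<Rightarrow> 'm::finite cpoly \<Rightarrow> bool" where
  "partials_generate d e w \<longleftrightarrow>
     (\<forall>P\<in>Sym_forms (e + d). \<exists>A. (\<forall>i. A i \<in> Sym_forms e) \<and> P = (\<Sum>i\<in>UNIV. A i * pd i w))"

text \<open>
  By the chain rule the partial derivatives of \<open>g w\<close> are, up to an invertible linear combination, the
  images under \<open>g\<close> of those of \<open>w\<close>.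
\<close>

lemma partials_generate_mat_act:
  assumes w: "partials_generate d e w" and gh: "g ** h = mat 1"
  shows "partials_generate d e (mat_act g w)"
  unfolding partials_generate_def
proof
  have hg: "h ** g = mat 1" using gh by (simp add: matrix_left_right_inverse)
  fix P :: "'a cpoly" assume P: "P \<in> Sym_forms (e + d)"
  obtain A where A: "\<And>i. A i \<in> Sym_forms e" and PA: "mat_act h P = (\<Sum>i\<in>UNIV. A i * pd i w)"
    using w mat_act_Sym_forms[OF P, of h] unfolding partials_generate_def by blast
  have inv: "mat_act g (pd i w) = (\<Sum>l\<in>UNIV. Const (h $ i $ l) * pd l (mat_act g w))" for i
  proof -
    have "(\<Sum>l\<in>UNIV. Const (h $ i $ l) * pd l (mat_act g w)) =
        (\<Sum>l\<in>UNIV. \<Sum>j\<in>UNIV. Const (h $ i $ l * g $ l $ j) * mat_act g (pd j w))"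
      by (simp add: pd_mat_act sum_distrib_left Const_mult mult.assoc)
    also have "\<dots> = (\<Sum>j\<in>UNIV. \<Sum>l\<in>UNIV. Const (h $ i $ l * g $ l $ j) * mat_act g (pd j w))"
      by (rule sum.swap)
    also have "\<dots> = (\<Sum>j\<in>UNIV. Const ((h ** g) $ i $ j) * mat_act g (pd j w))"
      by (simp add: matrix_matrix_mult_def Const_sum sum_distrib_right)
    also have "\<dots> = (\<Sum>j\<in>UNIV. if j = i then mat_act g (pd i w) else 0)"
      unfolding hg by (rule sum.cong) (auto simp: mat_def)
    finally show ?thesis by simp
  qed
  have "P = mat_act g (mat_act h P)" by (simp add: mat_act_mat_act gh)
  also have "\<dots> = (\<Sum>i\<in>UNIV. \<Sum>l\<in>UNIV. mat_act g (A i) * (Const (h $ i $ l) * pd l (mat_act g w)))"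
    by (simp add: PA mat_act_sum mat_act_mult inv sum_distrib_left)
  also have "\<dots> = (\<Sum>l\<in>UNIV. (\<Sum>i\<in>UNIV. mat_act g (A i) * Const (h $ i $ l)) * pd l (mat_act g w))"
    by (subst sum.swap) (simp add: sum_distrib_left sum_distrib_right mult_ac)
  finally have "P = (\<Sum>l\<in>UNIV. (\<Sum>i\<in>UNIV. mat_act g (A i) * Const (h $ i $ l)) * pd l (mat_act g w))" .
  moreover have "(\<Sum>i\<in>UNIV. mat_act g (A i) * Const (h $ i $ l)) \<in> Sym_forms e" for l
    by (intro Sym_forms_sum Sym_forms_mult_Const mat_act_Sym_forms A)
  ultimately show "\<exists>B. (\<forall>i. B i \<in> Sym_forms e) \<and> P = (\<Sum>i\<in>UNIV. B i * pd i (mat_act g w))"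
    by (intro exI[of _ "\<lambda>l. \<Sum>i\<in>UNIV. mat_act g (A i) * Const (h $ i $ l)"]) auto
qed

section \<open>Forms whose partial derivatives generate\<close>

text \<open>
  Polynomial functions of the coefficients, closed under the arithmetic operations, replace explicit
  polynomials with variables indexed by monomials.
\<close>

definition poly_fun :: "(('v \<Rightarrow> complex) \<Rightarrow> complex) \<Rightarrow> bool" where
  "poly_fun f \<longleftrightarrow> (\<exists>P. \<forall>a. eval_cpoly a P = f a)"

lemma poly_fun_const: "poly_fun (\<lambda>a. c)"
  unfolding poly_fun_def by (metis eval_cpoly_Const)
lemma poly_fun_coord: "poly_fun (\<lambda>a. a i)"
  unfolding poly_fun_def by (metis eval_cpoly_Var)
lemma poly_fun_add: "poly_fun f \<Longrightarrow> poly_fun g \<Longrightarrow> poly_fun (\<lambda>a. f a + g a)"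
  unfolding poly_fun_def by (metis eval_cpoly_add)
lemma poly_fun_mult: "poly_fun f \<Longrightarrow> poly_fun g \<Longrightarrow> poly_fun (\<lambda>a. f a * g a)"
  unfolding poly_fun_def by (metis eval_cpoly_mult)
lemma poly_fun_diff: "poly_fun f \<Longrightarrow> poly_fun g \<Longrightarrow> poly_fun (\<lambda>a. f a - g a)"
  using poly_fun_add[of f "\<lambda>a. (-1) * g a"] poly_fun_mult[OF poly_fun_const[of "-1"], of g] by simp
lemma poly_fun_sum: "(\<And>x. x \<in> X \<Longrightarrow> poly_fun (f x)) \<Longrightarrow> poly_fun (\<lambda>a. \<Sum>x\<in>X. f x a)"
  by (induction X rule: infinite_finite_induct) (auto intro: poly_fun_const poly_fun_add)
lemma poly_fun_prod: "(\<And>x. x \<in> X \<Longrightarrow> poly_fun (f x)) \<Longrightarrow> poly_fun (\<lambda>a. \<Prod>x\<in>X. f x a)"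
  by (induction X rule: infinite_finite_induct) (auto intro: poly_fun_const poly_fun_mult)

lemma zariski_open_nonvanishing:
  assumes "poly_fun f"
  shows "zariski_open D {w \<in> Sym_forms D. f (cf w) \<noteq> 0}"
proof -
  obtain P where P: "\<And>a. eval_cpoly a P = f a" using assms unfolding poly_fun_def by blast
  have "Sym_forms D - {w \<in> Sym_forms D. f (cf w) \<noteq> 0} =
      {w \<in> Sym_forms D. \<forall>Q\<in>{P}. eval_cpoly (cf w) Q = 0}" by (auto simp: P)
  then show ?thesis unfolding zariski_open_def zariski_closed_def by blast
qed

text \<open>
  If a square matrix of polynomial functions is a nonzero scalar matrix at \<open>a0\<close>, then the linear system
  it defines is solvable wherever a suitable polynomial function does not vanish. Eliminating one row
  and column leaves the Schur complement, again a matrix of polynomial functions which is scalar at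
  \<open>a0\<close>; the product of the pivots is the function looked for.
\<close>

lemma generic_solvability:
  fixes M :: "'x \<Rightarrow> 'x \<Rightarrow> ('v \<Rightarrow> complex) \<Rightarrow> complex"
  assumes "finite X" "\<And>x y. x \<in> X \<Longrightarrow> y \<in> X \<Longrightarrow> poly_fun (M x y)"
    and "\<And>x y. x \<in> X \<Longrightarrow> y \<in> X \<Longrightarrow> M x y a0 = (if x = y then c else 0)" "c \<noteq> 0"
  shows "\<exists>f. poly_fun f \<and> f a0 \<noteq> 0 \<and>
    (\<forall>a. f a \<noteq> 0 \<longrightarrow> (\<forall>b. \<exists>s. \<forall>y\<in>X. (\<Sum>x\<in>X. s x * M x y a) = b y))"
  using assms
proof (induction X arbitrary: M c rule: finite_induct)
  case empty
  show ?case by (intro exI[of _ "\<lambda>_. 1"]) (auto intro: poly_fun_const)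
next
  case (insert x X)
  define M' where "M' y z = (\<lambda>a. M x x a * M y z a - M y x a * M x z a)" for y z
  have "\<exists>f. poly_fun f \<and> f a0 \<noteq> 0 \<and>
    (\<forall>a. f a \<noteq> 0 \<longrightarrow> (\<forall>b. \<exists>s. \<forall>y\<in>X. (\<Sum>z\<in>X. s z * M' z y a) = b y))"
  proof (rule insert.IH[of M' "c * c"])
    show "poly_fun (M' y z)" if "y \<in> X" "z \<in> X" for y z
      unfolding M'_def using insert.prems(1) that by (intro poly_fun_diff poly_fun_mult) auto
    show "M' y z a0 = (if y = z then c * c else 0)" if "y \<in> X" "z \<in> X" for y z
    proof -
      have "y \<noteq> x" using that insert.hyps by auto
      then show ?thesis using insert.prems(2) that by (auto simp: M'_def)
    qed
  qed (use insert.prems in auto)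
  then obtain f where f: "poly_fun f" "f a0 \<noteq> 0"
    "\<And>a b. f a \<noteq> 0 \<Longrightarrow> \<exists>s. \<forall>y\<in>X. (\<Sum>z\<in>X. s z * M' z y a) = b y" by blast
  show ?case
  proof (intro exI[of _ "\<lambda>a. M x x a * f a"] conjI allI impI)
    show "poly_fun (\<lambda>a. M x x a * f a)" by (intro poly_fun_mult f insert.prems) auto
    show "M x x a0 * f a0 \<noteq> 0" using f insert.prems by auto
    fix a b assume "M x x a * f a \<noteq> 0"
    then have nz: "M x x a \<noteq> 0" "f a \<noteq> 0" by auto
    obtain s where s: "\<And>y. y \<in> X \<Longrightarrow> (\<Sum>z\<in>X. s z * M' z y a) = M x x a * b y - b x * M x y a"
      using f(3)[OF nz(2), of "\<lambda>y. M x x a * b y - b x * M x y a"] by auto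
    \<comment> \<open>The coefficient at the pivot is determined by the equation indexed by the pivot.\<close>
    define r where "r = (b x - (\<Sum>z\<in>X. s z * M z x a)) / M x x a"
    define s' where "s' = s(x := r)"
    have sum: "(\<Sum>z\<in>insert x X. s' z * M z y a) = r * M x y a + (\<Sum>z\<in>X. s z * M z y a)" for y
    proof -
      have "(\<Sum>z\<in>X. s' z * M z y a) = (\<Sum>z\<in>X. s z * M z y a)"
        using insert.hyps by (intro sum.cong) (auto simp: s'_def)
      then show ?thesis using insert.hyps by (simp add: s'_def)
    qed
    have "(\<Sum>z\<in>insert x X. s' z * M z y a) = b y" if "y \<in> insert x X" for y
    proof (cases "y = x")
      case True
      then show ?thesis unfolding sum r_def using nz by simp
    next
      case False
      then have y: "y \<in> X" using that by auto
      have "M x x a * (\<Sum>z\<in>X. s z * M z y a) =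
          (\<Sum>z\<in>X. s z * M' z y a) + (\<Sum>z\<in>X. s z * M z x a) * M x y a"
        by (simp add: M'_def sum_distrib_left sum_distrib_right algebra_simps flip: sum.distrib)
      also have "\<dots> = M x x a * b y - (b x - (\<Sum>z\<in>X. s z * M z x a)) * M x y a"
        by (simp add: s[OF y] algebra_simps)
      also have "b x - (\<Sum>z\<in>X. s z * M z x a) = r * M x x a"
        unfolding r_def using nz by simp
      finally have "M x x a * (r * M x y a + (\<Sum>z\<in>X. s z * M z y a)) = M x x a * b y"
        by (simp add: algebra_simps)
      then show ?thesis unfolding sum using nz by simp
    qed
    then show "\<exists>s. \<forall>y\<in>insert x X. (\<Sum>z\<in>insert x X. s z * M z y a) = b y" by blast
  qed
qed

lemma lookup_mon_mult:
  "cf (mon \<beta> * Q) \<gamma> = (if \<exists>\<delta>. \<gamma> = \<beta> + \<delta> then cf Q (\<gamma> - \<beta>) else 0)"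
proof -
  have "mon \<beta> * Q = mon \<beta> * (\<Sum>\<delta>\<in>Poly_Mapping.keys Q. Poly_Mapping.single \<delta> (cf Q \<delta>))"
    using poly_mapping_sum_single[of "Poly_Mapping.keys Q" Q] by simp
  also have "\<dots> = (\<Sum>\<delta>\<in>Poly_Mapping.keys Q. Poly_Mapping.single (\<beta> + \<delta>) (cf Q \<delta>))"
    by (simp add: sum_distrib_left mult_single)
  also have "cf \<dots> \<gamma> = (\<Sum>\<delta>\<in>Poly_Mapping.keys Q. cf Q \<delta> when \<beta> + \<delta> = \<gamma>)"
    by (simp add: lookup_sum lookup_single)
  also have "\<dots> = (if \<exists>\<delta>. \<gamma> = \<beta> + \<delta> then cf Q (\<gamma> - \<beta>) else 0)"
  proof (cases "\<exists>\<delta>. \<gamma> = \<beta> + \<delta>")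
    case True
    then obtain \<delta> where \<delta>: "\<gamma> = \<beta> + \<delta>" by blast
    have "(\<Sum>\<delta>'\<in>Poly_Mapping.keys Q. cf Q \<delta>' when \<beta> + \<delta>' = \<gamma>) = (\<Sum>\<delta>'\<in>Poly_Mapping.keys Q. if \<delta>' = \<delta> then cf Q \<delta> else 0)"
      by (rule sum.cong) (auto simp: \<delta> when_def)
    also have "\<dots> = cf Q \<delta>" by (auto simp: in_keys_iff sum.delta)
    finally show ?thesis using \<delta> by simp
  next
    case False
    then show ?thesis by (auto simp: when_def intro!: sum.neutral)
  qed
  finally show ?thesis .
qed

lemma lookup_times_keys:
  fixes P Q :: "'v cpoly"
  shows "cf (P * Q) \<alpha> = (\<Sum>\<beta>\<in>Poly_Mapping.keys P. cf P \<beta> * (if \<exists>\<delta>. \<alpha> = \<beta> + \<delta> then cf Q (\<alpha> - \<beta>) else 0))"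
proof -
  let ?K = "Poly_Mapping.keys P"
  have "P * Q = (\<Sum>\<beta>\<in>?K. Const (cf P \<beta>) * mon \<beta>) * Q" using cpoly_expand[of P] by simp
  also have "\<dots> = (\<Sum>\<beta>\<in>?K. Const (cf P \<beta>) * (mon \<beta> * Q))"
    by (simp only: sum_distrib_right mult.assoc)
  finally show ?thesis by (simp only: lookup_sum lookup_Const_mult lookup_mon_mult)
qed

lemma finite_mdeg_le: "finite {\<alpha> :: 'm::finite monom. mdeg \<alpha> \<le> n}"
proof -
  have "cf ` {\<alpha> :: 'm monom. mdeg \<alpha> \<le> n} \<subseteq> PiE UNIV (\<lambda>_. {..n})"
  proof (auto simp: mdeg_UNIV)
    fix \<alpha> :: "'m monom" and x assume "(\<Sum>i\<in>UNIV. cf \<alpha> i) \<le> n"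
    then show "cf \<alpha> x \<le> n" using member_le_sum[of x UNIV "cf \<alpha>"] by auto
  qed
  then have "finite (cf ` {\<alpha> :: 'm monom. mdeg \<alpha> \<le> n})"
    by (rule finite_subset) (auto intro: finite_PiE)
  then show ?thesis by (rule finite_imageD) (auto simp: inj_on_def intro: poly_mapping_eqI)
qed

lemma finite_monom_divisors: "finite {\<beta> :: 'm::finite monom. \<exists>\<delta>. \<alpha> = \<beta> + \<delta>}"
  by (rule finite_subset[OF _ finite_mdeg_le[of "mdeg \<alpha>"]]) (auto simp: mdeg_add)

lemma lookup_times:
  fixes P Q :: "'m::finite cpoly"
  shows "cf (P * Q) \<alpha> = (\<Sum>\<beta>\<in>{\<beta>. \<exists>\<delta>. \<alpha> = \<beta> + \<delta>}. cf P \<beta> * cf Q (\<alpha> - \<beta>))"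
proof -
  let ?D = "{\<beta>. \<exists>\<delta>. \<alpha> = \<beta> + \<delta>}" and ?K = "Poly_Mapping.keys P"
  have "cf (P * Q) \<alpha> = (\<Sum>\<beta>\<in>?K \<inter> ?D. cf P \<beta> * cf Q (\<alpha> - \<beta>))"
    unfolding lookup_times_keys by (rule sum.mono_neutral_cong_right) auto
  also have "\<dots> = (\<Sum>\<beta>\<in>?D. cf P \<beta> * cf Q (\<alpha> - \<beta>))"
    by (rule sum.mono_neutral_left) (auto simp: finite_monom_divisors in_keys_iff)
  finally show ?thesis .
qed

text \<open>
  The form that shows that the open set is not empty.
\<close>

definition fermat :: "nat \<Rightarrow> 'm::finite cpoly" where
  "fermat D = (\<Sum>j\<in>UNIV. Var j ^ D)"

lemma fermat_Sym_forms: "fermat D \<in> Sym_forms D"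
  unfolding fermat_def by (intro Sym_forms_sum) (use Sym_forms_power[OF Var_Sym_forms, of _ D] in simp)

lemma pd_fermat: "pd j (fermat (Suc d)) = Const (of_nat (Suc d)) * mon (Poly_Mapping.single j d)"
proof -
  have "pd j (Var i ^ Suc d) = (if i = j then Const (of_nat (Suc d)) * mon (Poly_Mapping.single j d) else 0)" for i
  proof -
    have "Poly_Mapping.single i (Suc d) - vexp i = Poly_Mapping.single i d"
      by (simp flip: single_diff)
    then show ?thesis
      by (auto simp only: Var_power pd_single lookup_single when_def Const_mult_single) auto
  qed
  then show ?thesis by (simp add: fermat_def pd_sum)
qed

lemma monom_large_exponent:
  fixes \<gamma> :: "'m::finite monom"
  assumes "mdeg \<gamma> > CARD('m) * (d - 1)"
  shows "\<exists>j. d \<le> cf \<gamma> j"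
proof (rule ccontr)
  assume "\<nexists>j. d \<le> cf \<gamma> j"
  then have "cf \<gamma> j \<le> d - 1" for j by (metis Suc_pred' diff_Suc_1 less_Suc_eq_le not_le not_less_zero zero_less_iff_neq_zero)
  then have "mdeg \<gamma> \<le> CARD('m) * (d - 1)"
    using sum_bounded_above[of UNIV "cf \<gamma>" "d - 1"] by (simp add: mdeg_UNIV)
  then show False using assms by simp
qed

text \<open>
  Every monomial \<open>\<gamma>\<close> of degree \<open>e + d\<close> contains some variable at least \<open>d\<close> times; write
  \<open>\<gamma> = x\<^sup>b x\<^sub>j\<^sup>d\<close>. The products \<open>x\<^sup>b \<partial>\<^sub>j w\<close>, one for each \<open>\<gamma>\<close>, form a square system in the space of forms of
  degree \<open>e + d\<close>. For the Fermat form the product is a fixed multiple of \<open>\<gamma>\<close> itself, so the system is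
  scalar there and \<open>generic_solvability\<close> applies.
\<close>

lemma generic_partials_generate:
  fixes d e :: nat
  assumes ed: "e + d > CARD('m::finite) * (d - 1)"
  shows "\<exists>f. poly_fun f \<and> f (cf (fermat (Suc d) :: 'm cpoly)) \<noteq> 0 \<and>
    (\<forall>w\<in>Sym_forms (Suc d). f (cf w) \<noteq> 0 \<longrightarrow> partials_generate d e (w :: 'm cpoly))"
proof -
  define X where "X = {\<gamma> :: 'm monom. mdeg \<gamma> = e + d}"
  have finX: "finite X" by (rule finite_subset[OF _ finite_mdeg_le[of "e + d"]]) (auto simp: X_def)
  have "\<forall>\<gamma>\<in>X. \<exists>j. d \<le> cf \<gamma> j" using ed by (auto simp: X_def intro!: monom_large_exponent)
  then obtain j where j: "\<And>\<gamma>. \<gamma> \<in> X \<Longrightarrow> d \<le> cf \<gamma> (j \<gamma>)" by metis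
  define b where "b \<gamma> = \<gamma> - Poly_Mapping.single (j \<gamma>) d" for \<gamma>
  have bj: "b \<gamma> + Poly_Mapping.single (j \<gamma>) d = \<gamma>" if "\<gamma> \<in> X" for \<gamma>
    by (rule poly_mapping_eqI) (use j[OF that] in \<open>auto simp: b_def lookup_add lookup_minus lookup_single when_def\<close>)
  have degb: "mdeg (b \<gamma>) = e" if "\<gamma> \<in> X" for \<gamma>
    using arg_cong[OF bj[OF that], of mdeg] that by (simp add: X_def mdeg_add)
  define M where "M \<gamma> \<gamma>' = (\<lambda>a. if \<exists>\<delta>. \<gamma>' = b \<gamma> + \<delta>
      then of_nat (Suc (cf (\<gamma>' - b \<gamma>) (j \<gamma>))) * a (\<gamma>' - b \<gamma> + vexp (j \<gamma>)) else (0::complex))" for \<gamma> \<gamma>'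
  have M: "M \<gamma> \<gamma>' (cf w) = cf (mon (b \<gamma>) * pd (j \<gamma>) w) \<gamma>'" for \<gamma> \<gamma>' and w :: "'m cpoly"
    by (simp add: M_def lookup_mon_mult lookup_pd)
  have "\<exists>f. poly_fun f \<and> f (cf (fermat (Suc d) :: 'm cpoly)) \<noteq> 0 \<and>
    (\<forall>a. f a \<noteq> 0 \<longrightarrow> (\<forall>b. \<exists>s. \<forall>y\<in>X. (\<Sum>x\<in>X. s x * M x y a) = b y))"
  proof (rule generic_solvability[OF finX, of M _ "of_nat (Suc d)"])
    show "poly_fun (M x y)" for x y
    proof (cases "\<exists>\<delta>. y = b x + \<delta>")
      case True
      then have "M x y = (\<lambda>a. of_nat (Suc (cf (y - b x) (j x))) * a (y - b x + vexp (j x)))"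
        by (simp only: M_def True if_True)
      then show ?thesis by (simp only: poly_fun_mult poly_fun_const poly_fun_coord)
    next
      case False
      then have "M x y = (\<lambda>a. 0)" by (simp only: M_def False if_False)
      then show ?thesis by (simp only: poly_fun_const)
    qed
    show "M x y (cf (fermat (Suc d))) = (if x = y then of_nat (Suc d) else 0)" if "x \<in> X" for x y
    proof -
      have "mon (b x) * pd (j x) (fermat (Suc d)) = Const (of_nat (Suc d)) * mon x"
        by (simp only: pd_fermat mult.left_commute[of "mon _"] mult_single bj[OF that]) simp
      then show ?thesis by (simp only: M lookup_Const_mult) (simp add: lookup_single when_def)
    qed
  qed (simp del: of_nat_Suc)
  then obtain f where f: "poly_fun f" "f (cf (fermat (Suc d) :: 'm cpoly)) \<noteq> 0"
    and solve: "\<And>a r. f a \<noteq> 0 \<Longrightarrow> \<exists>s. \<forall>y\<in>X. (\<Sum>x\<in>X. s x * M x y a) = r y" by blast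
  have "partials_generate d e w" if w: "w \<in> Sym_forms (Suc d)" "f (cf w) \<noteq> 0" for w :: "'m cpoly"
    unfolding partials_generate_def
  proof
    fix P :: "'m cpoly" assume P: "P \<in> Sym_forms (e + d)"
    obtain s where s: "\<And>y. y \<in> X \<Longrightarrow> (\<Sum>x\<in>X. s x * M x y (cf w)) = cf P y"
      using solve[OF w(2)] by blast
    let ?Q = "\<Sum>x\<in>X. (Const (s x) * mon (b x)) * pd (j x) w"
    have bS: "Const (s x) * mon (b x) \<in> Sym_forms e" if "x \<in> X" for x
      by (intro Sym_forms_Const_mult Sym_forms_single degb that)
    have QS: "?Q \<in> Sym_forms (e + d)"
      using pd_Sym_forms[OF w(1)] by (intro Sym_forms_sum Sym_forms_mult bS) auto
    have "P = ?Q"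
    proof (rule poly_mapping_eqI)
      fix y show "cf P y = cf ?Q y"
      proof (cases "y \<in> X")
        case True
        then show ?thesis using s by (simp add: lookup_sum M mult.assoc)
      next
        case False
        then have "cf P y = 0" "cf ?Q y = 0" using Sym_formsD[OF P] Sym_formsD[OF QS] unfolding X_def by blast+
        then show ?thesis by simp
      qed
    qed
    also have "?Q = (\<Sum>i\<in>UNIV. \<Sum>x\<in>{x\<in>X. j x = i}. (Const (s x) * mon (b x)) * pd (j x) w)"
      by (rule sum.group[symmetric]) (auto simp: finX)
    also have "\<dots> = (\<Sum>i\<in>UNIV. (\<Sum>x\<in>{x\<in>X. j x = i}. Const (s x) * mon (b x)) * pd i w)"
      by (simp add: sum_distrib_right)
    finally show "\<exists>A. (\<forall>i. A i \<in> Sym_forms e) \<and> P = (\<Sum>i\<in>UNIV. A i * pd i w)"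
      by (intro exI[of _ "\<lambda>i. \<Sum>x\<in>{x\<in>X. j x = i}. Const (s x) * mon (b x)"]) (auto intro!: Sym_forms_sum bS)
  qed
  then show ?thesis using f by blast
qed

section \<open>A dimension count on coordinate subspaces\<close>

interpretation cpoly: vector_space "\<lambda>c (P :: 'v cpoly). Const c * P"
  by unfold_locales (auto simp: algebra_simps Const_add Const_mult)

lemma independent_monomials: "\<not> cpoly.dependent (mon ` (A :: 'v monom set))"
proof
  assume "cpoly.dependent (mon ` A)"
  then obtain t u where t: "finite t" "t \<subseteq> mon ` A" "(\<Sum>v\<in>t. Const (u v) * v) = 0" "\<exists>v\<in>t. u v \<noteq> 0"
    unfolding cpoly.dependent_explicit by blast
  then obtain \<alpha> where \<alpha>: "mon \<alpha> \<in> t" "u (mon \<alpha>) \<noteq> 0" by blast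
  have inj: "mon \<beta> = mon \<alpha> \<longleftrightarrow> \<beta> = \<alpha>" for \<beta> :: "'v monom"
    by (metis lookup_single_eq lookup_single_not_eq zero_neq_one)
  have "u v * cf v \<alpha> = (if v = mon \<alpha> then u (mon \<alpha>) else 0)" if "v \<in> t" for v
  proof -
    have "v \<in> mon ` A" using that t(2) by (rule set_mp[rotated])
    then obtain \<beta> where "v = mon \<beta>" by (rule imageE)
    then show ?thesis by (auto simp: inj lookup_single when_def)
  qed
  then have "cf (\<Sum>v\<in>t. Const (u v) * v) \<alpha> = u (mon \<alpha>)"
    using \<alpha>(1) t(1) by (simp add: lookup_sum sum.delta)
  then show False using t(3) \<alpha>(2) by simp
qed

lemma span_mult_image:
  assumes "x \<in> cpoly.span S" "\<And>s. s \<in> S \<Longrightarrow> s * f \<in> cpoly.span T"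
  shows "x * f \<in> cpoly.span T"
proof (rule cpoly.span_induct[OF assms(1), where P = "\<lambda>x. x * f \<in> cpoly.span T"])
  show "cpoly.subspace {x. x * f \<in> cpoly.span T}"
    unfolding cpoly.subspace_def
    by (auto simp: distrib_right mult.assoc intro: cpoly.span_zero cpoly.span_add cpoly.span_scale)
qed (use assms(2) in auto)

lemma monom_split_degree:
  fixes \<alpha> :: "'m::finite monom"
  assumes "n \<le> mdeg \<alpha>"
  shows "\<exists>\<beta> \<gamma>. \<alpha> = \<beta> + \<gamma> \<and> mdeg \<beta> = n"
  using assms
proof (induction n)
  case 0
  then show ?case by (intro exI[of _ 0] exI[of _ \<alpha>]) simp
next
  case (Suc n)
  then obtain \<beta> \<gamma> where bg: "\<alpha> = \<beta> + \<gamma>" "mdeg \<beta> = n" by auto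
  then have "mdeg \<gamma> \<noteq> 0" using Suc.prems by (auto simp: mdeg_add)
  then obtain i where i: "cf \<gamma> i \<noteq> 0" by (auto simp: mdeg_UNIV)
  have "\<gamma> = vexp i + (\<gamma> - vexp i)"
    by (rule poly_mapping_eqI) (use i in \<open>auto simp: lookup_add lookup_minus lookup_single when_def\<close>)
  then have "\<alpha> = (\<beta> + vexp i) + (\<gamma> - vexp i)" using bg by (metis add.assoc)
  then show ?case using bg(2) by (intro exI[of _ "\<beta> + vexp i"] exI[of _ "\<gamma> - vexp i"]) (auto simp: mdeg_add)
qed

text \<open>
  Setting the variables outside \<open>J\<close> to zero kills all partial derivatives except those indexed by \<open>H\<close>.
  A monomial of large degree on \<open>J\<close> is then a combination of multiples of these restricted derivatives,
  with cofactors of smaller degree. By induction all monomials of degree at most \<open>n\<close> on \<open>J\<close> lie in the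
  span of products of a monomial of bounded degree and powers of the restricted derivatives with
  exponents at most \<open>n\<close>. The monomials are linearly independent, so there are at most as many of them as
  such products.
\<close>

lemma partials_restrict_count:
  fixes w :: "'m::finite cpoly"
  assumes w: "partials_generate d e w" and d: "d \<ge> 1" and J: "J \<noteq> {}"
    and vanish: "\<And>i. i \<notin> H \<Longrightarrow> subst_cpoly (\<lambda>j. if j \<in> J then Var j else 0) (pd i w) = 0"
  shows "\<exists>C. \<forall>n. (n + 1) ^ card J \<le> C * (card J * n + 1) ^ card H"
proof -
  define \<rho> where "\<rho> = subst_cpoly (\<lambda>j. if j \<in> J then Var j else (0 :: 'm cpoly))"
  define f where "f i = \<rho> (pd i w)" for i
  define N where "N = e + d"
  define L where "L = {\<alpha> :: 'm monom. Poly_Mapping.keys \<alpha> \<subseteq> J}"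
  define T where "T n = (\<lambda>(\<beta>, a). mon \<beta> * (\<Prod>i\<in>H. f i ^ a i)) ` ({\<beta>. mdeg \<beta> \<le> N} \<times> PiE H (\<lambda>_. {..n}))" for n :: nat
  have \<rho>_mon: "\<rho> (mon \<alpha>) = (if \<alpha> \<in> L then mon \<alpha> else 0)" for \<alpha>
  proof (cases "\<alpha> \<in> L")
    case True
    then show ?thesis unfolding \<rho>_def
      by (simp add: subst_cpoly_single) (subst mon_eq_prod, rule prod.cong, auto simp: L_def)
  next
    case False
    then obtain i where i: "i \<in> Poly_Mapping.keys \<alpha>" "i \<notin> J" by (auto simp: L_def)
    then have "cf \<alpha> i \<noteq> 0" by (simp add: in_keys_iff)
    with i have "(\<Prod>j\<in>Poly_Mapping.keys \<alpha>. (if j \<in> J then Var j else (0 :: 'm cpoly)) ^ cf \<alpha> j) = 0"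
      by (intro prod_zero) (auto intro!: bexI[of _ i] zero_power)
    then show ?thesis using False unfolding \<rho>_def by (simp add: subst_cpoly_single)
  qed
  have T_mult: "s * f i \<in> cpoly.span (T (Suc n))" if sT: "s \<in> T n" and iH: "i \<in> H" for s i n
  proof -
    obtain p where p: "p \<in> {\<beta>. mdeg \<beta> \<le> N} \<times> PiE H (\<lambda>_. {..n})" "s = (\<lambda>(\<beta>, a). mon \<beta> * (\<Prod>i\<in>H. f i ^ a i)) p"
      using sT unfolding T_def by (rule imageE)
    obtain \<beta> a where "p = (\<beta>, a)" by (cases p)
    with p have ba: "s = mon \<beta> * (\<Prod>i\<in>H. f i ^ a i)" "mdeg \<beta> \<le> N" "a \<in> PiE H (\<lambda>_. {..n})"
      by simp_all
    have a': "a(i := Suc (a i)) \<in> PiE H (\<lambda>_. {..Suc n})"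
      using ba(3) iH by (auto simp: PiE_iff extensional_def le_Suc_eq)
    have "(\<Prod>k\<in>H. f k ^ (a(i := Suc (a i))) k) = f i ^ Suc (a i) * (\<Prod>k\<in>H - {i}. f k ^ a k)"
      using iH by (simp add: prod.remove[of H i])
    also have "\<dots> = (\<Prod>k\<in>H. f k ^ a k) * f i"
      using iH by (simp add: prod.remove[of H i] mult_ac)
    finally have "s * f i = mon \<beta> * (\<Prod>k\<in>H. f k ^ (a(i := Suc (a i))) k)"
      by (simp add: ba(1) mult.assoc)
    also have "\<dots> \<in> T (Suc n)"
      unfolding T_def using ba(2) a' by (intro image_eqI[of _ _ "(\<beta>, a(i := Suc (a i)))"]) auto
    finally show ?thesis by (rule cpoly.span_base)
  qed
  have T_low: "mon \<alpha> \<in> cpoly.span (T n)" if "mdeg \<alpha> \<le> N" for \<alpha> n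
  proof -
    have "mon \<alpha> = mon \<alpha> * (\<Prod>i\<in>H. f i ^ (restrict (\<lambda>_. 0) H) i)" by simp
    also have "\<dots> \<in> T n"
      unfolding T_def using that by (intro image_eqI[of _ _ "(\<alpha>, restrict (\<lambda>_. 0) H)"]) auto
    finally show ?thesis by (rule cpoly.span_base)
  qed
  have main: "\<alpha> \<in> L \<Longrightarrow> mdeg \<alpha> \<le> n \<Longrightarrow> mon \<alpha> \<in> cpoly.span (T n)" for \<alpha> n
  proof (induction n arbitrary: \<alpha>)
    case 0
    then show ?case by (intro T_low) auto
  next
    case (Suc n)
    show ?case
    proof (cases "mdeg \<alpha> \<le> N")
      case True
      then show ?thesis by (rule T_low)
    next
      case False
      then obtain \<beta> \<gamma> where bg: "\<alpha> = \<beta> + \<gamma>" "mdeg \<beta> = N" using monom_split_degree[of N \<alpha>] by auto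
      have bgL: "\<beta> \<in> L" "\<gamma> \<in> L" using Suc.prems(1) by (auto simp: L_def bg keys_add_monom)
      obtain A where A: "\<And>i. A i \<in> Sym_forms e" "mon \<beta> = (\<Sum>i\<in>UNIV. A i * pd i w)"
        using w bg(2) unfolding partials_generate_def N_def
        by (metis Sym_forms_single)
      have "mon \<beta> = \<rho> (mon \<beta>)" using bgL by (simp add: \<rho>_mon)
      also have "\<dots> = (\<Sum>i\<in>UNIV. \<rho> (A i) * f i)"
        by (simp add: A \<rho>_def f_def subst_cpoly_sum subst_cpoly_mult)
      also have "\<dots> = (\<Sum>i\<in>H. \<rho> (A i) * f i)"
        by (rule sum.mono_neutral_right) (use vanish in \<open>auto simp: f_def \<rho>_def\<close>)
      finally have "mon \<alpha> = (\<Sum>i\<in>H. mon \<gamma> * \<rho> (A i) * f i)"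
        by (simp add: bg(1) add.commute[of \<beta>] mult_single[of _ "1::complex" _ 1, simplified, symmetric] sum_distrib_left mult.assoc)
      moreover have "mon \<gamma> * \<rho> (A i) * f i \<in> cpoly.span (T (Suc n))" if "i \<in> H" for i
      proof (rule span_mult_image[of _ "T n"])
        have "mon \<gamma> * \<rho> (A i) = (\<Sum>\<delta>\<in>Poly_Mapping.keys (A i). Const (cf (A i) \<delta>) * (mon \<gamma> * \<rho> (mon \<delta>)))"
          by (subst cpoly_expand) (simp add: \<rho>_def subst_cpoly_sum subst_cpoly_mult sum_distrib_left mult_ac)
        also have "\<dots> \<in> cpoly.span (T n)"
        proof (intro cpoly.span_sum cpoly.span_scale)
          fix \<delta> assume "\<delta> \<in> Poly_Mapping.keys (A i)"
          then have "mdeg \<delta> = e" using A(1)[of i] by (auto simp: Sym_forms_def)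
          then have "mdeg (\<gamma> + \<delta>) \<le> n"
            using Suc.prems(2) bg d by (auto simp: mdeg_add N_def)
          then show "mon \<gamma> * \<rho> (mon \<delta>) \<in> cpoly.span (T n)"
            using Suc.IH[of "\<gamma> + \<delta>"] bgL
            by (auto simp: \<rho>_mon mult_single L_def keys_add_monom intro: cpoly.span_zero)
        qed
        finally show "mon \<gamma> * \<rho> (A i) \<in> cpoly.span (T n)" .
      qed (use that in \<open>auto intro: T_mult\<close>)
      ultimately show ?thesis by (simp add: cpoly.span_sum)
    qed
  qed
  define C where "C = card {\<beta> :: 'm monom. mdeg \<beta> \<le> N}"
  have finT: "finite (T n)" for n
    unfolding T_def by (intro finite_imageI finite_cartesian_product finite_mdeg_le finite_PiE) auto
  have cardT: "card (T n) \<le> C * (n + 1) ^ card H" for n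
  proof -
    have "card (T n) \<le> card ({\<beta> :: 'm monom. mdeg \<beta> \<le> N} \<times> PiE H (\<lambda>_. {..n}))"
      unfolding T_def by (rule card_image_le) (intro finite_cartesian_product finite_mdeg_le finite_PiE, auto)
    also have "\<dots> = C * (n + 1) ^ card H"
      by (simp add: C_def card_cartesian_product card_PiE)
    finally show ?thesis .
  qed
  have "(n + 1) ^ card J \<le> C * (card J * n + 1) ^ card H" for n
  proof -
    define m where "m a = (\<Sum>i\<in>J. Poly_Mapping.single i (a i))" for a :: "'m \<Rightarrow> nat"
    have cfm: "cf (m a) j = (if j \<in> J then a j else 0)" for a j
      unfolding m_def lookup_sum lookup_single when_def by (simp add: sum.delta)
    let ?A = "m ` PiE J (\<lambda>_. {..n})"
    have "inj_on m (PiE J (\<lambda>_. {..n}))"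
    proof (rule inj_onI)
      fix a b assume ab: "a \<in> PiE J (\<lambda>_. {..n})" "b \<in> PiE J (\<lambda>_. {..n})" "m a = m b"
      then have "a j = b j" if "j \<in> J" for j using cfm[of a j] cfm[of b j] that by simp
      then show "a = b" using ab by (intro PiE_ext)
    qed
    then have cardA: "card ?A = (n + 1) ^ card J" by (simp add: card_image card_PiE)
    have inj: "inj_on mon ?A"
      by (rule inj_onI) (metis lookup_single_eq lookup_single_not_eq zero_neq_one)
    have "mon ` ?A \<subseteq> cpoly.span (T (card J * n))"
    proof clarify
      fix a assume a: "a \<in> PiE J (\<lambda>_. {..n})"
      have "mdeg (m a) = (\<Sum>i\<in>J. a i)" by (simp add: mdeg_UNIV cfm sum.If_cases)
      also have "\<dots> \<le> card J * n" using sum_bounded_above[of J a n] a by (auto simp: PiE_iff)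
      finally show "mon (m a) \<in> cpoly.span (T (card J * n))"
        by (intro main) (auto simp: L_def in_keys_iff cfm split: if_splits)
    qed
    then have "card (mon ` ?A) \<le> card (T (card J * n))"
      using cpoly.independent_span_bound[OF finT independent_monomials] by blast
    then show ?thesis using cardT[of "card J * n"] by (simp add: card_image[OF inj] cardA)
  qed
  then show ?thesis by blast
qed

text \<open>
  If no such monomial occurred, the derivatives indexed by \<open>I\<close> would vanish on the coordinate subspace
  of \<open>J\<close>. The number of remaining derivatives is less than \<open>card J\<close>, and then the bound of
  \<open>partials_restrict_count\<close> grows too slowly in \<open>n\<close>.
\<close>

lemma nonzero_mixed_coefficient:
  fixes w :: "'m::finite cpoly"
  assumes w: "partials_generate d e w" "w \<in> Sym_forms (Suc d)" and d: "d \<ge> 1"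
    and IJ: "card I + card J > CARD('m)"
  shows "\<exists>i\<in>I. \<exists>\<beta>. Poly_Mapping.keys \<beta> \<subseteq> J \<and> mdeg \<beta> = d \<and> cf w (\<beta> + vexp i) \<noteq> 0"
proof (rule ccontr)
  assume neg: "\<not> ?thesis"
  let ?\<sigma> = "\<lambda>j. if j \<in> J then Var j else (0 :: 'm cpoly)"
  have "card I \<le> CARD('m)" by (rule card_mono) auto
  then have k: "card J \<ge> 1" using IJ by linarith
  then have J: "J \<noteq> {}" by auto
  have "subst_cpoly ?\<sigma> (pd i w) = 0" if "i \<notin> - I" for i
    unfolding subst_cpoly_def
  proof (rule sum.neutral, rule ballI)
    fix \<beta> assume \<beta>: "\<beta> \<in> Poly_Mapping.keys (pd i w)"
    then have nz: "cf w (\<beta> + vexp i) \<noteq> 0" by (auto simp: in_keys_iff lookup_pd)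
    have "mdeg \<beta> = d" using pd_Sym_forms[OF w(2), of i] \<beta> by (auto simp: Sym_forms_def)
    then have "\<not> Poly_Mapping.keys \<beta> \<subseteq> J" using neg nz that by auto
    then obtain j where j: "j \<in> Poly_Mapping.keys \<beta>" "j \<notin> J" by auto
    then have "cf \<beta> j \<noteq> 0" by (simp add: in_keys_iff)
    with j have "(\<Prod>j\<in>Poly_Mapping.keys \<beta>. ?\<sigma> j ^ cf \<beta> j) = 0"
      by (intro prod_zero) (auto intro!: bexI[of _ j] zero_power)
    then show "Const (cf (pd i w) \<beta>) * (\<Prod>j\<in>Poly_Mapping.keys \<beta>. ?\<sigma> j ^ cf \<beta> j) = 0" by simp
  qed
  from partials_restrict_count[OF w(1) d J this]
  obtain C where C: "\<And>n. (n + 1) ^ card J \<le> C * (card J * n + 1) ^ card (- I)" by blast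
  obtain k where k: "card J = Suc k" using k by (cases "card J") auto
  have H: "card (- I) \<le> k" using IJ k by (simp add: Compl_eq_Diff_UNIV card_Diff_subset)
  \<comment> \<open>With this choice \<open>n * (n + 1) ^ k\<close> bounds a quantity that is at least \<open>(n + 1) ^ Suc k\<close>.\<close>
  define n where "n = C * Suc k ^ k"
  have "(n + 1) ^ Suc k \<le> C * (Suc k * n + 1) ^ card (- I)" using C[of n] k by simp
  also have "\<dots> \<le> C * (Suc k * (n + 1)) ^ k"
    using H by (intro mult_left_mono order_trans[OF power_increasing power_mono]) auto
  also have "\<dots> = n * (n + 1) ^ k" by (simp only: n_def power_mult_distrib mult.assoc)
  also have "\<dots> < (n + 1) ^ Suc k" by simp
  finally show False by simp
qed

section \<open>Extending homomorphisms into the complex numbers to valuation rings\<close>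

text \<open>
  The graph of a ring homomorphism from a subring of \<open>'k\<close> to the complex numbers. Encoded as a
  subring of the product that is single-valued at \<open>0\<close>, hence everywhere, such homomorphisms are ordered
  by inclusion and unions of chains are of the same kind.
\<close>

definition partial_hom :: "('k::field \<times> complex) set \<Rightarrow> bool" where
  "partial_hom r \<longleftrightarrow> (1, 1) \<in> r \<and>
     (\<forall>x a y b. (x, a) \<in> r \<longrightarrow> (y, b) \<in> r \<longrightarrow> (x + y, a + b) \<in> r \<and> (x * y, a * b) \<in> r) \<and>
     (\<forall>x a. (x, a) \<in> r \<longrightarrow> (- x, - a) \<in> r) \<and> (\<forall>b. (0, b) \<in> r \<longrightarrow> b = 0)"

context
  fixes r :: "('k::field \<times> complex) set"
  assumes r: "partial_hom r"
begin

lemma ph_one: "(1, 1) \<in> r" using r by (simp add: partial_hom_def)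
lemma ph_add: "(x, a) \<in> r \<Longrightarrow> (y, b) \<in> r \<Longrightarrow> (x + y, a + b) \<in> r" using r unfolding partial_hom_def by blast
lemma ph_mult: "(x, a) \<in> r \<Longrightarrow> (y, b) \<in> r \<Longrightarrow> (x * y, a * b) \<in> r" using r unfolding partial_hom_def by blast
lemma ph_uminus: "(x, a) \<in> r \<Longrightarrow> (- x, - a) \<in> r" using r unfolding partial_hom_def by blast
lemma ph_diff: "(x, a) \<in> r \<Longrightarrow> (y, b) \<in> r \<Longrightarrow> (x - y, a - b) \<in> r"
  using ph_add[OF _ ph_uminus] by fastforce
lemma ph_zero: "(0, 0) \<in> r" using ph_diff[OF ph_one ph_one] by simp
lemma ph_zero_unique: "(0, b) \<in> r \<Longrightarrow> b = 0" using r unfolding partial_hom_def by blast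
lemma ph_unique: "(x, a) \<in> r \<Longrightarrow> (x, b) \<in> r \<Longrightarrow> a = b"
  using ph_diff[of x a x b] ph_zero_unique by force
lemma ph_sum: "(\<And>i. i \<in> I \<Longrightarrow> (f i, g i) \<in> r) \<Longrightarrow> (sum f I, sum g I) \<in> r"
  by (induction I rule: infinite_finite_induct) (auto intro: ph_zero ph_add)
lemma ph_prod: "(\<And>i. i \<in> I \<Longrightarrow> (f i, g i) \<in> r) \<Longrightarrow> (prod f I, prod g I) \<in> r"
  by (induction I rule: infinite_finite_induct) (auto intro: ph_one ph_mult)
lemma ph_power: "(x, a) \<in> r \<Longrightarrow> (x ^ n, a ^ n) \<in> r"
  by (induction n) (auto intro: ph_one ph_mult)

text \<open>
  Elements with nonzero image may be inverted.
\<close>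

lemma partial_hom_localize:
  assumes ac: "(x, c) \<in> r" "c \<noteq> 0"
  shows "\<exists>r'. partial_hom r' \<and> r \<subseteq> r' \<and> (inverse x, inverse c) \<in> r'"
proof -
  have x: "x \<noteq> 0" using ac ph_zero_unique by blast
  define r' where "r' = {(y / x ^ n, b / c ^ n) | y b n. (y, b) \<in> r}"
  have r'I: "(y / x ^ n, b / c ^ n) \<in> r'" if "(y, b) \<in> r" for y b n using that r'_def by blast
  have "partial_hom r'"
    unfolding partial_hom_def
  proof (intro conjI allI impI)
    show "(1, 1) \<in> r'" using r'I[OF ph_one, of 0] by simp
    show "(- y, - a) \<in> r'" if ya: "(y, a) \<in> r'" for y a
    proof -
      obtain z b n where zb: "y = z / x ^ n" "a = b / c ^ n" "(z, b) \<in> r" using ya unfolding r'_def by blast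
      then show ?thesis using r'I[OF ph_uminus[OF zb(3)], of n] by simp
    qed
    show "b = 0" if "(0, b) \<in> r'" for b
      using that x ph_zero_unique unfolding r'_def by auto
    fix y a y' a' assume "(y, a) \<in> r'" "(y', a') \<in> r'"
    then obtain z b n z' b' n' where zb: "y = z / x ^ n" "a = b / c ^ n" "(z, b) \<in> r"
      and zb': "y' = z' / x ^ n'" "a' = b' / c ^ n'" "(z', b') \<in> r" unfolding r'_def by blast
    show "(y * y', a * a') \<in> r'"
      using r'I[OF ph_mult[OF zb(3) zb'(3)], of "n + n'"] by (simp add: zb zb' power_add)
    have "(z * x ^ n' + z' * x ^ n, b * c ^ n' + b' * c ^ n) \<in> r"
      by (intro ph_add ph_mult ph_power zb zb' ac)
    from r'I[OF this, of "n + n'"] show "(y + y', a + a') \<in> r'"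
      using x ac(2) by (simp add: zb zb' power_add add_divide_distrib)
  qed
  moreover have "r \<subseteq> r'" using r'I[of _ _ 0] by auto
  moreover have "(inverse x, inverse c) \<in> r'" using r'I[OF ph_one, of 1] by (simp add: divide_inverse)
  ultimately show ?thesis by blast
qed

text \<open>
  The obstruction to extending the homomorphism to \<open>x\<close>: the kernel generates the unit ideal after \<open>x\<close>
  has been adjoined, with a witness of degree at most \<open>n\<close>.
\<close>

definition kernel_one :: "'k \<Rightarrow> nat \<Rightarrow> bool" where
  "kernel_one x n \<longleftrightarrow> (\<exists>p. (\<forall>i\<le>n. (p i, 0) \<in> r) \<and> (\<Sum>i\<le>n. p i * x ^ i) = 1)"

text \<open>
  The value \<open>z\<close> given to \<open>x\<close> must be a root of the image of every polynomial that vanishes at \<open>x\<close>.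
  These images form an ideal over the image of the homomorphism, which is a field, so they are the
  multiples of an element of least degree. That element is not a nonzero constant, because this would
  be the obstruction \<open>kernel_one\<close>; hence it is zero or has a complex root.
\<close>

lemma partial_hom_adjoin:
  assumes inv: "\<And>y c. (y, c) \<in> r \<Longrightarrow> c \<noteq> 0 \<Longrightarrow> (inverse y, inverse c) \<in> r"
    and x: "\<And>n. \<not> kernel_one x n"
  shows "\<exists>r'. partial_hom r' \<and> r \<subseteq> r' \<and> x \<in> Domain r'"
proof -
  define pr where "pr p q \<longleftrightarrow> (\<forall>i. (coeff p i, coeff q i) \<in> r)" for p q
  have pr_add: "pr (p + p') (q + q')" if "pr p q" "pr p' q'" for p q p' q'
    using that unfolding pr_def by (auto intro: ph_add)
  have pr_diff: "pr (p - p') (q - q')" if "pr p q" "pr p' q'" for p q p' q'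
    using that unfolding pr_def by (auto intro: ph_diff)
  have pr_mult: "pr (p * p') (q * q')" if "pr p q" "pr p' q'" for p q p' q'
    using that unfolding pr_def by (auto simp: coeff_mult intro!: ph_sum ph_mult)
  have pr_monom: "pr (monom y n) (monom b n)" if "(y, b) \<in> r" for y b n
    using that unfolding pr_def by (auto intro: ph_zero)
  define J where "J = {q. \<exists>p. pr p q \<and> poly p x = 0}"
  have J_const: "degree q \<noteq> 0" if qJ: "q \<in> J" and q0: "q \<noteq> 0" for q
  proof
    assume deg: "degree q = 0"
    obtain p where p: "pr p q" "poly p x = 0" using qJ unfolding J_def by blast
    define c where "c = coeff q 0"
    have c: "c \<noteq> 0" using deg q0 unfolding c_def by (metis leading_coeff_0_iff)
    have qi: "coeff q i = (if i = 0 then c else 0)" for i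
      using deg by (auto simp: c_def coeff_eq_0)
    have p0: "(coeff p 0, c) \<in> r" using p(1) qi[of 0] unfolding pr_def by metis
    \<comment> \<open>Dividing by the constant coefficient makes the image polynomial equal to \<open>1\<close>, so that the
      negatives of the other coefficients witness the obstruction.\<close>
    define u where "u = inverse (coeff p 0)"
    have u: "(u, inverse c) \<in> r" unfolding u_def using inv[OF p0 c] .
    have pnz: "coeff p 0 \<noteq> 0" using p0 c ph_zero_unique by metis
    define s where "s i = (if i = 0 then 0 else - (u * coeff p i))" for i
    have "(s i, 0) \<in> r" for i
    proof (cases "i = 0")
      case False
      then have "(coeff p i, 0) \<in> r" using p(1) qi[of i] unfolding pr_def by metis
      from ph_uminus[OF ph_mult[OF u this]] show ?thesis using False by (simp add: s_def)
    qed (simp add: s_def ph_zero)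
    moreover have "(\<Sum>i\<le>degree p. s i * x ^ i) = 1"
    proof -
      have "0 = u * (\<Sum>i\<le>degree p. coeff p i * x ^ i)" using p(2) by (simp add: poly_altdef)
      also have "\<dots> = (\<Sum>i\<le>degree p. (if i = 0 then 1 else 0) - s i * x ^ i)"
        unfolding sum_distrib_left using pnz by (intro sum.cong) (auto simp: s_def u_def)
      also have "\<dots> = 1 - (\<Sum>i\<le>degree p. s i * x ^ i)"
        by (simp add: sum_subtractf)
      finally show ?thesis by simp
    qed
    ultimately show False using x[of "degree p"] unfolding kernel_one_def by blast
  qed
  \<comment> \<open>If only the zero polynomial occurs then \<open>x\<close> may be sent anywhere; \<open>0\<close> is as good as any.\<close>
  obtain z where z: "\<And>q. q \<in> J \<Longrightarrow> poly q z = 0"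
  proof (cases "\<exists>q\<in>J. q \<noteq> 0")
    case False
    then show ?thesis using that[of 0] by (metis poly_0)
  next
    case True
    then obtain q0 where q0: "q0 \<in> J" "q0 \<noteq> 0" "\<And>q. q \<in> J \<Longrightarrow> q \<noteq> 0 \<Longrightarrow> degree q0 \<le> degree q"
      using ex_has_least_nat[of "\<lambda>q. q \<in> J \<and> q \<noteq> 0" _ degree] by blast
    then have "degree q0 \<noteq> 0" using J_const by blast
    then obtain z where z: "poly q0 z = 0"
      using fundamental_theorem_of_algebra[of q0] constant_degree[of q0] by auto
    obtain p0 where p0: "pr p0 q0" "poly p0 x = 0" using q0(1) unfolding J_def by blast
    have "poly q z = 0" if "q \<in> J" for q
      using that
    proof (induction "degree q" arbitrary: q rule: less_induct)
      case less
      show ?case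
      proof (cases "q = 0")
        case False
        obtain p where p: "pr p q" "poly p x = 0" using less.prems unfolding J_def by blast
        define k where "k = degree q - degree q0"
        have dq: "degree q = k + degree q0" using q0(3)[OF less.prems False] unfolding k_def by simp
        obtain y where y: "(y, lead_coeff q) \<in> r" using p unfolding pr_def by blast
        have l0: "(coeff p0 (degree q0), lead_coeff q0) \<in> r" using p0 unfolding pr_def by blast
        have l0': "(inverse (coeff p0 (degree q0)), inverse (lead_coeff q0)) \<in> r"
          using inv[OF l0] q0(2) by simp
        \<comment> \<open>One step of polynomial division, performed on the polynomial and on its image simultaneously.\<close>
        let ?m = "monom (y * inverse (coeff p0 (degree q0))) k" and ?m' = "monom (lead_coeff q * inverse (lead_coeff q0)) k"
        have "pr (p - ?m * p0) (q - ?m' * q0)"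
          by (intro pr_diff pr_mult pr_monom p p0 ph_mult y l0')
        then have J': "q - ?m' * q0 \<in> J" unfolding J_def using p p0 by (intro CollectI exI[of _ "p - ?m * p0"]) auto
        have "poly (q - ?m' * q0) z = 0"
        proof (cases "q - ?m' * q0 = 0")
          case neq: False
          have "degree (?m' * q0) \<le> degree q"
            using degree_mult_le[of ?m' q0] degree_monom_le[of "lead_coeff q * inverse (lead_coeff q0)" k] dq by linarith
          then have le: "degree (q - ?m' * q0) \<le> degree q" by (intro degree_diff_le) auto
          have "coeff (q - ?m' * q0) (degree q) = 0"
            using q0(2) by (simp add: dq coeff_monom_mult)
          then have "degree (q - ?m' * q0) \<noteq> degree q" using neq by (metis leading_coeff_0_iff)
          then show ?thesis using le less.hyps[OF _ J'] by simp
        qed simp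
        then show ?thesis using z by simp
      qed simp
    qed
    then show ?thesis by (rule that)
  qed
  define r' where "r' = {(poly p x, poly q z) | p q. pr p q}"
  have r'I: "(poly p x, poly q z) \<in> r'" if "pr p q" for p q using that r'_def by blast
  have "partial_hom r'"
    unfolding partial_hom_def
  proof (intro conjI allI impI)
    show "(1, 1) \<in> r'" using r'I[OF pr_monom[OF ph_one, of 0]] by (simp add: poly_monom)
    show "(- y, - a) \<in> r'" if ya: "(y, a) \<in> r'" for y a
    proof -
      obtain p q where pq: "y = poly p x" "a = poly q z" "pr p q" using ya unfolding r'_def by blast
      have "pr (0 - p) (0 - q)"
        using pr_diff[OF _ pq(3), of 0 0] by (simp add: pr_def ph_zero)
      from r'I[OF this] show ?thesis by (simp add: pq)
    qed
    show "b = 0" if b: "(0, b) \<in> r'" for b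
    proof -
      obtain p q where pq: "0 = poly p x" "b = poly q z" "pr p q" using b unfolding r'_def by blast
      then have "q \<in> J" unfolding J_def by auto
      then show ?thesis using z pq by simp
    qed
    fix y a y' a' assume "(y, a) \<in> r'" "(y', a') \<in> r'"
    then obtain p q p' q' where pq: "y = poly p x" "a = poly q z" "pr p q"
      and pq': "y' = poly p' x" "a' = poly q' z" "pr p' q'" unfolding r'_def by blast
    show "(y + y', a + a') \<in> r'" using r'I[OF pr_add[OF pq(3) pq'(3)]] by (simp add: pq pq')
    show "(y * y', a * a') \<in> r'" using r'I[OF pr_mult[OF pq(3) pq'(3)]] by (simp add: pq pq')
  qed
  moreover have "r \<subseteq> r'"
  proof clarify
    fix y b assume "(y, b) \<in> r"
    from r'I[OF pr_monom[OF this, of 0]] show "(y, b) \<in> r'" by (simp add: poly_monom)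
  qed
  moreover have "x \<in> Domain r'"
    using r'I[OF pr_monom[OF ph_one, of 1]] by (auto simp: poly_monom)
  ultimately show ?thesis by blast
qed

text \<open>
  The relation for \<open>inverse x\<close>, multiplied by \<open>x\<^sup>n\<close>, expresses \<open>x\<^sup>n\<close> by smaller powers of \<open>x\<close> with
  coefficients in the kernel. Substituting this for the leading term lowers the degree of the relation
  for \<open>x\<close>.
\<close>

lemma kernel_one_descent:
  assumes inv: "\<And>y c. (y, c) \<in> r \<Longrightarrow> c \<noteq> 0 \<Longrightarrow> (inverse y, inverse c) \<in> r"
    and x: "x \<noteq> 0" and n: "kernel_one x n" and m: "kernel_one (inverse x) m" and mn: "m \<le> n"
  shows "n > 0 \<and> kernel_one x (n - 1)"
proof -
  obtain p where p: "\<And>i. i \<le> n \<Longrightarrow> (p i, 0) \<in> r" "(\<Sum>i\<le>n. p i * x ^ i) = 1"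
    using n unfolding kernel_one_def by blast
  obtain q where q: "\<And>i. i \<le> m \<Longrightarrow> (q i, 0) \<in> r" "(\<Sum>i\<le>m. q i * inverse x ^ i) = 1"
    using m unfolding kernel_one_def by blast
  have "n \<noteq> 0"
  proof
    assume "n = 0"
    then have "(1, 0) \<in> r" using p(1)[of 0] p(2) by simp
    from ph_unique[OF ph_one this] show False by simp
  qed
  then obtain k where k: "n = Suc k" by (cases n) auto
  define u where "u = inverse (1 - q 0)"
  have u1: "(1 - q 0, 1) \<in> r" using ph_diff[OF ph_one q(1)[of 0]] by simp
  then have u: "(u, 1) \<in> r" unfolding u_def using inv[OF u1] by simp
  have u0: "1 - q 0 \<noteq> 0"
  proof
    assume "1 - q 0 = 0"
    then have "(0, 1) \<in> r" using u1 by simp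
    from ph_zero_unique[OF this] show False by simp
  qed
  define s where "s j = (if j \<le> m then q j * u else 0)" for j
  have s: "(s j, 0) \<in> r" for j
    using ph_mult[OF q(1) u] ph_zero by (auto simp: s_def)
  have "(\<Sum>j\<le>m. q j * inverse x ^ j) = q 0 + (\<Sum>j\<in>{1..m}. q j * inverse x ^ j)"
  proof -
    have "{..m} - {0} = {1..m}" by auto
    then show ?thesis using sum.remove[of "{..m}" 0 "\<lambda>j. q j * inverse x ^ j"] by simp
  qed
  then have "(\<Sum>j\<in>{1..m}. q j * inverse x ^ j) = 1 - q 0" using q(2) by (simp add: algebra_simps)
  then have "(\<Sum>j\<in>{1..m}. q j * inverse x ^ j) * u = 1" using u0 by (simp add: u_def)
  then have "1 = (\<Sum>j\<in>{1..m}. q j * inverse x ^ j * u)" by (simp only: sum_distrib_right)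
  also have "\<dots> = (\<Sum>j\<in>{1..m}. s j * inverse x ^ j)"
    by (rule sum.cong) (auto simp: s_def)
  also have "\<dots> = (\<Sum>j\<in>{1..n}. s j * inverse x ^ j)"
    by (rule sum.mono_neutral_left) (use mn in \<open>auto simp: s_def\<close>)
  also have "\<dots> = (\<Sum>j<n. s (Suc j) * inverse x ^ Suc j)"
    by (rule sum.reindex_bij_witness[of _ Suc "\<lambda>j. j - 1"]) auto
  also have "\<dots> = (\<Sum>i<n. s (n - i) * inverse x ^ (n - i))"
    by (rule sum.reindex_bij_witness[of _ "\<lambda>i. n - Suc i" "\<lambda>i. n - Suc i"]) (auto simp: Suc_diff_Suc)
  finally have "x ^ n = x ^ n * (\<Sum>i<n. s (n - i) * inverse x ^ (n - i))" by simp
  also have "\<dots> = (\<Sum>i<n. s (n - i) * (x ^ n * inverse x ^ (n - i)))"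
    unfolding sum_distrib_left by (intro sum.cong) (auto simp only: mult.left_commute)
  also have "\<dots> = (\<Sum>i<n. s (n - i) * x ^ i)"
  proof (rule sum.cong)
    fix i assume i: "i \<in> {..<n}"
    then have "x ^ n = x ^ i * x ^ (n - i)" by (simp flip: power_add)
    then show "s (n - i) * (x ^ n * inverse x ^ (n - i)) = s (n - i) * x ^ i"
      using x by (simp add: power_inverse)
  qed simp
  finally have xn: "x ^ n = (\<Sum>i<n. s (n - i) * x ^ i)" .
  \<comment> \<open>The summands \<open>p n * s (n - i)\<close> replace the leading term \<open>p n * x ^ n\<close>.\<close>
  define p' where "p' i = p i + p n * s (n - i)" for i
  have "(p' i, 0) \<in> r" if "i \<le> n" for i
    using ph_add[OF p(1)[OF that] ph_mult[OF p(1)[of n] s]] by (simp add: p'_def)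
  moreover have "(\<Sum>i\<le>k. p' i * x ^ i) = 1"
  proof -
    have "(\<Sum>i\<le>k. p' i * x ^ i) = (\<Sum>i<n. p i * x ^ i) + p n * (\<Sum>i<n. s (n - i) * x ^ i)"
      by (simp add: p'_def k lessThan_Suc_atMost sum.distrib sum_distrib_left algebra_simps)
    also have "\<dots> = (\<Sum>i\<le>n. p i * x ^ i)"
      by (simp add: xn[symmetric] flip: lessThan_Suc_atMost)
    finally show ?thesis using p(2) by simp
  qed
  ultimately have "kernel_one x k" unfolding kernel_one_def using k by (intro exI[of _ p']) auto
  then show ?thesis using k by simp
qed

lemma kernel_one_not_both:
  assumes inv: "\<And>y c. (y, c) \<in> r \<Longrightarrow> c \<noteq> 0 \<Longrightarrow> (inverse y, inverse c) \<in> r"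
    and x: "x \<noteq> 0"
  shows "\<not> (kernel_one x n \<and> kernel_one (inverse x) m)"
proof (induction "n + m" arbitrary: n m rule: less_induct)
  case less
  show ?case
  proof
    assume a: "kernel_one x n \<and> kernel_one (inverse x) m"
    show False
    proof (cases "m \<le> n")
      case True
      then show False using kernel_one_descent[OF inv x] a less[of "n - 1" m] by fastforce
    next
      case False
      then show False
        using kernel_one_descent[OF inv, of "inverse x" m n] x a less[of n "m - 1"] by fastforce
    qed
  qed
qed

end

text \<open>
  A maximal extension, which exists by Zorn's lemma, is defined on a valuation ring: at most one of \<open>x\<close>
  and \<open>inverse x\<close> can be obstructed. Maximality also makes every element with nonzero image a unit.
\<close>

theorem partial_hom_extend_to_valuation_ring:
  fixes r0 :: "('k::field \<times> complex) set"
  assumes "partial_hom r0"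
  shows "\<exists>r. partial_hom r \<and> r0 \<subseteq> r \<and> (\<forall>x. x \<in> Domain r \<or> inverse x \<in> Domain r) \<and>
    (\<forall>x c. (x, c) \<in> r \<longrightarrow> c \<noteq> 0 \<longrightarrow> (inverse x, inverse c) \<in> r)"
proof -
  let ?A = "{r. partial_hom r \<and> r0 \<subseteq> r}"
  have "\<exists>M\<in>?A. \<forall>X\<in>?A. M \<subseteq> X \<longrightarrow> X = M"
  proof (rule subset_Zorn_nonempty)
    show "?A \<noteq> {}" using assms by blast
    fix \<C> assume ne: "\<C> \<noteq> {}" and chain: "subset.chain ?A \<C>"
    have ph: "partial_hom r" "r0 \<subseteq> r" if "r \<in> \<C>" for r
      using chain that unfolding subset.chain_def by auto
    have two: "\<exists>r\<in>\<C>. p \<in> r \<and> q \<in> r" if "p \<in> \<Union>\<C>" "q \<in> \<Union>\<C>" for p q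
      using chain that unfolding subset.chain_def by blast
    have "partial_hom (\<Union>\<C>)"
      unfolding partial_hom_def
    proof (intro conjI allI impI)
      show "(1, 1) \<in> \<Union>\<C>" using ne ph_one[OF ph(1)] by blast
      show "(- x, - a) \<in> \<Union>\<C>" if "(x, a) \<in> \<Union>\<C>" for x a using that ph_uminus[OF ph(1)] by blast
      show "b = 0" if "(0, b) \<in> \<Union>\<C>" for b using that ph_zero_unique[OF ph(1)] by blast
      fix x a y b assume "(x, a) \<in> \<Union>\<C>" "(y, b) \<in> \<Union>\<C>"
      from two[OF this] show "(x + y, a + b) \<in> \<Union>\<C>" "(x * y, a * b) \<in> \<Union>\<C>"
        using ph_add[OF ph(1)] ph_mult[OF ph(1)] by blast+
    qed
    then show "\<Union>\<C> \<in> ?A" using ne ph(2) by blast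
  qed
  then obtain r where r: "partial_hom r" "r0 \<subseteq> r"
    and max: "\<And>r'. partial_hom r' \<Longrightarrow> r \<subseteq> r' \<Longrightarrow> r' = r" by auto
  have inv: "(inverse y, inverse c) \<in> r" if "(y, c) \<in> r" "c \<noteq> 0" for y c
    using partial_hom_localize[OF r(1) that] max by blast
  have "x \<in> Domain r \<or> inverse x \<in> Domain r" for x
  proof (cases "x = 0")
    case True
    then show ?thesis using ph_zero[OF r(1)] by auto
  next
    case False
    then have "(\<forall>n. \<not> kernel_one r x n) \<or> (\<forall>n. \<not> kernel_one r (inverse x) n)"
      using kernel_one_not_both[OF r(1) inv False] by blast
    then show ?thesis using partial_hom_adjoin[OF r(1) inv] max by metis
  qed
  then show ?thesis using r inv by blast
qed

section \<open>Valuation rings: weights and Smith normal form\<close>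

definition valuation_ring :: "'k::field set \<Rightarrow> bool" where
  "valuation_ring R \<longleftrightarrow> 1 \<in> R \<and> (\<forall>x\<in>R. \<forall>y\<in>R. x + y \<in> R \<and> x * y \<in> R) \<and>
     (\<forall>x\<in>R. - x \<in> R) \<and> (\<forall>x. x \<in> R \<or> inverse x \<in> R)"

context
  fixes R :: "'k::field set"
  assumes R: "valuation_ring R"
begin

lemma vr_1: "1 \<in> R" using R unfolding valuation_ring_def by blast
lemma vr_add: "x \<in> R \<Longrightarrow> y \<in> R \<Longrightarrow> x + y \<in> R" using R unfolding valuation_ring_def by blast
lemma vr_mult: "x \<in> R \<Longrightarrow> y \<in> R \<Longrightarrow> x * y \<in> R" using R unfolding valuation_ring_def by blast
lemma vr_uminus: "x \<in> R \<Longrightarrow> - x \<in> R" using R unfolding valuation_ring_def by blast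
lemma vr_total: "x \<in> R \<or> inverse x \<in> R" using R unfolding valuation_ring_def by blast
lemma vr_0: "0 \<in> R" using vr_add[OF vr_1 vr_uminus[OF vr_1]] by simp
lemma vr_sum: "(\<And>i. i \<in> I \<Longrightarrow> f i \<in> R) \<Longrightarrow> sum f I \<in> R"
  by (induction I rule: infinite_finite_induct) (auto intro: vr_0 vr_add)
lemma vr_prod: "(\<And>i. i \<in> I \<Longrightarrow> f i \<in> R) \<Longrightarrow> prod f I \<in> R"
  by (induction I rule: infinite_finite_induct) (auto intro: vr_1 vr_mult)
lemma vr_power: "x \<in> R \<Longrightarrow> x ^ n \<in> R"
  by (induction n) (auto intro: vr_1 vr_mult)

text \<open>
  Valuation rings are integrally closed; roots of elements are all that is needed.
\<close>

lemma vr_root: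
  assumes "x ^ n \<in> R" "n \<ge> 1"
  shows "x \<in> R"
proof (rule ccontr)
  assume nx: "x \<notin> R"
  then have x: "x \<noteq> 0" using vr_0 by blast
  have inv: "inverse x \<in> R" using nx vr_total by blast
  obtain k where n: "n = Suc k" using assms(2) by (cases n) auto
  have "x ^ n * inverse x ^ k \<in> R" by (rule vr_mult[OF assms(1) vr_power[OF inv]])
  moreover have "x ^ n * inverse x ^ k = x * (x * inverse x) ^ k"
    by (simp only: n power_Suc power_mult_distrib mult_ac)
  ultimately show False using x nx by simp
qed

text \<open>
  Divisibility is a total preorder, so a finite set has an element of largest absolute value.
\<close>

lemma vr_dominant:
  assumes "finite X" "X \<noteq> {}"
  shows "\<exists>x\<in>X. \<forall>y\<in>X. \<exists>c\<in>R. y = c * x"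
  using assms
proof (induction X rule: finite_ne_induct)
  case (singleton x)
  have "x = 1 * x" by simp
  then show ?case using vr_1 by blast
next
  case (insert z X)
  then obtain x where x: "x \<in> X" "\<And>y. y \<in> X \<Longrightarrow> \<exists>c\<in>R. y = c * x" by blast
  show ?case
  proof (cases "\<exists>c\<in>R. z = c * x")
    case True
    then have "\<exists>c\<in>R. y = c * x" if "y \<in> insert z X" for y using x(2)[of y] that by blast
    then show ?thesis using x(1) by blast
  next
    case False
    have xz: "\<exists>c\<in>R. x = c * z"
    proof (cases "x = 0 \<or> z = 0")
      case True
      then show ?thesis
      proof
        assume "x = 0"
        then show ?thesis using vr_0 by (intro bexI[of _ 0]) simp_all
      next
        assume "z = 0"
        then have "z = 0 * x" by simp
        then show ?thesis using False vr_0 by blast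
      qed
    next
      case nz: False
      then have "z = (z * inverse x) * x" by simp
      then have "z * inverse x \<notin> R" using False by blast
      then have "inverse (z * inverse x) \<in> R" using vr_total by blast
      moreover have "x = inverse (z * inverse x) * z" using nz by simp
      ultimately show ?thesis by blast
    qed
    then obtain c where c: "c \<in> R" "x = c * z" by blast
    have "\<exists>c\<in>R. y = c * z" if y: "y \<in> insert z X" for y
    proof (cases "y = z")
      case True
      then have "y = 1 * z" by simp
      then show ?thesis using vr_1 by blast
    next
      case False
      then obtain b where "b \<in> R" "y = b * x" using x(2)[of y] y by blast
        with c have "b * c \<in> R" "y = b * c * z" using vr_mult by (simp_all add: mult.assoc)
      then show ?thesis by blast
    qed
    then show ?thesis by blast
  qed
qed

text \<open>
  The relation says that \<open>t y\<close> has at most the absolute value of \<open>t x\<close>: the enumeration is by decreasing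
  size.
\<close>

lemma vr_sorted_enumeration:
  assumes "finite S" "\<And>i. i \<in> S \<Longrightarrow> t i \<noteq> 0"
  shows "\<exists>xs. set xs = S \<and> distinct xs \<and> sorted_wrt (\<lambda>x y. t y * inverse (t x) \<in> R) xs"
  using assms
proof (induction S rule: finite_induct)
  case (insert x S)
  let ?le = "\<lambda>y x. t y * inverse (t x) \<in> R"
  obtain xs where xs: "set xs = S" "distinct xs" "sorted_wrt (\<lambda>x y. ?le y x) xs"
    using insert.IH[OF insert.prems[OF insertI2]] by blast
  have tr: "?le a c" if le: "?le a b" "?le b c" and b: "b \<in> insert x S" for a b c
  proof -
    have "t a * inverse (t b) * (t b * inverse (t c)) \<in> R" by (rule vr_mult[OF le])
    moreover have "t b \<noteq> 0" using insert.prems[OF b] .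
    then have "t a * inverse (t b) * (t b * inverse (t c)) = t a * inverse (t c)" by simp
    ultimately show ?thesis by metis
  qed
  have tot: "?le y z \<or> ?le z y" if "y \<in> insert x S" "z \<in> insert x S" for y z
    using vr_total[of "t y * inverse (t z)"] by (simp add: mult.commute)
  define ys where "ys = filter (\<lambda>y. ?le x y) xs @ x # filter (\<lambda>y. \<not> ?le x y) xs"
  have "set ys = insert x S" "distinct ys" using xs insert.hyps by (auto simp: ys_def)
  moreover have "sorted_wrt (\<lambda>x y. ?le y x) ys"
  proof -
    have low: "?le z x" if "z \<in> S" "\<not> ?le x z" for z using tot[of x z] that by blast
    have mid: "?le z y" if "y \<in> S" "?le x y" "z \<in> S" "\<not> ?le x z" for y z
      using tr[OF low[OF that(3,4)] that(2)] by simp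
    show ?thesis
      unfolding ys_def sorted_wrt_append sorted_wrt.simps set_filter list.set xs(1)
      by (intro conjI sorted_wrt_filter xs(3)) (use low mid in auto)
  qed
  ultimately show ?case by blast
qed auto

text \<open>
  Write \<open>\<bar>t\<bar>\<close> for the size of \<open>t\<close> and let \<open>\<tau> 0, \<dots>, \<tau> (m - 1)\<close> be the weights by decreasing size. The
  hypothesis for the first \<open>k + 1\<close> and the first \<open>m - k\<close> indices gives
  \<open>\<bar>\<tau> (m - 1 - k)\<bar> \<bar>\<tau> k\<bar>\<^sup>d \<le> 1\<close>, since replacing a weight by a later one only makes it smaller.
  Multiplying this with its mirror image for \<open>m - 1 - k\<close> yields \<open>\<bar>\<tau> k \<tau> (m - 1 - k)\<bar> \<le> 1\<close>. The product of
  these numbers over all \<open>k\<close> is the square of a unit, so each of them has size one. Dividing by it in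
  the first inequality leaves \<open>\<bar>\<tau> k\<bar>\<^sup>d\<^sup>-\<^sup>1 \<le> 1\<close>, and \<open>d \<ge> 2\<close> allows a root to be taken.
\<close>

lemma integral_weights:
  fixes t :: "'m::finite \<Rightarrow> 'k"
  assumes t0: "\<And>i. t i \<noteq> 0" and unit: "inverse (\<Prod>i\<in>UNIV. t i) \<in> R" and d: "d \<ge> 2"
    and mixed: "\<And>I J. card I + card J > CARD('m) \<Longrightarrow>
        \<exists>i\<in>I. \<exists>\<beta>. Poly_Mapping.keys \<beta> \<subseteq> J \<and> mdeg \<beta> = d \<and> t i * (\<Prod>j\<in>UNIV. t j ^ cf \<beta> j) \<in> R"
  shows "t i \<in> R"
proof -
  define m where "m = CARD('m)"
  obtain xs where xs: "set xs = (UNIV :: 'm set)" "distinct xs" "sorted_wrt (\<lambda>x y. t y * inverse (t x) \<in> R) xs"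
    using vr_sorted_enumeration[of UNIV t] t0 by auto
  have len: "length xs = m" using xs distinct_card[of xs] by (simp add: m_def)
  define \<tau> where "\<tau> k = t (xs ! k)" for k
  have \<tau>0: "\<tau> k \<noteq> 0" for k by (simp add: \<tau>_def t0)
  have mono: "\<tau> l * inverse (\<tau> k) \<in> R" if "k \<le> l" "l < m" for k l
  proof (cases "k = l")
    case True
    then show ?thesis using \<tau>0 vr_1 by simp
  next
    case False
    then show ?thesis using sorted_wrt_nth_less[OF xs(3), of k l] that len by (simp add: \<tau>_def)
  qed
  have idx: "\<exists>k<m. i = xs ! k" for i using xs(1) len by (metis UNIV_I in_set_conv_nth)
  \<comment> \<open>The indices up to \<open>k\<close> and up to \<open>m - Suc k\<close> number \<open>k + 1\<close> and \<open>m - k\<close>, one more than \<open>m\<close> together.\<close>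
  have key: "\<tau> (m - Suc k) * \<tau> k ^ d \<in> R" if k: "k < m" for k
  proof -
    define J where "J = (!) xs ` {..k}"
    define I where "I = (!) xs ` {..m - Suc k}"
    have inj: "inj_on ((!) xs) {..<m}" using xs(2) len by (auto simp: inj_on_def nth_eq_iff_index_eq)
    have "card J = k + 1" "card I = m - k"
      unfolding J_def I_def using k by (subst card_image; (auto intro: inj_on_subset[OF inj]))+
    then obtain i \<beta> where i: "i \<in> I" "Poly_Mapping.keys \<beta> \<subseteq> J" "mdeg \<beta> = d" "t i * (\<Prod>j\<in>UNIV. t j ^ cf \<beta> j) \<in> R"
      using mixed[of I J] k by (auto simp: m_def)
    obtain l where l: "l \<le> m - Suc k" "i = xs ! l" using i(1) unfolding I_def by auto
    have 1: "\<tau> (m - Suc k) * inverse (t i) \<in> R" using mono[of l "m - Suc k"] l k by (simp add: \<tau>_def)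
    have 2: "(\<Prod>j\<in>UNIV. (\<tau> k * inverse (t j)) ^ cf \<beta> j) \<in> R"
    proof (rule vr_prod)
      fix j
      show "(\<tau> k * inverse (t j)) ^ cf \<beta> j \<in> R"
      proof (cases "j \<in> J")
        case True
        then obtain l where "l \<le> k" "j = xs ! l" unfolding J_def by auto
        then show ?thesis using mono[of l k] k by (intro vr_power) (simp add: \<tau>_def)
      next
        case False
        then have "cf \<beta> j = 0" using i(2) by (auto simp: in_keys_iff)
        then show ?thesis by (simp add: vr_1)
      qed
    qed
    have "(\<Prod>j\<in>UNIV. (\<tau> k * inverse (t j)) ^ cf \<beta> j) * (\<Prod>j\<in>UNIV. t j ^ cf \<beta> j) = (\<Prod>j\<in>UNIV. \<tau> k ^ cf \<beta> j)"
      unfolding prod.distrib[symmetric] power_mult_distrib[symmetric] by (simp add: t0 mult.assoc)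
    also have "\<dots> = \<tau> k ^ d" unfolding i(3)[symmetric] mdeg_UNIV power_sum ..
    finally have 3: "(\<Prod>j\<in>UNIV. (\<tau> k * inverse (t j)) ^ cf \<beta> j) * (\<Prod>j\<in>UNIV. t j ^ cf \<beta> j) = \<tau> k ^ d" .
    have "(\<tau> (m - Suc k) * inverse (t i)) * ((\<Prod>j\<in>UNIV. (\<tau> k * inverse (t j)) ^ cf \<beta> j) * (t i * (\<Prod>j\<in>UNIV. t j ^ cf \<beta> j))) \<in> R"
      by (rule vr_mult[OF 1 vr_mult[OF 2 i(4)]])
    also have "(\<tau> (m - Suc k) * inverse (t i)) * ((\<Prod>j\<in>UNIV. (\<tau> k * inverse (t j)) ^ cf \<beta> j) * (t i * (\<Prod>j\<in>UNIV. t j ^ cf \<beta> j))) =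
      \<tau> (m - Suc k) * (inverse (t i) * t i) * ((\<Prod>j\<in>UNIV. (\<tau> k * inverse (t j)) ^ cf \<beta> j) * (\<Prod>j\<in>UNIV. t j ^ cf \<beta> j))"
      by (simp only: mult_ac)
    finally show ?thesis using 3 t0 by simp
  qed
  define s where "s k = \<tau> k * \<tau> (m - Suc k)" for k
  have s: "s k \<in> R" if k: "k < m" for k
  proof -
    have k': "m - Suc (m - Suc k) = k" "m - Suc k < m" using k by auto
    have "(\<tau> (m - Suc k) * \<tau> k ^ d) * (\<tau> k * \<tau> (m - Suc k) ^ d) \<in> R"
      by (rule vr_mult[OF key[OF k] key[OF k'(2), unfolded k'(1)]])
    then have "s k ^ Suc d \<in> R" by (simp add: s_def power_mult_distrib mult_ac)
    then show ?thesis by (rule vr_root) simp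
  qed
  have prod\<tau>: "(\<Prod>k<m. \<tau> k) = (\<Prod>i\<in>UNIV. t i)"
    unfolding \<tau>_def
  proof (rule prod.reindex_bij_betw)
    show "bij_betw ((!) xs) {..<m} UNIV"
      using bij_betw_nth[OF xs(2), of "{..<m}" UNIV] len xs(1) by simp
  qed
  have prods: "(\<Prod>k<m. s k) = (\<Prod>i\<in>UNIV. t i) ^ 2"
    unfolding s_def prod.distrib prod.nat_diff_reindex prod\<tau> by (simp add: power2_eq_square)
  have sinv: "inverse (s k) \<in> R" if k: "k < m" for k
  proof -
    let ?T = "\<Prod>i\<in>UNIV. t i" and ?Q = "\<Prod>l\<in>{..<m} - {k}. s l"
    have T0: "?T \<noteq> 0" using t0 by simp
    have s0: "s k \<noteq> 0" by (simp add: s_def \<tau>0)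
    have "(\<Prod>k<m. s k) = s k * ?Q" using k by (intro prod.remove) auto
    then have Q: "s k * ?Q = ?T ^ 2" using prods by metis
    have "?Q * inverse ?T ^ 2 = inverse (s k) * (s k * ?Q) * inverse ?T ^ 2" using s0 by simp
    also have "\<dots> = inverse (s k) * (?T * inverse ?T) ^ 2" by (simp only: Q power_mult_distrib mult.assoc)
    also have "\<dots> = inverse (s k)" using T0 by simp
    finally have "inverse (s k) = ?Q * inverse ?T ^ 2" by (rule sym)
    moreover have "?Q \<in> R" by (rule vr_prod) (use s in auto)
    ultimately show ?thesis using vr_mult vr_power[OF unit] by metis
  qed
  obtain k where k: "k < m" "i = xs ! k" using idx by blast
  have pow: "\<tau> k ^ d = \<tau> k * \<tau> k ^ (d - 1)" using d by (cases d) auto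
  have cancel: "(b * (a * c)) * inverse (a * b) = c" if "a \<noteq> 0" "b \<noteq> 0" for a b c :: 'k
    using that by (simp add: field_simps)
  have "(\<tau> (m - Suc k) * \<tau> k ^ d) * inverse (s k) = \<tau> k ^ (d - 1)"
    unfolding s_def pow by (rule cancel) (rule \<tau>0)+
  then have "\<tau> k ^ (d - 1) \<in> R" using vr_mult[OF key[OF k(1)] sinv[OF k(1)]] by metis
  then have "\<tau> k \<in> R" by (rule vr_root) (use d in simp)
  then show ?thesis using k by (simp add: \<tau>_def)
qed

end

definition GL_over :: "'k::field set \<Rightarrow> 'k ^ 'm ^ 'm::finite \<Rightarrow> bool" where
  "GL_over R P \<longleftrightarrow> (\<exists>P'. (\<forall>i j. P $ i $ j \<in> R) \<and> (\<forall>i j. P' $ i $ j \<in> R) \<and> P ** P' = mat 1 \<and> P' ** P = mat 1)"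

text \<open>
  Left multiplication adds \<open>c i\<close> times row \<open>s\<close> to each other row \<open>i\<close>; the transpose acts on columns.
\<close>

definition row_add :: "'m \<Rightarrow> ('m \<Rightarrow> 'k) \<Rightarrow> 'k::field ^ 'm ^ 'm::finite" where
  "row_add s c = (\<chi> i j. if i = j then 1 else if j = s then c i else 0)"

definition row_permute :: "('m \<Rightarrow> 'm) \<Rightarrow> 'k::field ^ 'm ^ 'm::finite" where
  "row_permute \<pi> = (\<chi> i j. if \<pi> i = j then 1 else 0)"

lemma row_add_mult: "(row_add s c ** M) $ i $ j = M $ i $ j + (if i = s then 0 else c i * M $ s $ j)"
proof -
  have "row_add s c $ i $ k * M $ k $ j =
      (if k = i then M $ i $ j else 0) + (if k = s then (if i = s then 0 else c i * M $ s $ j) else 0)" for k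
    by (auto simp: row_add_def)
  then have "(row_add s c ** M) $ i $ j = (\<Sum>k\<in>UNIV.
      (if k = i then M $ i $ j else 0) + (if k = s then (if i = s then 0 else c i * M $ s $ j) else 0))"
    by (simp only: matrix_matrix_mult_def vec_lambda_beta)
  then show ?thesis by (simp add: sum.distrib)
qed

lemma row_permute_mult: "(row_permute \<pi> ** M) $ i $ j = M $ (\<pi> i) $ j"
proof -
  have "row_permute \<pi> $ i $ k * M $ k $ j = (if k = \<pi> i then M $ (\<pi> i) $ j else 0)" for k
    by (auto simp: row_permute_def)
  then have "(row_permute \<pi> ** M) $ i $ j = (\<Sum>k\<in>UNIV. if k = \<pi> i then M $ (\<pi> i) $ j else 0)"
    by (simp only: matrix_matrix_mult_def vec_lambda_beta)
  then show ?thesis by simp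
qed

lemma mult_transpose_row_add:
  "(M ** transpose (row_add s c)) $ i $ j = M $ i $ j + (if j = s then 0 else c j * M $ i $ s)"
proof -
  have "M ** transpose (row_add s c) = transpose (row_add s c ** transpose M)"
    by (simp add: matrix_transpose_mul)
  then show ?thesis by (simp add: transpose_def row_add_mult)
qed

lemma mult_transpose_row_permute: "(M ** transpose (row_permute \<pi>)) $ i $ j = M $ i $ (\<pi> j)"
proof -
  have "M ** transpose (row_permute \<pi>) = transpose (row_permute \<pi> ** transpose M)"
    by (simp add: matrix_transpose_mul)
  then show ?thesis by (simp add: transpose_def row_permute_mult)
qed

definition diagonal_on :: "'m set \<Rightarrow> 'k::field ^ 'm ^ 'm::finite \<Rightarrow> bool" where
  "diagonal_on S B \<longleftrightarrow> (\<forall>i j. i \<noteq> j \<longrightarrow> i \<in> S \<or> j \<in> S \<longrightarrow> B $ i $ j = 0)"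

lemma diagonal_on_permute:
  fixes B :: "'k::field ^ 'm ^ 'm::finite"
  assumes B: "diagonal_on S B" and ps: "p \<notin> S" "q \<notin> S" "s \<notin> S"
  shows "diagonal_on S (row_permute (Transposition.transpose p s) ** B ** transpose (row_permute (Transposition.transpose q s)))"
  unfolding diagonal_on_def mult_transpose_row_permute row_permute_mult
proof (intro allI impI)
  fix i j assume ij: "i \<noteq> j" "i \<in> S \<or> j \<in> S"
  let ?p = "Transposition.transpose p s" and ?q = "Transposition.transpose q s"
  have 1: "?p i \<in> S \<longleftrightarrow> i \<in> S" "?q j \<in> S \<longleftrightarrow> j \<in> S" "i \<in> S \<Longrightarrow> ?p i = i" "j \<in> S \<Longrightarrow> ?q j = j"
    using ps by (auto simp: Transposition.transpose_def)
  then have "?p i \<noteq> ?q j" using ij by metis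
  then show "B $ ?p i $ ?q j = 0" using B ij 1(1,2) unfolding diagonal_on_def by blast
qed

text \<open>
  One pivot: the multipliers are chosen to cancel row and column \<open>s\<close> and leave the rows and columns of
  \<open>S\<close> alone.
\<close>

lemma diagonal_on_clear:
  fixes C :: "'k::field ^ 'm ^ 'm::finite"
  assumes C: "diagonal_on S C" and s: "s \<notin> S"
    and a: "\<And>i. i \<in> S \<Longrightarrow> a i = 0" "\<And>i. i \<notin> S \<Longrightarrow> i \<noteq> s \<Longrightarrow> C $ i $ s + a i * C $ s $ s = 0"
    and b: "\<And>i. i \<in> S \<Longrightarrow> b i = 0" "\<And>i. i \<notin> S \<Longrightarrow> i \<noteq> s \<Longrightarrow> C $ s $ i + b i * C $ s $ s = 0"
  shows "diagonal_on (insert s S) (row_add s a ** C ** transpose (row_add s b))"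
  unfolding diagonal_on_def mult_transpose_row_add row_add_mult
proof (intro allI impI)
  fix i j assume ij: "i \<noteq> j" "i \<in> insert s S \<or> j \<in> insert s S"
  have CS: "C $ i $ j = 0" if "i \<noteq> j" "i \<in> S \<or> j \<in> S" for i j
    using C that unfolding diagonal_on_def by blast
  have col: "C $ i $ s + a i * C $ s $ s = 0" if "i \<noteq> s" for i
    using that a[of i] CS[of i s] by (cases "i \<in> S") auto
  have row: "C $ s $ j + b j * C $ s $ s = 0" if "j \<noteq> s" for j
    using that b[of j] CS[of s j] by (cases "j \<in> S") auto
  show "C $ i $ j + (if i = s then 0 else a i * C $ s $ j) +
      (if j = s then 0 else b j * (C $ i $ s + (if i = s then 0 else a i * C $ s $ s))) = 0"
  proof (cases "i = s")
    case True
    then show ?thesis using row[of j] ij by simp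
  next
    case False
    have "C $ i $ j = 0 \<and> a i * C $ s $ j = 0" if "j \<noteq> s"
      using that ij False CS[of i j] CS[of s j] a(1)[of i] by auto
    then show ?thesis using col[of i] False by (cases "j = s") auto
  qed
qed

context
  fixes R :: "'k::field set"
  assumes R: "valuation_ring R"
begin

lemma GL_over_one: "GL_over R (mat 1 :: 'k ^ 'm ^ 'm::finite)"
proof -
  have "(mat 1 :: 'k ^ 'm ^ 'm) $ i $ j \<in> R" for i j by (simp add: mat_def vr_0[OF R] vr_1[OF R])
  then show ?thesis unfolding GL_over_def by (intro exI[of _ "mat 1"]) auto
qed

lemma GL_over_mult:
  assumes "GL_over R P" "GL_over R Q"
  shows "GL_over R (P ** Q :: 'k ^ 'm ^ 'm::finite)"
proof -
  obtain P' Q' where P: "\<And>i j. P $ i $ j \<in> R" "\<And>i j. P' $ i $ j \<in> R" "P ** P' = mat 1" "P' ** P = mat 1"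
    and Q: "\<And>i j. Q $ i $ j \<in> R" "\<And>i j. Q' $ i $ j \<in> R" "Q ** Q' = mat 1" "Q' ** Q = mat 1"
    using assms unfolding GL_over_def by blast
  have e: "(X ** Y) $ i $ j \<in> R" if "\<And>i j. X $ i $ j \<in> R" "\<And>i j. Y $ i $ j \<in> R" for X Y :: "'k ^ 'm ^ 'm" and i j
    using that by (auto simp: matrix_matrix_mult_def intro!: vr_sum[OF R] vr_mult[OF R])
  have "P ** Q ** (Q' ** P') = P ** (Q ** Q') ** P'" "Q' ** P' ** (P ** Q) = Q' ** (P' ** P) ** Q"
    by (simp_all only: matrix_mul_assoc)
  then have "P ** Q ** (Q' ** P') = mat 1" "Q' ** P' ** (P ** Q) = mat 1"
    by (simp_all add: P Q)
  then show ?thesis unfolding GL_over_def by (intro exI[of _ "Q' ** P'"]) (auto intro!: e P Q)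
qed

lemma GL_over_transpose:
  assumes "GL_over R (P :: 'k ^ 'm ^ 'm::finite)"
  shows "GL_over R (transpose P)"
proof -
  obtain P' where P: "\<And>i j. P $ i $ j \<in> R" "\<And>i j. P' $ i $ j \<in> R" "P ** P' = mat 1" "P' ** P = mat 1"
    using assms unfolding GL_over_def by blast
  then have "transpose P ** transpose P' = mat 1" "transpose P' ** transpose P = mat 1"
    by (simp_all flip: matrix_transpose_mul)
  then show ?thesis unfolding GL_over_def
    by (intro exI[of _ "transpose P'"]) (auto simp: transpose_def P)
qed

lemma GL_over_row_add:
  assumes "\<And>i. c i \<in> R"
  shows "GL_over R (row_add s c :: 'k ^ 'm ^ 'm::finite)"
proof -
  have "row_add s a ** row_add s (\<lambda>i. - a i) = (mat 1 :: 'k ^ 'm ^ 'm)" for a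
    by (simp add: vec_eq_iff row_add_mult) (auto simp: row_add_def mat_def)
  from this[of c] this[of "\<lambda>i. - c i"] show ?thesis
    unfolding GL_over_def using assms
    by (intro exI[of _ "row_add s (\<lambda>i. - c i)"]) (auto simp: row_add_def intro: vr_0[OF R] vr_1[OF R] vr_uminus[OF R])
qed

lemma GL_over_row_permute:
  assumes "\<And>i. \<pi> (\<pi> i) = i"
  shows "GL_over R (row_permute \<pi> :: 'k ^ 'm ^ 'm::finite)"
proof -
  have "row_permute \<pi> ** row_permute \<pi> = (mat 1 :: 'k ^ 'm ^ 'm)"
    by (simp add: vec_eq_iff row_permute_mult) (auto simp: row_permute_def mat_def assms)
  then show ?thesis
    unfolding GL_over_def
    by (intro exI[of _ "row_permute \<pi>"]) (auto simp: row_permute_def intro: vr_0[OF R] vr_1[OF R])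
qed

text \<open>
  Moving an entry of largest absolute value among the remaining ones to position \<open>(s, s)\<close> makes all
  multipliers of the elimination integral.
\<close>

lemma smith_step:
  fixes B :: "'k ^ 'm ^ 'm::finite"
  assumes B: "diagonal_on S B" and s: "s \<notin> S"
  shows "\<exists>P Q. GL_over R P \<and> GL_over R Q \<and> diagonal_on (insert s S) (P ** B ** Q)"
proof -
  let ?X = "(\<lambda>(i, j). B $ i $ j) ` ((- S) \<times> (- S))"
  have "\<exists>x\<in>?X. \<forall>y\<in>?X. \<exists>c\<in>R. y = c * x"
    using s by (intro vr_dominant[OF R]) auto
  then obtain p q where pq: "p \<notin> S" "q \<notin> S" "\<And>i j. i \<notin> S \<Longrightarrow> j \<notin> S \<Longrightarrow> \<exists>c\<in>R. B $ i $ j = c * B $ p $ q"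
    by fastforce
  define \<pi> where "\<pi> = Transposition.transpose p s"
  define \<rho> where "\<rho> = Transposition.transpose q s"
  define C where "C = row_permute \<pi> ** B ** transpose (row_permute \<rho>)"
  have C: "C $ i $ j = B $ (\<pi> i) $ (\<rho> j)" for i j
    by (simp add: C_def mult_transpose_row_permute row_permute_mult)
  have S: "\<pi> i \<in> S \<longleftrightarrow> i \<in> S" "\<rho> i \<in> S \<longleftrightarrow> i \<in> S" for i
    using pq(1,2) s by (auto simp: \<pi>_def \<rho>_def Transposition.transpose_def)
  have Css: "C $ s $ s = B $ p $ q" by (simp add: C \<pi>_def \<rho>_def)
  have "\<exists>c\<in>R. C $ i $ s = c * C $ s $ s" "\<exists>c\<in>R. C $ s $ i = c * C $ s $ s" if "i \<notin> S" for i
    unfolding Css unfolding C using pq(3) S that s by blast+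
  then obtain a b where ab: "\<And>i. i \<notin> S \<Longrightarrow> a i \<in> R \<and> C $ i $ s = a i * C $ s $ s"
    "\<And>i. i \<notin> S \<Longrightarrow> b i \<in> R \<and> C $ s $ i = b i * C $ s $ s" by metis
  define a' where "a' i = (if i \<in> S then 0 else - a i)" for i
  define b' where "b' i = (if i \<in> S then 0 else - b i)" for i
  define E where "E = row_add s a' ** C ** transpose (row_add s b')"
  have "diagonal_on S C"
    unfolding C_def \<pi>_def \<rho>_def by (rule diagonal_on_permute[OF B pq(1,2) s])
  then have "diagonal_on (insert s S) E"
    unfolding E_def by (rule diagonal_on_clear[OF _ s]) (use ab in \<open>auto simp: a'_def b'_def\<close>)
  moreover have "GL_over R (row_add s a' ** row_permute \<pi>)" "GL_over R (transpose (row_permute \<rho>) ** transpose (row_add s b'))"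
    using ab by (auto simp: a'_def b'_def \<pi>_def \<rho>_def
        intro!: GL_over_mult GL_over_transpose GL_over_row_add GL_over_row_permute vr_0[OF R] vr_uminus[OF R])
  moreover have "E = (row_add s a' ** row_permute \<pi>) ** B ** (transpose (row_permute \<rho>) ** transpose (row_add s b'))"
    by (simp only: E_def C_def matrix_mul_assoc)
  ultimately show ?thesis by metis
qed

lemma smith_normal_form:
  fixes A :: "'k ^ 'm ^ 'm::finite"
  shows "\<exists>P Q. GL_over R P \<and> GL_over R Q \<and> diagonal_on UNIV (P ** A ** Q)"
proof -
  have "\<exists>P Q. GL_over R P \<and> GL_over R Q \<and> diagonal_on S (P ** A ** Q)" for S :: "'m set"
  proof (induction S rule: finite_induct[OF finite])
    case 1
    show ?case by (intro exI[of _ "mat 1"]) (auto simp: diagonal_on_def GL_over_one)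
  next
    case (2 s S)
    then obtain P Q where PQ: "GL_over R P" "GL_over R Q" "diagonal_on S (P ** A ** Q)" by blast
    obtain P' Q' where PQ': "GL_over R P'" "GL_over R Q'" "diagonal_on (insert s S) (P' ** (P ** A ** Q) ** Q')"
      using smith_step[OF PQ(3) 2(2)] by blast
    have "P' ** (P ** A ** Q) ** Q' = (P' ** P) ** A ** (Q ** Q')" by (simp only: matrix_mul_assoc)
    then show ?case using PQ PQ' by (metis GL_over_mult)
  qed
  then show ?thesis .
qed

end

section \<open>Quadratic forms\<close>

lemma valuation_ring_UNIV: "valuation_ring (UNIV :: 'k::field set)"
  by (simp add: valuation_ring_def)

lemma diagonal_on_congruence_pivot:
  fixes B :: "complex ^ 'm ^ 'm::finite"
  assumes sym: "transpose B = B" and B: "diagonal_on S B" and s: "s \<notin> S" and p: "p \<notin> S" "B $ p $ p \<noteq> 0"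
  shows "\<exists>P. GL_over UNIV P \<and> diagonal_on (insert s S) (P ** B ** transpose P)"
proof -
  define \<pi> where "\<pi> = Transposition.transpose p s"
  define C where "C = row_permute \<pi> ** B ** transpose (row_permute \<pi>)"
  have Cij: "C $ i $ j = B $ \<pi> i $ \<pi> j" for i j
    by (simp add: C_def mult_transpose_row_permute row_permute_mult)
  have Bs: "B $ i $ j = B $ j $ i" for i j
    using arg_cong[OF sym, of "\<lambda>M. M $ j $ i"] unfolding transpose_def vec_lambda_beta .
  have "C $ s $ s = B $ p $ p" by (simp add: Cij \<pi>_def)
  then have Css: "C $ s $ s \<noteq> 0" using p by simp
  define a where "a i = (if i \<in> S then 0 else - C $ i $ s / C $ s $ s)" for i
  have Csym: "C $ i $ j = C $ j $ i" for i j unfolding Cij by (rule Bs)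
  have "diagonal_on S C"
    unfolding C_def \<pi>_def by (rule diagonal_on_permute[OF B p(1) p(1) s])
  then have D: "diagonal_on (insert s S) (row_add s a ** C ** transpose (row_add s a))"
  proof (rule diagonal_on_clear[OF _ s])
    show "C $ i $ s + a i * C $ s $ s = 0" if "i \<notin> S" for i using that Css by (simp add: a_def)
    then show "C $ s $ i + a i * C $ s $ s = 0" if "i \<notin> S" for i using that Csym[of s i] by metis
  qed (simp_all add: a_def)
  define P where "P = row_add s a ** row_permute \<pi>"
  have "row_add s a ** C ** transpose (row_add s a) = P ** B ** transpose P"
    by (simp only: P_def C_def matrix_transpose_mul matrix_mul_assoc)
  moreover have "GL_over UNIV P"
    unfolding P_def \<pi>_def
    by (intro GL_over_mult GL_over_row_add GL_over_row_permute valuation_ring_UNIV) auto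
  ultimately show ?thesis using D by metis
qed

text \<open>
  A symmetric matrix whose remaining diagonal vanishes still has a nonzero entry \<open>B $ p $ q\<close> off the
  diagonal, unless nothing is left to do. Adding row and column \<open>q\<close> to row and column \<open>p\<close> creates the
  diagonal entry \<open>2 * B $ p $ q\<close>, which serves as the pivot.
\<close>

lemma diagonal_on_congruence_step:
  fixes B :: "complex ^ 'm ^ 'm::finite"
  assumes sym: "transpose B = B" and B: "diagonal_on S B" and s: "s \<notin> S"
  shows "\<exists>P. GL_over UNIV P \<and> diagonal_on (insert s S) (P ** B ** transpose P)"
proof -
  have Bs: "B $ i $ j = B $ j $ i" for i j
    using arg_cong[OF sym, of "\<lambda>M. M $ j $ i"] unfolding transpose_def vec_lambda_beta .
  consider (zero) "\<forall>i j. i \<notin> S \<longrightarrow> j \<notin> S \<longrightarrow> B $ i $ j = 0"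
    | (diag) p where "p \<notin> S" "B $ p $ p \<noteq> 0"
    | (off) p q where "p \<notin> S" "q \<notin> S" "B $ p $ q \<noteq> 0" "\<forall>i. i \<notin> S \<longrightarrow> B $ i $ i = 0"
    by metis
  then show ?thesis
  proof cases
    case zero
    then have "diagonal_on (insert s S) B" using B s unfolding diagonal_on_def by blast
    then show ?thesis using GL_over_one[OF valuation_ring_UNIV]
      by (intro exI[of _ "mat 1"]) (simp add: transpose_mat)
  next
    case diag
    then show ?thesis using diagonal_on_congruence_pivot[OF sym B s] by blast
  next
    case (off p q)
    then have pq: "p \<noteq> q" by auto
    define c where "c i = (if i = p then 1 else 0 :: complex)" for i
    define E where "E = row_add q c"
    define C where "C = E ** B ** transpose E"
    have Cij: "C $ i $ j = (B $ i $ j + (if i = q then 0 else c i * B $ q $ j)) +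
      (if j = q then 0 else c j * (B $ i $ q + (if i = q then 0 else c i * B $ q $ q)))" for i j
      by (simp add: C_def E_def mult_transpose_row_add row_add_mult)
    have "C $ p $ p = 2 * B $ p $ q"
      using off pq by (simp add: Cij c_def Bs[of q p])
    then have Cpp: "C $ p $ p \<noteq> 0" using off by simp
    have Csym: "transpose C = C"
      by (simp add: C_def matrix_transpose_mul sym matrix_mul_assoc)
    have CS: "diagonal_on S C"
      unfolding diagonal_on_def
    proof (intro allI impI)
      fix i j assume ij: "i \<noteq> j" "i \<in> S \<or> j \<in> S"
      have Z: "B $ i $ j = 0" if "i \<noteq> j" "i \<in> S \<or> j \<in> S" for i j
        using B that unfolding diagonal_on_def by blast
      have c0: "c i = 0" if "i \<in> S" for i using that off by (auto simp: c_def)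
      have qS: "q \<notin> S" by fact
      show "C $ i $ j = 0"
      proof (cases "i \<in> S")
        case True
        then have "B $ i $ j = 0" "B $ i $ q = 0" "c i = 0" using Z ij qS c0 by metis+
        then show ?thesis by (simp add: Cij)
      next
        case False
        then have "B $ i $ j = 0" "B $ q $ j = 0" "c j = 0" using Z ij qS c0 by metis+
        then show ?thesis by (simp add: Cij)
      qed
    qed
    obtain P where P: "GL_over UNIV P" "diagonal_on (insert s S) (P ** C ** transpose P)"
      using diagonal_on_congruence_pivot[OF Csym CS s off(1) Cpp] by blast
    have "P ** C ** transpose P = (P ** E) ** B ** transpose (P ** E)"
      by (simp only: C_def matrix_transpose_mul matrix_mul_assoc)
    moreover have "GL_over UNIV (P ** E)"
      unfolding E_def by (intro GL_over_mult P GL_over_row_add valuation_ring_UNIV) auto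
    ultimately show ?thesis using P by metis
  qed
qed

lemma symmetric_diagonalization:
  fixes A :: "complex ^ 'm ^ 'm::finite"
  assumes A: "transpose A = A"
  shows "\<exists>P. GL_over UNIV P \<and> diagonal_on UNIV (P ** A ** transpose P)"
proof -
  have "\<exists>P. GL_over UNIV P \<and> diagonal_on S (P ** A ** transpose P)" for S :: "'m set"
  proof (induction S rule: finite_induct[OF finite])
    case 1
    show ?case
      by (intro exI[of _ "mat 1"]) (auto simp: diagonal_on_def GL_over_one[OF valuation_ring_UNIV])
  next
    case (2 s S)
    then obtain P where P: "GL_over UNIV P" "diagonal_on S (P ** A ** transpose P)" by blast
    have "transpose (P ** A ** transpose P) = P ** A ** transpose P"
      by (simp add: matrix_transpose_mul A matrix_mul_assoc)
    then obtain Q where Q: "GL_over UNIV Q" "diagonal_on (insert s S) (Q ** (P ** A ** transpose P) ** transpose Q)"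
      using diagonal_on_congruence_step[OF _ P(2) 2(2)] by blast
    have "Q ** (P ** A ** transpose P) ** transpose Q = (Q ** P) ** A ** transpose (Q ** P)"
      by (simp only: matrix_transpose_mul matrix_mul_assoc)
    then show ?case using P Q by (metis GL_over_mult[OF valuation_ring_UNIV])
  qed
  then show ?thesis .
qed

lemma diagm_mult: "diagm a ** diagm b = diagm (\<lambda>i. a i * b i)"
proof -
  have "diagm a $ i $ k * diagm b $ k $ j = (if k = i then (if i = j then a i * b i else 0) else 0)" for i j k
    by (auto simp: diagm_def)
  then show ?thesis by (simp add: vec_eq_iff matrix_matrix_mult_def) (simp add: diagm_def)
qed

lemma det_diagm: "det (diagm t) = (\<Prod>i\<in>UNIV. t i)"
  by (subst det_diagonal) (auto simp: diagm_def)

lemma diagonal_on_UNIV: "diagonal_on UNIV B \<Longrightarrow> B = diagm (\<lambda>i. B $ i $ i)"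
  by (auto simp: diagonal_on_def diagm_def vec_eq_iff)

lemma symmetric_congruent_one:
  fixes A :: "complex ^ 'm ^ 'm::finite"
  assumes A: "transpose A = A" and det: "det A \<noteq> 0"
  shows "\<exists>g :: complex ^ 'm ^ 'm. g ** A ** transpose g = mat 1"
proof -
  obtain P where P: "GL_over UNIV P" "diagonal_on UNIV (P ** A ** transpose P)"
    using symmetric_diagonalization[OF A] by blast
  define b where "b = (\<lambda>i. (P ** A ** transpose P) $ i $ i)"
  have D: "P ** A ** transpose P = diagm b"
    unfolding b_def by (rule diagonal_on_UNIV[OF P(2)])
  obtain P' where "P ** P' = mat 1" using P(1) unfolding GL_over_def by blast
  then have "det P * det P' = 1" by (metis det_mul det_I)
  then have "det P \<noteq> 0" by auto
  then have "det (diagm b) \<noteq> 0" using det by (simp flip: D add: det_mul)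
  then have b: "b i \<noteq> 0" for i by (simp add: det_diagm)
  define c where "c i = inverse (csqrt (b i))" for i
  have c: "c i * b i * c i = 1" for i
  proof -
    have "b i = csqrt (b i) ^ 2" by simp
    moreover have "csqrt (b i) \<noteq> 0" using b by simp
    ultimately show ?thesis unfolding c_def by (metis (no_types) left_inverse mult.assoc mult.right_neutral power2_eq_square right_inverse)
  qed
  have tr: "transpose (diagm c) = diagm c" by (auto simp: transpose_def diagm_def vec_eq_iff)
  have one: "diagm (\<lambda>i. 1) = mat 1" by (auto simp: diagm_def mat_def vec_eq_iff)
  have "(diagm c ** P) ** A ** transpose (diagm c ** P) = diagm c ** (P ** A ** transpose P) ** diagm c"
    by (simp only: matrix_transpose_mul matrix_mul_assoc tr)
  also have "\<dots> = mat 1" by (simp add: D diagm_mult c one)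
  finally show ?thesis by blast
qed

text \<open>
  Both matrices are congruent to the identity. The determinants of the two transformations agree up to
  sign, and a diagonal sign change, which preserves the identity matrix, corrects it.
\<close>

lemma symmetric_congruent:
  fixes A B :: "complex ^ 'm ^ 'm::finite"
  assumes A: "transpose A = A" and B: "transpose B = B" and det: "det A = det B" "det A \<noteq> 0"
  shows "\<exists>k :: complex ^ 'm ^ 'm. det k = 1 \<and> k ** A ** transpose k = B"
proof -
  obtain g :: "complex ^ 'm ^ 'm" where g: "g ** A ** transpose g = mat 1" using symmetric_congruent_one[OF A det(2)] by blast
  obtain h :: "complex ^ 'm ^ 'm" where h: "h ** B ** transpose h = mat 1" using symmetric_congruent_one[OF B] det by auto
  have dg: "det g ^ 2 * det A = 1"
    using arg_cong[OF g, of det] by (simp add: det_mul power2_eq_square mult_ac)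
  have dh: "det h ^ 2 * det A = 1"
    using arg_cong[OF h, of det] det by (simp add: det_mul power2_eq_square mult_ac)
  have "det g ^ 2 = det h ^ 2" using dg dh det(2) by (metis mult_right_cancel)
  then have gh: "det g = det h \<or> det g = - det h" by (simp add: power2_eq_iff)
  define i0 where "i0 = (SOME i :: 'm. True)"
  define \<epsilon> where "\<epsilon> = det g * inverse (det h)"
  have h0: "det h \<noteq> 0" using dh by auto
  have \<epsilon>: "\<epsilon> * \<epsilon> = 1" using gh h0 by (auto simp: \<epsilon>_def)
  \<comment> \<open>The sign goes into a single diagonal entry, so that the determinant changes by it.\<close>
  define f where "f i = (if i = i0 then \<epsilon> else 1)" for i
  have ff: "f i * f i = 1" for i by (simp add: f_def \<epsilon>)
  have df: "det (diagm f) = \<epsilon>" by (simp add: det_diagm f_def)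
  have tr: "transpose (diagm f) = diagm f" by (auto simp: transpose_def diagm_def vec_eq_iff)
  have one: "diagm (\<lambda>i. 1) = mat 1" by (auto simp: diagm_def mat_def vec_eq_iff)
  define h2 where "h2 = diagm f ** h"
  have h2: "h2 ** B ** transpose h2 = mat 1"
  proof -
    have "h2 ** B ** transpose h2 = diagm f ** (h ** B ** transpose h) ** diagm f"
      by (simp only: h2_def matrix_transpose_mul matrix_mul_assoc tr)
    then show ?thesis by (simp add: h diagm_mult ff one)
  qed
  have dh2: "det h2 = det g" using h0 by (simp add: h2_def det_mul df \<epsilon>_def)
  have g0: "det g \<noteq> 0" using dg by auto
  then have "invertible h2" using dh2 by (simp add: invertible_det_nz)
  then obtain k where k: "h2 ** k = mat 1" "k ** h2 = mat 1" unfolding invertible_def by blast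
  have "det h2 * det k = 1" using arg_cong[OF k(1), of det] by (simp add: det_mul)
  then have "det (k ** g) = 1" using dh2 by (simp add: det_mul mult.commute)
  moreover have "(k ** g) ** A ** transpose (k ** g) = B"
  proof -
    have "(k ** g) ** A ** transpose (k ** g) = k ** (g ** A ** transpose g) ** transpose k"
      by (simp only: matrix_transpose_mul matrix_mul_assoc)
    also have "\<dots> = k ** (h2 ** B ** transpose h2) ** transpose k" using g h2 by simp
    also have "\<dots> = (k ** h2) ** B ** transpose (k ** h2)"
      by (simp only: matrix_transpose_mul matrix_mul_assoc)
    finally show ?thesis by (simp add: k)
  qed
  ultimately show ?thesis by blast
qed

text \<open>
  The symmetric matrix of a quadratic form.
\<close>

definition gram :: "'m::finite cpoly \<Rightarrow> complex ^ 'm ^ 'm" where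
  "gram w = (\<chi> i j. if i = j then cf w (vexp i + vexp i) else cf w (vexp i + vexp j) / 2)"

definition quadric :: "complex ^ 'm ^ 'm \<Rightarrow> 'm::finite cpoly" where
  "quadric A = (\<Sum>i\<in>UNIV. \<Sum>j\<in>UNIV. Const (A $ i $ j) * (Var i * Var j))"

lemma mat_act_quadric: "mat_act g (quadric A) = quadric (g ** A ** transpose g)"
proof -
  have "mat_act g (quadric A) = (\<Sum>i\<in>UNIV. \<Sum>j\<in>UNIV. Const (A $ i $ j) *
      ((\<Sum>k\<in>UNIV. Const (g $ k $ i) * Var k) * (\<Sum>l\<in>UNIV. Const (g $ l $ j) * Var l)))"
    by (simp add: quadric_def mat_act_sum mat_act_mult mat_act_Var)
  also have "\<dots> = (\<Sum>i\<in>UNIV. \<Sum>j\<in>UNIV. \<Sum>k\<in>UNIV. \<Sum>l\<in>UNIV. Const (g $ k $ i * A $ i $ j * g $ l $ j) * (Var k * Var l))"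
    by (simp only: sum_product, simp only: sum_distrib_left, intro sum.cong refl, simp only: Const_mult mult_ac)
  also have "\<dots> = (\<Sum>k\<in>UNIV. \<Sum>l\<in>UNIV. \<Sum>j\<in>UNIV. \<Sum>i\<in>UNIV. Const (g $ k $ i * A $ i $ j * g $ l $ j) * (Var k * Var l))"
  proof -
    have "(\<Sum>i\<in>UNIV. \<Sum>j\<in>UNIV. \<Sum>k\<in>UNIV. \<Sum>l\<in>UNIV. F i j k l) = (\<Sum>k\<in>UNIV. \<Sum>l\<in>UNIV. \<Sum>j\<in>UNIV. \<Sum>i\<in>UNIV. F i j k l)"
      for F :: "'a \<Rightarrow> 'a \<Rightarrow> 'a \<Rightarrow> 'a \<Rightarrow> 'a cpoly"
    proof -
      have "(\<Sum>i\<in>UNIV. \<Sum>j\<in>UNIV. \<Sum>k\<in>UNIV. \<Sum>l\<in>UNIV. F i j k l) = (\<Sum>i\<in>UNIV. \<Sum>k\<in>UNIV. \<Sum>j\<in>UNIV. \<Sum>l\<in>UNIV. F i j k l)"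
        by (rule sum.cong[OF refl], rule sum.swap)
      also have "\<dots> = (\<Sum>k\<in>UNIV. \<Sum>i\<in>UNIV. \<Sum>j\<in>UNIV. \<Sum>l\<in>UNIV. F i j k l)" by (rule sum.swap)
      also have "\<dots> = (\<Sum>k\<in>UNIV. \<Sum>i\<in>UNIV. \<Sum>l\<in>UNIV. \<Sum>j\<in>UNIV. F i j k l)"
        by (rule sum.cong[OF refl], rule sum.cong[OF refl], rule sum.swap)
      also have "\<dots> = (\<Sum>k\<in>UNIV. \<Sum>l\<in>UNIV. \<Sum>i\<in>UNIV. \<Sum>j\<in>UNIV. F i j k l)"
        by (rule sum.cong[OF refl], rule sum.swap)
      also have "\<dots> = (\<Sum>k\<in>UNIV. \<Sum>l\<in>UNIV. \<Sum>j\<in>UNIV. \<Sum>i\<in>UNIV. F i j k l)"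
        by (rule sum.cong[OF refl], rule sum.cong[OF refl], rule sum.swap)
      finally show ?thesis .
    qed
    then show ?thesis .
  qed
  also have "\<dots> = quadric (g ** A ** transpose g)"
    by (simp add: quadric_def matrix_matrix_mult_def transpose_def Const_sum sum_distrib_right)
  finally show ?thesis .
qed

lemma vexp_add_eq_iff:
  "vexp i + vexp j = vexp p + vexp q \<longleftrightarrow> (i = p \<and> j = q) \<or> (i = q \<and> j = p)"
proof
  assume eq: "vexp i + vexp j = vexp p + vexp q"
  have "(if i = x then 1 else 0) + (if j = x then 1 else 0) = (if p = x then 1 else 0) + (if q = x then 1 else (0::nat))" for x
    using arg_cong[OF eq, of "\<lambda>\<alpha>. cf \<alpha> x"] by (simp only: lookup_add lookup_single when_def One_nat_def)
  from this[of i] have "i = p \<or> i = q" by (auto split: if_splits)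
  moreover have inj: "vexp x = vexp y \<longleftrightarrow> x = y" for x y :: 'a
    by (metis lookup_single_eq lookup_single_not_eq nat.distinct(1))
  moreover have "j = q" if "i = p" using eq that inj[of j q] by simp
  moreover have "j = p" if "i = q" using eq that inj[of j p] by (simp add: add.commute[of "vexp p"])
  ultimately show "(i = p \<and> j = q) \<or> (i = q \<and> j = p)" by blast
qed (auto simp: add.commute)

lemma lookup_quadric:
  "cf (quadric A) (vexp p + vexp q) = (if p = q then A $ p $ p else A $ p $ q + A $ q $ p)"
proof -
  have m: "Var i * Var j = mon (vexp i + vexp j)" for i j :: 'a by (simp add: Var_def mult_single)
  have "cf (quadric A) (vexp p + vexp q) =
     (\<Sum>i\<in>UNIV. \<Sum>j\<in>UNIV. A $ i $ j * (if (i = p \<and> j = q) \<or> (i = q \<and> j = p) then 1 else 0))"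
    by (simp add: quadric_def lookup_sum m lookup_single when_def vexp_add_eq_iff)
  also have "\<dots> = (\<Sum>i\<in>UNIV. if i = p then A $ p $ q else if i = q then A $ q $ p else 0)"
  proof (rule sum.cong)
    fix i
    have "(\<Sum>j\<in>UNIV. A $ i $ j * (if (i = p \<and> j = q) \<or> (i = q \<and> j = p) then 1 else 0)) =
      (\<Sum>j\<in>UNIV. if j = (if i = p then q else p) then (if i = p then A $ p $ q else if i = q then A $ q $ p else 0) else 0)"
      by (intro sum.cong) auto
    then show "(\<Sum>j\<in>UNIV. A $ i $ j * (if (i = p \<and> j = q) \<or> (i = q \<and> j = p) then 1 else 0)) =
      (if i = p then A $ p $ q else if i = q then A $ q $ p else 0)" by simp
  qed simp
  also have "\<dots> = (\<Sum>i\<in>UNIV. (if i = p then A $ p $ q else 0) + (if i = q then (if p = q then 0 else A $ q $ p) else 0))"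
    by (intro sum.cong) auto
  also have "\<dots> = (if p = q then A $ p $ p else A $ p $ q + A $ q $ p)"
    by (simp add: sum.distrib)
  finally show ?thesis .
qed

lemma gram_quadric:
  assumes "transpose A = A"
  shows "gram (quadric A) = A"
proof -
  have sym: "A $ i $ j = A $ j $ i" for i j
    using arg_cong[OF assms, of "\<lambda>M. M $ j $ i"] unfolding transpose_def vec_lambda_beta .
  have "gram (quadric A) $ i $ j = A $ i $ j" for i j
    using sym[of j i] by (cases "i = j") (simp_all add: gram_def lookup_quadric)
  then show ?thesis by (simp add: vec_eq_iff)
qed

lemma transpose_gram: "transpose (gram w) = gram w"
  by (auto simp: transpose_def gram_def vec_eq_iff add.commute)

lemma quadric_Sym_forms: "quadric A \<in> Sym_forms 2"
proof -
  have "Var i * Var j \<in> Sym_forms 2" for i j :: 'a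
    using Sym_forms_mult[OF Var_Sym_forms[of i] Var_Sym_forms[of j]] by (simp add: numeral_2_eq_2)
  then show ?thesis unfolding quadric_def by (intro Sym_forms_sum Sym_forms_Const_mult)
qed

lemma mdeg_two:
  fixes \<alpha> :: "'m::finite monom"
  assumes "mdeg \<alpha> = 2"
  shows "\<exists>p q. \<alpha> = vexp p + vexp q"
proof -
  have *: "\<exists>p. \<beta> = vexp p" if b: "mdeg \<beta> = 1" for \<beta> :: "'m monom"
  proof -
    have "mdeg \<beta> \<noteq> 0" using b by simp
    then obtain p where p: "cf \<beta> p \<noteq> 0" by (auto simp: mdeg_UNIV)
    have "(\<Sum>i\<in>UNIV. cf \<beta> i) = cf \<beta> p + (\<Sum>i\<in>UNIV - {p}. cf \<beta> i)" by (intro sum.remove) auto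
    then have s: "cf \<beta> p = 1" "(\<Sum>i\<in>UNIV - {p}. cf \<beta> i) = 0" using b p unfolding mdeg_UNIV by linarith+
    then have "cf \<beta> i = 0" if "i \<noteq> p" for i using that by (auto simp: sum_eq_0_iff)
    then show ?thesis using s by (intro exI[of _ p] poly_mapping_eqI) (auto simp: lookup_single when_def)
  qed
  obtain \<beta> \<gamma> where "\<alpha> = \<beta> + \<gamma>" "mdeg \<beta> = 1" using monom_split_degree[of 1 \<alpha>] assms by auto
  moreover then have "mdeg \<gamma> = 1" using assms by (simp add: mdeg_add)
  ultimately show ?thesis using * by metis
qed

lemma quadric_gram:
  assumes w: "w \<in> Sym_forms 2"
  shows "quadric (gram w) = w"
proof (rule poly_mapping_eqI)
  fix \<alpha>
  show "cf (quadric (gram w)) \<alpha> = cf w \<alpha>"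
  proof (cases "mdeg \<alpha> = 2")
    case True
    then obtain p q where "\<alpha> = vexp p + vexp q" using mdeg_two by blast
    then show ?thesis
      using add.commute[of "vexp q" "vexp p"] by (cases "p = q") (simp_all add: lookup_quadric gram_def)
  next
    case False
    then show ?thesis using Sym_formsD[OF w, of \<alpha>] Sym_formsD[OF quadric_Sym_forms, of "gram w" \<alpha>] by metis
  qed
qed

text \<open>
  Under the correspondence between quadratic forms and symmetric matrices this is
  \<open>symmetric_congruent\<close>.
\<close>

lemma SL_orbit_quadric:
  fixes w :: "'m::finite cpoly"
  assumes w: "w \<in> Sym_forms 2" and det: "det (gram w) \<noteq> 0"
  shows "SL_orbit w = {u \<in> Sym_forms 2. det (gram u) = det (gram w)}"
proof (intro equalityI subsetI)
  fix u :: "'m cpoly" assume "u \<in> SL_orbit w"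
  then obtain g where g: "det g = 1" "u = mat_act g w" unfolding SL_orbit_def by blast
  have "u = quadric (g ** gram w ** transpose g)"
    using g(2) mat_act_quadric[of g "gram w"] quadric_gram[OF w] by simp
  moreover have "transpose (g ** gram w ** transpose g) = g ** gram w ** transpose g"
    by (simp add: matrix_transpose_mul transpose_gram matrix_mul_assoc)
  ultimately have "gram u = g ** gram w ** transpose g" using gram_quadric by metis
  then have "det (gram u) = det (gram w)" by (simp add: det_mul g)
  then show "u \<in> {u \<in> Sym_forms 2. det (gram u) = det (gram w)}"
    using g(2) mat_act_Sym_forms[OF w] by simp
next
  fix u :: "'m cpoly" assume u: "u \<in> {u \<in> Sym_forms 2. det (gram u) = det (gram w)}"
  then obtain k where k: "det k = 1" "k ** gram w ** transpose k = gram u"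
    using symmetric_congruent[OF transpose_gram transpose_gram, of w u] det by auto
  have "u = mat_act k w"
    using mat_act_quadric[of k "gram w"] quadric_gram[OF w] quadric_gram[of u] u k(2) by simp
  then show "u \<in> SL_orbit w" using k unfolding SL_orbit_def by blast
qed

lemma poly_fun_det_gram:
  "\<exists>f. poly_fun f \<and> (\<forall>w :: 'm::finite cpoly. f (cf w) = det (gram w))"
proof -
  define G where "G i j = (\<lambda>a :: 'm monom \<Rightarrow> complex. if i = j then a (vexp i + vexp i) else a (vexp i + vexp j) * (1 / 2))" for i j
  have G: "poly_fun (G i j)" for i j
    unfolding G_def
    by (cases "i = j") (simp_all only: if_True if_False refl poly_fun_coord poly_fun_mult poly_fun_const)
  define f where "f = (\<lambda>a. \<Sum>p | p permutes (UNIV :: 'm set). of_int (sign p) * (\<Prod>i\<in>UNIV. G i (p i) a))"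
  have "poly_fun f"
    unfolding f_def by (intro poly_fun_sum poly_fun_mult poly_fun_const poly_fun_prod G)
  moreover have "f (cf w) = det (gram w)" for w
    unfolding f_def det_def by (intro sum.cong refl arg_cong2[where f = "(*)"] prod.cong) (simp add: gram_def G_def)
  ultimately show ?thesis by blast
qed

theorem almost_all_quadrics_polystable:
  "almost_all_forms 2 (polystable 2 :: 'm::finite cpoly \<Rightarrow> bool)"
proof -
  obtain f where f: "poly_fun f" "\<And>w :: 'm cpoly. f (cf w) = det (gram w)"
    using poly_fun_det_gram by blast
  let ?U = "{w :: 'm cpoly. w \<in> Sym_forms 2 \<and> f (cf w) \<noteq> 0}"
  have "polystable 2 w" if w: "w \<in> ?U" for w
  proof -
    have "poly_fun (\<lambda>a. f a - det (gram w))" by (intro poly_fun_diff f poly_fun_const)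
    then obtain P where P: "\<And>a. eval_cpoly a P = f a - det (gram w)" unfolding poly_fun_def by blast
    have "SL_orbit w = {u \<in> Sym_forms 2. \<forall>Q\<in>{P}. eval_cpoly (cf u) Q = 0}"
      using w by (subst SL_orbit_quadric) (auto simp: P f)
    then have "zariski_closed 2 (SL_orbit w)" unfolding zariski_closed_def by (rule exI)
    then show ?thesis using w by (simp add: polystable_def)
  qed
  moreover have "?U \<noteq> {}"
  proof -
    have "quadric (mat 1) \<in> ?U"
      by (simp add: quadric_Sym_forms f gram_quadric transpose_mat)
    then show ?thesis by blast
  qed
  ultimately show ?thesis
    unfolding almost_all_forms_def using zariski_open_nonvanishing[OF f(1), of 2]
    by (intro exI[of _ ?U]) simp
qed

section \<open>Generic points of the special linear group\<close>

definition entries :: "complex ^ 'm ^ 'm \<Rightarrow> 'm \<times> 'm \<Rightarrow> complex" where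
  "entries g = (\<lambda>(i, j). g $ i $ j)"

definition mat_poly :: "(complex ^ 'm ^ 'm \<Rightarrow> complex) \<Rightarrow> bool" where
  "mat_poly f \<longleftrightarrow> (\<exists>P. \<forall>g. f g = eval_cpoly (entries g) P)"

lemma mat_poly_const: "mat_poly (\<lambda>g. c)"
  unfolding mat_poly_def by (rule exI[of _ "Const c"]) simp
lemma mat_poly_entry: "mat_poly (\<lambda>g. g $ i $ j)"
  unfolding mat_poly_def by (rule exI[of _ "Var (i, j)"]) (simp add: entries_def)
lemma mat_poly_add: "mat_poly f \<Longrightarrow> mat_poly h \<Longrightarrow> mat_poly (\<lambda>g. f g + h g)"
  unfolding mat_poly_def by (metis eval_cpoly_add)
lemma mat_poly_mult: "mat_poly f \<Longrightarrow> mat_poly h \<Longrightarrow> mat_poly (\<lambda>g. f g * h g)"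
  unfolding mat_poly_def by (metis eval_cpoly_mult)
lemma mat_poly_sum: "(\<And>x. x \<in> X \<Longrightarrow> mat_poly (f x)) \<Longrightarrow> mat_poly (\<lambda>g. \<Sum>x\<in>X. f x g)"
  by (induction X rule: infinite_finite_induct) (auto intro: mat_poly_const mat_poly_add)

lemma mat_poly_lookup_mat_act: "mat_poly (\<lambda>g. cf (mat_act g w) \<alpha>)" for w :: "'m::finite cpoly"
proof (induction w arbitrary: \<alpha> rule: cpoly_induct)
  case (Const c)
  show ?case by (simp add: mat_poly_const)
next
  case (Var j)
  show ?case unfolding mat_act_Var lookup_sum lookup_Const_mult
    by (intro mat_poly_sum mat_poly_mult mat_poly_entry mat_poly_const)
next
  case (add P Q)
  then show ?case unfolding mat_act_add lookup_add by (intro mat_poly_add)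
next
  case (mult P Q)
  then show ?case unfolding mat_act_mult lookup_times by (intro mat_poly_sum mat_poly_mult)
qed

lemma mat_poly_eval_mat_act: "mat_poly (\<lambda>g. eval_cpoly (cf (mat_act g w)) P)"
proof (induction P rule: cpoly_induct)
  case (Const c)
  show ?case by (simp add: mat_poly_const)
next
  case (Var j)
  show ?case by (simp add: mat_poly_lookup_mat_act)
next
  case (add P Q)
  then show ?case unfolding eval_cpoly_add by (intro mat_poly_add)
next
  case (mult P Q)
  then show ?case unfolding eval_cpoly_mult by (intro mat_poly_mult)
qed

text \<open>
  Rescaling one row retracts the invertible matrices onto \<open>SL\<close>. In this way \<open>SL\<close> is parametrized by an
  open dense subset of an affine space, where lines are available.
\<close>

definition det_normalize :: "'m \<Rightarrow> complex ^ 'm ^ 'm \<Rightarrow> complex ^ 'm ^ 'm::finite" where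
  "det_normalize k a = (\<chi> i. if i = k then inverse (det a) *s (a $ i) else a $ i)"

lemma det_det_normalize:
  assumes "det a \<noteq> 0"
  shows "det (det_normalize k a) = 1"
proof -
  have "det (det_normalize k a) = inverse (det a) * det (\<chi> i. if i = k then a $ i else a $ i)"
    unfolding det_normalize_def by (rule det_row_mul)
  also have "(\<chi> i. if i = k then a $ i else a $ i) = a" by (simp add: vec_eq_iff)
  finally show ?thesis using assms by simp
qed

lemma det_normalize_id: "det a = 1 \<Longrightarrow> det_normalize k a = a"
  by (simp add: det_normalize_def vec_eq_iff)

lemma det_normalize_entry:
  "det_normalize k a $ i $ j = (if i = k then inverse (det a) * a $ i $ j else a $ i $ j)"
  by (simp add: det_normalize_def)

lemma continuous_on_det_complex: "continuous_on UNIV (det :: complex ^ 'm ^ 'm \<Rightarrow> complex)"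
  unfolding det_def[abs_def] by (intro continuous_intros)

lemma open_invertible: "open {a :: complex ^ 'm ^ 'm::finite. det a \<noteq> 0}"
  by (rule open_Collect_neq[OF continuous_on_det_complex continuous_on_const])

lemma open_generic:
  assumes "mat_poly f"
  shows "open {a :: complex ^ 'm ^ 'm::finite. det a \<noteq> 0 \<and> f (det_normalize k a) \<noteq> 0}"
proof -
  let ?S = "{a :: complex ^ 'm ^ 'm. det a \<noteq> 0}"
  obtain P where P: "\<And>g. f g = eval_cpoly (entries g) P" using assms unfolding mat_poly_def by blast
  have det: "continuous_on ?S det" using continuous_on_det_complex by (rule continuous_on_subset) simp
  have "continuous_on ?S (\<lambda>a. eval_cpoly (entries (det_normalize k a)) P)"
  proof (induction P rule: cpoly_induct)
    case (Var ij)
    obtain i j where ij: "ij = (i, j)" by (cases ij)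
    show ?case
      by (cases "i = k") (auto simp: ij entries_def det_normalize_entry intro!: continuous_intros det)
  qed (auto simp: eval_cpoly_add eval_cpoly_mult intro!: continuous_intros)
  then have "open (?S \<inter> (\<lambda>a. eval_cpoly (entries (det_normalize k a)) P) -` (- {0}))"
    by (rule continuous_open_preimage[OF _ open_invertible]) auto
  also have "?S \<inter> (\<lambda>a. eval_cpoly (entries (det_normalize k a)) P) -` (- {0}) =
      {a. det a \<noteq> 0 \<and> f (det_normalize k a) \<noteq> 0}" by (auto simp: P)
  finally show ?thesis .
qed

text \<open>
  Restricted to the complex line from an arbitrary \<open>a\<close> to the given \<open>b\<close>, the function
  \<open>f (det_normalize k _)\<close> is a polynomial divided by a power of the determinant. The numerator and the
  determinant are nonzero at \<open>b\<close>, so they vanish at finitely many points of the line only, and nonzero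
  values occur arbitrarily close to \<open>a\<close>.
\<close>

lemma dense_generic:
  fixes f :: "complex ^ 'm ^ 'm::finite \<Rightarrow> complex"
  assumes f: "mat_poly f" and b: "det b = 1" "f b \<noteq> 0"
  shows "closure {a. det a \<noteq> 0 \<and> f (det_normalize k a) \<noteq> 0} = UNIV"
proof -
  let ?X = "{a. det a \<noteq> 0 \<and> f (det_normalize k a) \<noteq> 0}"
  obtain P where P: "\<And>g. f g = eval_cpoly (entries g) P" using f unfolding mat_poly_def by blast
  have "a \<in> closure ?X" for a
    unfolding closure_approachable
  proof (intro allI impI)
    fix e :: real assume e: "e > 0"
    define l where "l s = (\<chi> i j. a $ i $ j + s * (b $ i $ j - a $ i $ j))" for s
    define lp where "lp i j = [:a $ i $ j, b $ i $ j - a $ i $ j:]" for i j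
    have lp: "l s $ i $ j = poly (lp i j) s" for s i j by (simp add: l_def lp_def)
    define q where "q = (\<Sum>p | p permutes (UNIV :: 'm set). [:of_int (sign p):] * (\<Prod>i\<in>UNIV. lp i (p i)))"
    have q: "det (l s) = poly q s" for s
      by (simp add: det_def q_def poly_sum poly_prod lp)
    have l1: "l 1 = b" and l0: "l 0 = a" by (simp_all add: l_def vec_eq_iff)
    have "\<exists>p n. \<forall>s. poly q s \<noteq> 0 \<longrightarrow> eval_cpoly (entries (det_normalize k (l s))) P = poly p s / poly q s ^ n"
    proof (induction P rule: cpoly_induct)
      case (Const c)
      show ?case by (intro exI[of _ "[:c:]"] exI[of _ 0]) simp
    next
      case (Var ij)
      obtain i j where ij: "ij = (i, j)" by (cases ij)
      show ?case
      proof (cases "i = k")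
        case True
        then show ?thesis
          by (intro exI[of _ "lp i j"] exI[of _ 1])
             (simp add: ij entries_def det_normalize_entry q lp divide_inverse mult.commute)
      next
        case False
        then show ?thesis
          by (intro exI[of _ "lp i j"] exI[of _ 0]) (simp add: ij entries_def det_normalize_entry lp)
      qed
    next
      case (add P Q)
      obtain p n where "\<forall>s. poly q s \<noteq> 0 \<longrightarrow> eval_cpoly (entries (det_normalize k (l s))) P = poly p s / poly q s ^ n"
        using add.IH(1) by (elim exE)
      moreover obtain p' n' where "\<forall>s. poly q s \<noteq> 0 \<longrightarrow> eval_cpoly (entries (det_normalize k (l s))) Q = poly p' s / poly q s ^ n'"
        using add.IH(2) by (elim exE)
      ultimately show ?case
        by (intro exI[of _ "p * q ^ n' + p' * q ^ n"] exI[of _ "n + n'"])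
           (simp add: eval_cpoly_add add_divide_distrib power_add)
    next
      case (mult P Q)
      obtain p n where "\<forall>s. poly q s \<noteq> 0 \<longrightarrow> eval_cpoly (entries (det_normalize k (l s))) P = poly p s / poly q s ^ n"
        using mult.IH(1) by (elim exE)
      moreover obtain p' n' where "\<forall>s. poly q s \<noteq> 0 \<longrightarrow> eval_cpoly (entries (det_normalize k (l s))) Q = poly p' s / poly q s ^ n'"
        using mult.IH(2) by (elim exE)
      ultimately show ?case
        by (intro exI[of _ "p * p'"] exI[of _ "n + n'"]) (simp add: eval_cpoly_mult power_add)
    qed
    then obtain p n where p: "\<And>s. poly q s \<noteq> 0 \<Longrightarrow> f (det_normalize k (l s)) = poly p s / poly q s ^ n"
      by (auto simp: P)
    have q1: "poly q 1 = 1" using q[of 1] b(1) l1 by simp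
    have "poly p 1 \<noteq> 0" using p[of 1] q1 b l1 by (simp add: det_normalize_id)
    then have "poly (p * q) 1 \<noteq> 0" using q1 by simp
    then have "p * q \<noteq> 0" by (metis poly_0)
    then have fin: "finite {s. poly (p * q) s = 0}" by (rule poly_roots_finite)
    have "continuous_on UNIV l"
      unfolding l_def[abs_def] by (intro continuous_intros)
    then obtain d where d: "d > 0" "\<And>s. dist s 0 < d \<Longrightarrow> dist (l s) (l 0) < e"
      using e unfolding continuous_on_iff by (metis UNIV_I)
    have "infinite (ball (0 :: complex) d)" 
      using islimpt_UNIV[of "0 :: complex"] d(1) unfolding islimpt_eq_infinite_ball by simp
    then have "\<not> ball 0 d \<subseteq> {s. poly (p * q) s = 0}" using fin finite_subset by blast
    then obtain s where s: "s \<in> ball 0 d" "poly (p * q) s \<noteq> 0" by blast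
    then have "poly q s \<noteq> 0" "poly p s \<noteq> 0" by auto
    then have "l s \<in> ?X" using p[of s] by (simp add: q)
    moreover have "dist (l s) a < e" using d(2)[of s] s(1) l0 by (simp add: dist_commute)
    ultimately show "\<exists>y\<in>?X. dist y a < e" by blast
  qed
  then show ?thesis by blast
qed

text \<open>
  Each function excludes the complement of an open dense set; Baire's theorem handles countably many at
  once.
\<close>

lemma generic_SL_point:
  fixes \<F> :: "(complex ^ 'm ^ 'm::finite \<Rightarrow> complex) set"
  assumes cnt: "countable \<F>" and poly: "\<And>f. f \<in> \<F> \<Longrightarrow> mat_poly f"
    and nz: "\<And>f. f \<in> \<F> \<Longrightarrow> \<exists>b. det b = 1 \<and> f b \<noteq> 0"
  shows "\<exists>g. det g = 1 \<and> (\<forall>f\<in>\<F>. f g \<noteq> 0)"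
proof -
  define k where "k = (SOME i :: 'm. True)"
  define X where "X f = {a :: complex ^ 'm ^ 'm. det a \<noteq> 0 \<and> f (det_normalize k a) \<noteq> 0}" for f :: "complex ^ 'm ^ 'm \<Rightarrow> complex"
  \<comment> \<open>The constant function makes sure that the determinant does not vanish even if \<open>\<F>\<close> is empty.\<close>
  define \<F>' where "\<F>' = insert (\<lambda>_. 1) \<F>"
  have poly': "mat_poly f" if "f \<in> \<F>'" for f using that poly by (auto simp: \<F>'_def mat_poly_const)
  have nz': "\<exists>b. det b = 1 \<and> f b \<noteq> 0" if "f \<in> \<F>'" for f
  proof (cases "f \<in> \<F>")
    case False
    then have "f = (\<lambda>_. 1)" using that by (auto simp: \<F>'_def)
    then show ?thesis by (intro exI[of _ "mat 1"]) simp
  qed (rule nz)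
  have "UNIV \<subseteq> closure (\<Inter> (X ` \<F>'))"
  proof (rule Baire)
    show "countable (X ` \<F>')" using cnt by (simp add: \<F>'_def)
    fix T assume "T \<in> X ` \<F>'"
    then obtain f where f: "f \<in> \<F>'" "T = X f" by blast
    obtain b where "det b = 1" "f b \<noteq> 0" using nz'[OF f(1)] by blast
    then have "closure T = UNIV" unfolding f X_def by (rule dense_generic[OF poly'[OF f(1)]])
    moreover have "open T" unfolding f X_def by (rule open_generic[OF poly'[OF f(1)]])
    ultimately show "openin (top_of_set UNIV) T \<and> UNIV \<subseteq> closure T" by simp
  qed simp
  then have "\<Inter> (X ` \<F>') \<noteq> {}" by (metis closure_empty UNIV_not_empty subset_empty)
  then obtain a where a: "\<And>f. f \<in> \<F>' \<Longrightarrow> a \<in> X f" by blast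
  have "det a \<noteq> 0" using a[of "\<lambda>_. 1"] by (simp add: \<F>'_def X_def)
  then have "det (det_normalize k a) = 1" by (rule det_det_normalize)
  moreover have "f (det_normalize k a) \<noteq> 0" if "f \<in> \<F>" for f
    using a[of f] that by (simp add: \<F>'_def X_def)
  ultimately show ?thesis by blast
qed

primrec ring_layer :: "complex set \<Rightarrow> nat \<Rightarrow> complex set" where
  "ring_layer X 0 = X"
| "ring_layer X (Suc n) = ring_layer X n \<union>
     (\<Union>x\<in>ring_layer X n. \<Union>y\<in>ring_layer X n. {x + y, x * y, - x})"

lemma countable_subring:
  fixes X :: "complex set"
  assumes "countable X"
  shows "\<exists>F. countable F \<and> X \<subseteq> F \<and> 1 \<in> F \<and> 0 \<in> F \<and> (\<forall>x\<in>F. \<forall>y\<in>F. x + y \<in> F \<and> x * y \<in> F) \<and> (\<forall>x\<in>F. - x \<in> F)"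
proof -
  let ?L = "ring_layer ({0, 1} \<union> X)"
  define F where "F = (\<Union>n. ?L n)"
  have "countable (?L n)" for n
  proof (induction n)
    case (Suc n)
    then show ?case unfolding ring_layer.simps by (intro countable_Un countable_UN) auto
  qed (use assms in simp)
  then have "countable F" unfolding F_def by auto
  moreover have "?L 0 \<subseteq> F" unfolding F_def by blast
  then have "X \<subseteq> F" "1 \<in> F" "0 \<in> F" by simp_all
  moreover have mono: "?L n \<subseteq> ?L (n + k)" for n k
    by (induction k) (simp, simp only: add_Suc_right ring_layer.simps, blast)
  have "x + y \<in> F \<and> x * y \<in> F" if xy: "x \<in> F" "y \<in> F" for x y
  proof -
    obtain i j where "x \<in> ?L i" "y \<in> ?L j" using xy unfolding F_def by blast
    then have "x \<in> ?L (i + j)" "y \<in> ?L (i + j)" using mono[of i j] mono[of j i] unfolding add.commute[of j i] by blast+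
    then have "x + y \<in> ?L (Suc (i + j))" "x * y \<in> ?L (Suc (i + j))"
      unfolding ring_layer.simps by blast+
    then show ?thesis unfolding F_def by blast
  qed
  moreover have "- x \<in> F" if x: "x \<in> F" for x
  proof -
    obtain i where "x \<in> ?L i" using x unfolding F_def by blast
    then have "- x \<in> ?L (Suc i)" unfolding ring_layer.simps by blast
    then show ?thesis unfolding F_def by blast
  qed
  ultimately show ?thesis by (intro exI[of _ F]) simp
qed

lemma countable_poly_mappings:
  fixes F :: "'b::zero set"
  assumes F: "countable F" and A: "countable (UNIV :: 'a set)"
  shows "countable {P :: 'a \<Rightarrow>\<^sub>0 'b. \<forall>\<alpha>. cf P \<alpha> \<in> F}"
proof -
  define G where "G P = (\<lambda>\<alpha>. (\<alpha>, cf P \<alpha>)) ` Poly_Mapping.keys P" for P :: "'a \<Rightarrow>\<^sub>0 'b"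
  have "inj G"
  proof (rule injI)
    fix P Q assume eq: "G P = G Q"
    have G: "(\<alpha>, c) \<in> G P \<longleftrightarrow> c = cf P \<alpha> \<and> c \<noteq> 0" for P \<alpha> c by (auto simp: G_def in_keys_iff)
    show "P = Q"
    proof (rule poly_mapping_eqI)
      fix \<alpha> show "cf P \<alpha> = cf Q \<alpha>"
        using G[of \<alpha> "cf P \<alpha>" P] G[of \<alpha> "cf P \<alpha>" Q] G[of \<alpha> "cf Q \<alpha>" P] G[of \<alpha> "cf Q \<alpha>" Q] eq by metis
    qed
  qed
  have "G ` {P. \<forall>\<alpha>. cf P \<alpha> \<in> F} \<subseteq> {S. S \<subseteq> UNIV \<times> F \<and> finite S}"
    by (auto simp: G_def)
  moreover have "countable {S. S \<subseteq> (UNIV :: 'a set) \<times> F \<and> finite S}"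
    using countable_Collect_finite_subset[OF countable_SIGMA[OF A, of "\<lambda>_. F"]] F by (simp add: conj_commute)
  ultimately have "countable (G ` {P. \<forall>\<alpha>. cf P \<alpha> \<in> F})" by (rule countable_subset)
  then show ?thesis by (rule countable_image_inj_on) (use \<open>inj G\<close> in \<open>auto simp: inj_on_def\<close>)
qed

lemma countable_monoms: "countable (UNIV :: 'm::finite monom set)"
proof -
  have "UNIV = (\<Union>n. {\<alpha> :: 'm monom. mdeg \<alpha> \<le> n})" by auto
  also have "countable \<dots>" by (auto intro: countable_finite finite_mdeg_le)
  finally show ?thesis .
qed

section \<open>Orbits of forms of degree at least three\<close>

text \<open>
  Under a homomorphism with graph \<open>r\<close>, the matrix \<open>N\<close> is the reduction of \<open>M\<close>; likewise for forms in
  \<open>poly_rel\<close>. Relating the two objects avoids applying a partial function to coefficients.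
\<close>

definition mat_rel :: "(complex \<times> complex) set \<Rightarrow> complex ^ 'm ^ 'm::finite \<Rightarrow> complex ^ 'm ^ 'm \<Rightarrow> bool" where
  "mat_rel r M N \<longleftrightarrow> (\<forall>i j. (M $ i $ j, N $ i $ j) \<in> r)"

definition poly_rel :: "(complex \<times> complex) set \<Rightarrow> 'm::finite cpoly \<Rightarrow> 'm cpoly \<Rightarrow> bool" where
  "poly_rel r P Q \<longleftrightarrow> (\<forall>\<alpha>. (cf P \<alpha>, cf Q \<alpha>) \<in> r)"

context
  fixes r :: "(complex \<times> complex) set"
  assumes r: "partial_hom r"
begin

lemma mat_rel_mult: "mat_rel r M N \<Longrightarrow> mat_rel r M' N' \<Longrightarrow> mat_rel r (M ** M') (N ** N')"
  unfolding mat_rel_def matrix_matrix_mult_def by (auto intro!: ph_sum[OF r] ph_mult[OF r])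

lemma mat_rel_unique: "mat_rel r M N \<Longrightarrow> mat_rel r M N' \<Longrightarrow> N = N'"
  unfolding mat_rel_def vec_eq_iff using ph_unique[OF r] by blast

lemma mat_rel_one: "mat_rel r (mat 1) (mat 1)"
  unfolding mat_rel_def mat_def by (auto intro: ph_zero[OF r] ph_one[OF r])

lemma mat_rel_det: "mat_rel r M N \<Longrightarrow> (det M, det N) \<in> r"
  unfolding det_def
proof (rule ph_sum[OF r], rule ph_mult[OF r])
  fix p :: "'a \<Rightarrow> 'a"
  show "(of_int (sign p), of_int (sign p)) \<in> r"
    using ph_one[OF r] ph_uminus[OF r ph_one[OF r]] by (simp add: sign_def)
  show "mat_rel r M N \<Longrightarrow> (\<Prod>i\<in>UNIV. M $ i $ p i, \<Prod>i\<in>UNIV. N $ i $ p i) \<in> r"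
    unfolding mat_rel_def by (blast intro: ph_prod[OF r])
qed

lemma mat_rel_exists:
  assumes "\<And>i j. M $ i $ j \<in> Domain r"
  shows "\<exists>N. mat_rel r M N"
proof -
  have "\<forall>i j. \<exists>c. (M $ i $ j, c) \<in> r" using assms by blast
  then obtain N where "\<And>i j. (M $ i $ j, N i j) \<in> r" by metis
  then show ?thesis by (intro exI[of _ "\<chi> i j. N i j"]) (simp add: mat_rel_def)
qed

lemma poly_rel_Const: "(a, b) \<in> r \<Longrightarrow> poly_rel r (Const a) (Const b)"
  unfolding poly_rel_def Const_def lookup_single when_def using ph_zero[OF r] by simp
lemma poly_rel_one: "poly_rel r 1 1" using poly_rel_Const[OF ph_one[OF r]] by simp
lemma poly_rel_Var: "poly_rel r (Var i) (Var i)"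
  unfolding poly_rel_def Var_def lookup_single when_def using ph_zero[OF r] ph_one[OF r] by simp
lemma poly_rel_mult: "poly_rel r P Q \<Longrightarrow> poly_rel r P' Q' \<Longrightarrow> poly_rel r (P * P') (Q * Q')"
  unfolding poly_rel_def lookup_times by (auto intro!: ph_sum[OF r] ph_mult[OF r])
lemma poly_rel_sum: "(\<And>x. x \<in> X \<Longrightarrow> poly_rel r (f x) (g x)) \<Longrightarrow> poly_rel r (sum f X) (sum g X)"
  unfolding poly_rel_def lookup_sum by (auto intro!: ph_sum[OF r])
lemma poly_rel_power: "poly_rel r P Q \<Longrightarrow> poly_rel r (P ^ n) (Q ^ n)"
  by (induction n) (auto intro: poly_rel_one poly_rel_mult)
lemma poly_rel_prod: "(\<And>x. x \<in> X \<Longrightarrow> poly_rel r (f x) (g x)) \<Longrightarrow> poly_rel r (prod f X) (prod g X)"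
  by (induction X rule: infinite_finite_induct) (auto intro: poly_rel_one poly_rel_mult)
lemma poly_rel_unique: "poly_rel r P Q \<Longrightarrow> poly_rel r P Q' \<Longrightarrow> Q = Q'"
  unfolding poly_rel_def by (rule poly_mapping_eqI) (use ph_unique[OF r] in blast)

lemma poly_rel_mat_act:
  assumes M: "mat_rel r M N" and w: "poly_rel r w w'"
  shows "poly_rel r (mat_act M w) (mat_act N w')"
proof -
  let ?K = "Poly_Mapping.keys w \<union> Poly_Mapping.keys w'"
  let ?t = "\<lambda>M \<beta>. \<Prod>j\<in>Poly_Mapping.keys \<beta>. (\<Sum>i\<in>UNIV. Const (M $ i $ j) * Var i) ^ cf \<beta> j"
  have e: "mat_act M w = (\<Sum>\<beta>\<in>?K. Const (cf w \<beta>) * ?t M \<beta>)"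
    unfolding mat_act_def subst_cpoly_def by (rule linear_extension_sum) auto
  have e': "mat_act N w' = (\<Sum>\<beta>\<in>?K. Const (cf w' \<beta>) * ?t N \<beta>)"
    unfolding mat_act_def subst_cpoly_def by (rule linear_extension_sum) auto
  have "poly_rel r (Const (M $ i $ j)) (Const (N $ i $ j))" for i j
    using M unfolding mat_rel_def by (blast intro: poly_rel_Const)
  then have t: "poly_rel r (?t M \<beta>) (?t N \<beta>)" for \<beta>
    by (intro poly_rel_prod poly_rel_power poly_rel_sum poly_rel_mult poly_rel_Var)
  show ?thesis unfolding e e'
  proof (rule poly_rel_sum, rule poly_rel_mult[OF poly_rel_Const t])
    fix \<beta> show "(cf w \<beta>, cf w' \<beta>) \<in> r" using w unfolding poly_rel_def by blast
  qed
qed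

lemma Domain_valuation_ring:
  assumes "\<And>x. x \<in> Domain r \<or> inverse x \<in> Domain r"
  shows "valuation_ring (Domain r)"
  unfolding valuation_ring_def
proof (intro conjI ballI allI)
  show "1 \<in> Domain r" using ph_one[OF r] by blast
  show "x + y \<in> Domain r" if "x \<in> Domain r" "y \<in> Domain r" for x y
    using that ph_add[OF r] by (elim DomainE) blast
  show "x * y \<in> Domain r" if "x \<in> Domain r" "y \<in> Domain r" for x y
    using that ph_mult[OF r] by (elim DomainE) blast
  show "- x \<in> Domain r" if "x \<in> Domain r" for x
    using that ph_uminus[OF r] by (elim DomainE) blast
  show "x \<in> Domain r \<or> inverse x \<in> Domain r" for x by (rule assms)
qed

text \<open>
  If the coefficients of \<open>g w\<close> are integral, then so are the entries of \<open>g\<close>, and the reduction of \<open>g\<close>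
  moves \<open>w\<close> to the reduction of \<open>g w\<close>. This is properness of the orbit map, tested on a valuation ring.
\<close>

lemma integral_orbit_point:
  fixes w u :: "'m::finite cpoly"
  assumes val: "\<And>x. x \<in> Domain r \<or> inverse x \<in> Domain r"
    and loc: "\<And>x c. (x, c) \<in> r \<Longrightarrow> c \<noteq> 0 \<Longrightarrow> (inverse x, inverse c) \<in> r"
    and w: "partials_generate d e w" "w \<in> Sym_forms (Suc d)" and d: "d \<ge> 2"
    and g: "det g = 1" and ww: "poly_rel r w w" and gu: "poly_rel r (mat_act g w) u"
  shows "\<exists>h. det h = 1 \<and> mat_act h w = u"
proof -
  let ?R = "Domain r"
  have R: "valuation_ring ?R" by (rule Domain_valuation_ring[OF val])
  obtain P Q where PQ: "GL_over ?R P" "GL_over ?R Q" "diagonal_on UNIV (P ** g ** Q)"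
    using smith_normal_form[OF R] by blast
  obtain P' where P: "\<And>i j. P $ i $ j \<in> ?R" "\<And>i j. P' $ i $ j \<in> ?R" "P ** P' = mat 1" "P' ** P = mat 1"
    using PQ(1) unfolding GL_over_def by blast
  obtain Q' where Q: "\<And>i j. Q $ i $ j \<in> ?R" "\<And>i j. Q' $ i $ j \<in> ?R" "Q ** Q' = mat 1" "Q' ** Q = mat 1"
    using PQ(2) unfolding GL_over_def by blast
  define t where "t = (\<lambda>i. (P ** g ** Q) $ i $ i)"
  have T: "P ** g ** Q = diagm t" unfolding t_def by (rule diagonal_on_UNIV[OF PQ(3)])
  obtain Pb where Pb: "mat_rel r P Pb" using mat_rel_exists P(1) by blast
  obtain Pb' where Pb': "mat_rel r P' Pb'" using mat_rel_exists P(2) by blast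
  obtain Qb where Qb: "mat_rel r Q Qb" using mat_rel_exists Q(1) by blast
  obtain Qb' where Qb': "mat_rel r Q' Qb'" using mat_rel_exists Q(2) by blast
  have QbQb': "Qb' ** Qb = mat 1"
    using mat_rel_unique[OF mat_rel_mult[OF Qb' Qb], of "mat 1"] mat_rel_one Q(4) by simp
  define w' where "w' = mat_act Q' w"
  define wb where "wb = mat_act Qb' w"
  have w'b: "poly_rel r w' wb" unfolding w'_def wb_def by (rule poly_rel_mat_act[OF Qb' ww])
  have wb: "partials_generate d e wb" "wb \<in> Sym_forms (Suc d)"
    unfolding wb_def by (rule partials_generate_mat_act[OF w(1) QbQb'], rule mat_act_Sym_forms[OF w(2)])
  \<comment> \<open>The diagonal matrix sends \<open>w'\<close>, which is integral with good reduction, to the integral form \<open>P (g w)\<close>.\<close>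
  have "mat_act (diagm t) w' = mat_act P (mat_act g w)"
  proof -
    have "mat_act (diagm t) w' = mat_act (P ** g ** (Q ** Q')) w"
      unfolding w'_def T[symmetric] mat_act_mat_act by (simp only: matrix_mul_assoc)
    then show ?thesis by (simp add: Q mat_act_mat_act)
  qed
  then have "poly_rel r (mat_act (diagm t) w') (mat_act Pb u)" using poly_rel_mat_act[OF Pb gu] by simp
  then have tw: "(\<Prod>i\<in>UNIV. t i ^ cf \<alpha> i) * cf w' \<alpha> \<in> ?R" for \<alpha>
    unfolding poly_rel_def lookup_mat_act_diagm by blast
  have dets: "det P * det P' = 1" "det Q * det Q' = 1"
    by (metis P(3) det_mul det_I, metis Q(3) det_mul det_I)
  have "det P * det g * det Q = (\<Prod>i\<in>UNIV. t i)"
    using arg_cong[OF T, of det] by (simp only: det_mul det_diagm)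
  then have pt: "(\<Prod>i\<in>UNIV. t i) = det P * det Q" using g by simp
  have "(det P * det Q) * (det P' * det Q') = (det P * det P') * (det Q * det Q')" by (simp only: mult_ac)
  then have one: "(\<Prod>i\<in>UNIV. t i) * (det P' * det Q') = 1" using dets pt by simp
  then have nz: "(\<Prod>i\<in>UNIV. t i) \<noteq> 0"
    by (metis mult_zero_left zero_neq_one)
  have "inverse (\<Prod>i\<in>UNIV. t i) = det P' * det Q'" using one by (rule inverse_unique)
  moreover have "det P' * det Q' \<in> ?R"
    using ph_mult[OF r mat_rel_det[OF Pb'] mat_rel_det[OF Qb']] by blast
  ultimately have unit: "inverse (\<Prod>i\<in>UNIV. t i) \<in> ?R" by simp
  have t0: "t i \<noteq> 0" for i using nz by simp
  have tR: "t i \<in> ?R" for i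
  proof (rule integral_weights[OF R t0 unit d])
    fix I J :: "'m set" assume IJ: "card I + card J > CARD('m)"
    obtain i \<beta> where i: "i \<in> I" "Poly_Mapping.keys \<beta> \<subseteq> J" "mdeg \<beta> = d" "cf wb (\<beta> + vexp i) \<noteq> 0"
      using nonzero_mixed_coefficient[OF wb _ IJ] d by auto
    let ?\<alpha> = "\<beta> + vexp i"
    have c: "(cf w' ?\<alpha>, cf wb ?\<alpha>) \<in> r" using w'b unfolding poly_rel_def by blast
    have c0: "cf w' ?\<alpha> \<noteq> 0"
    proof
      assume "cf w' ?\<alpha> = 0"
      then show False using c i(4) ph_zero_unique[OF r] by simp
    qed
    \<comment> \<open>The coefficient of \<open>w'\<close> is a unit because its reduction is nonzero, and can be cancelled.\<close>
    have "inverse (cf w' ?\<alpha>) \<in> ?R" using loc[OF c i(4)] by blast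
    then have "(\<Prod>j\<in>UNIV. t j ^ cf ?\<alpha> j) * cf w' ?\<alpha> * inverse (cf w' ?\<alpha>) \<in> ?R"
      by (rule vr_mult[OF R tw])
    then have "(\<Prod>j\<in>UNIV. t j ^ cf ?\<alpha> j) \<in> ?R" using c0 by (simp add: mult.assoc)
    moreover have "(\<Prod>j\<in>UNIV. t j ^ cf ?\<alpha> j) = t i * (\<Prod>j\<in>UNIV. t j ^ cf \<beta> j)"
    proof -
      have "(\<Prod>j\<in>UNIV. t j ^ cf (vexp i) j) = (\<Prod>j\<in>UNIV. if j = i then t i else 1)"
        by (intro prod.cong refl) (simp add: lookup_single when_def)
      then show ?thesis by (simp add: lookup_add power_add prod.distrib mult.commute)
    qed
    ultimately show "\<exists>i\<in>I. \<exists>\<beta>. Poly_Mapping.keys \<beta> \<subseteq> J \<and> mdeg \<beta> = d \<and> t i * (\<Prod>j\<in>UNIV. t j ^ cf \<beta> j) \<in> ?R"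
      using i by (intro bexI[of _ i] exI[of _ \<beta>]) simp_all
  qed
  have "diagm t $ i $ j \<in> ?R" for i j using tR vr_0[OF R] by (simp add: diagm_def)
  then obtain Tb where Tb: "mat_rel r (diagm t) Tb" using mat_rel_exists by blast
  have "P' ** diagm t ** Q' = (P' ** P) ** g ** (Q ** Q')"
    unfolding T[symmetric] by (simp only: matrix_mul_assoc)
  then have gT: "g = P' ** diagm t ** Q'" by (simp add: P Q)
  define h where "h = Pb' ** Tb ** Qb'"
  have gh: "mat_rel r g h" unfolding gT h_def by (intro mat_rel_mult Pb' Tb Qb')
  have "(1, det h) \<in> r" using mat_rel_det[OF gh] g by simp
  then have "det h = 1" using ph_unique[OF r _ ph_one[OF r]] by blast
  moreover have "mat_act h w = u"
    by (rule poly_rel_unique[OF poly_rel_mat_act[OF gh ww] gu])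
  ultimately show ?thesis by blast
qed

end

lemma coefficients_mult_closed:
  fixes P Q :: "'v cpoly"
  assumes "\<And>\<alpha>. cf P \<alpha> \<in> F" "\<And>\<alpha>. cf Q \<alpha> \<in> F"
    and F: "0 \<in> F" "\<And>x y. x \<in> F \<Longrightarrow> y \<in> F \<Longrightarrow> x + y \<in> F" "\<And>x y. x \<in> F \<Longrightarrow> y \<in> F \<Longrightarrow> x * y \<in> F"
  shows "cf (P * Q) \<alpha> \<in> (F :: complex set)"
proof -
  have S': "sum f X \<in> F" if "\<And>x. x \<in> X \<Longrightarrow> f x \<in> F" for f :: "'v monom \<Rightarrow> complex" and X
    using that by (induction X rule: infinite_finite_induct) (auto intro: F)
  show ?thesis
    unfolding lookup_times_keys by (rule S') (use assms(1,2) F in simp)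
qed

text \<open>
  A point \<open>u\<close> of the Zariski closure is the reduction of \<open>g w\<close> for a generic \<open>g\<close>, and
  \<open>integral_orbit_point\<close> turns this into membership in the orbit.
\<close>

lemma SL_orbit_zariski_closed:
  fixes w :: "'m::finite cpoly"
  assumes w: "partials_generate d e w" "w \<in> Sym_forms (Suc d)" and d: "d \<ge> 2"
  shows "zariski_closed (Suc d) (SL_orbit w)"
  unfolding zariski_closed_def
proof (intro exI equalityI subsetI)
  let ?S = "{P. \<forall>z\<in>SL_orbit w. eval_cpoly (cf z) P = 0}"
  show "z \<in> {w \<in> Sym_forms (Suc d). \<forall>P\<in>?S. eval_cpoly (cf w) P = 0}" if "z \<in> SL_orbit w" for z
    using that mat_act_Sym_forms[OF w(2)] by (auto simp: SL_orbit_def)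
  fix u :: "'m cpoly" assume u: "u \<in> {w \<in> Sym_forms (Suc d). \<forall>P\<in>?S. eval_cpoly (cf w) P = 0}"
  define X where "X = range (cf w) \<union> range (cf u)"
  have "countable X" unfolding X_def using countable_monoms by auto
  from countable_subring[OF this] obtain F where "countable F \<and> X \<subseteq> F \<and> 1 \<in> F \<and> 0 \<in> F \<and>
    (\<forall>x\<in>F. \<forall>y\<in>F. x + y \<in> F \<and> x * y \<in> F) \<and> (\<forall>x\<in>F. - x \<in> F)" by (elim exE)
  then have F: "countable F" "X \<subseteq> F" "1 \<in> F" "0 \<in> F"
    "\<And>x y. x \<in> F \<Longrightarrow> y \<in> F \<Longrightarrow> x + y \<in> F" "\<And>x y. x \<in> F \<Longrightarrow> y \<in> F \<Longrightarrow> x * y \<in> F" "\<And>x. x \<in> F \<Longrightarrow> - x \<in> F"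
    by simp_all
  \<comment> \<open>The relations over \<open>F\<close>; countability of \<open>F\<close> leaves only countably many of them.\<close>
  define A where "A = {P :: 'm monom cpoly. \<forall>\<alpha>. cf P \<alpha> \<in> F}"
  have cntA: "countable A"
  proof -
    have "countable (UNIV :: 'm monom monom set)"
      using countable_poly_mappings[of "UNIV :: nat set", where 'a = "'m monom"] countable_monoms by simp
    then show ?thesis unfolding A_def by (rule countable_poly_mappings[OF F(1)])
  qed
  let ?ev = "\<lambda>P g. eval_cpoly (cf (mat_act g w)) P"
  define G where "G = ?ev ` {P \<in> A. \<exists>b. det b = 1 \<and> ?ev P b \<noteq> 0}"
  have "\<exists>g. det g = 1 \<and> (\<forall>f\<in>G. f g \<noteq> 0)"
  proof (rule generic_SL_point)
    show "countable G"
      unfolding G_def by (rule countable_image, rule countable_subset[OF _ cntA]) simp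
  qed (auto simp: G_def mat_poly_eval_mat_act)
  then obtain g where g: "det g = 1" and gG: "\<forall>f\<in>G. f g \<noteq> 0" by (elim exE conjE)
  have gen: "?ev P b = 0" if P: "P \<in> A" "?ev P g = 0" "det b = 1" for P b
  proof (rule ccontr)
    assume "?ev P b \<noteq> 0"
    then have "?ev P \<in> G" unfolding G_def using P by (intro imageI) auto
    then show False using gG P(2) by auto
  qed
  \<comment> \<open>The specialization of \<open>g w\<close> to \<open>u\<close> over \<open>F\<close>. It is well defined because a relation that holds at
    the generic \<open>g w\<close> holds on the orbit, hence at \<open>u\<close>.\<close>
  define r0 where "r0 = (\<lambda>P. (?ev P g, eval_cpoly (cf u) P)) ` A"
  have r0I: "(?ev P g, eval_cpoly (cf u) P) \<in> r0" if "P \<in> A" for P using that by (auto simp: r0_def)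
  have A_Const: "Const c \<in> A" if "c \<in> F" for c
    using that F(4) by (simp add: A_def Const_def lookup_single when_def)
  have A_Var: "Var \<alpha> \<in> A" for \<alpha> using F(3,4) by (simp add: A_def lookup_Var when_def)
  have A_add: "P + Q \<in> A" if "P \<in> A" "Q \<in> A" for P Q using that F(5) by (simp add: A_def lookup_add)
  have A_uminus: "- P \<in> A" if "P \<in> A" for P using that F(7) by (simp add: A_def)
  have A_mult: "P * Q \<in> A" if "P \<in> A" "Q \<in> A" for P Q
    using that coefficients_mult_closed[of P F Q, OF _ _ F(4-6)] by (simp add: A_def)
  have ev_minus: "eval_cpoly a (- P) = - eval_cpoly a P" for a and P :: "'m monom cpoly"
  proof (rule minus_unique[symmetric])
    show "eval_cpoly a P + eval_cpoly a (- P) = 0" unfolding eval_cpoly_add[symmetric] by simp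
  qed
  have "partial_hom r0"
    unfolding partial_hom_def
  proof (intro conjI allI impI)
    show "(1, 1) \<in> r0" using r0I[OF A_Const[OF F(3)]] by (simp del: Const_1)
    show "(- x, - a) \<in> r0" if xa: "(x, a) \<in> r0" for x a
    proof -
      obtain P where P: "P \<in> A" "x = ?ev P g" "a = eval_cpoly (cf u) P" using xa by (auto simp: r0_def)
      then show ?thesis using r0I[OF A_uminus[OF P(1)]] by (simp add: ev_minus)
    qed
    show "b = 0" if b: "(0, b) \<in> r0" for b
    proof -
      obtain P where P: "P \<in> A" "0 = ?ev P g" "b = eval_cpoly (cf u) P" using b by (auto simp: r0_def)
      then have "P \<in> ?S" using gen[OF P(1)] by (auto simp: SL_orbit_def)
      then show ?thesis using u P(3) by simp
    qed
    fix x a y b assume xy: "(x, a) \<in> r0" "(y, b) \<in> r0"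
    obtain P where P: "P \<in> A" "x = ?ev P g" "a = eval_cpoly (cf u) P" using xy(1) by (auto simp: r0_def)
    obtain Q where Q: "Q \<in> A" "y = ?ev Q g" "b = eval_cpoly (cf u) Q" using xy(2) by (auto simp: r0_def)
    show "(x + y, a + b) \<in> r0" using r0I[OF A_add[OF P(1) Q(1)]] by (simp add: eval_cpoly_add P Q)
    show "(x * y, a * b) \<in> r0" using r0I[OF A_mult[OF P(1) Q(1)]] by (simp add: eval_cpoly_mult P Q)
  qed
  from partial_hom_extend_to_valuation_ring[OF this]
  obtain r where "partial_hom r \<and> r0 \<subseteq> r \<and> (\<forall>x. x \<in> Domain r \<or> inverse x \<in> Domain r) \<and>
    (\<forall>x c. (x, c) \<in> r \<longrightarrow> c \<noteq> 0 \<longrightarrow> (inverse x, inverse c) \<in> r)" by (elim exE)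
  then have r: "partial_hom r" "r0 \<subseteq> r" "\<And>x. x \<in> Domain r \<or> inverse x \<in> Domain r"
    "\<And>x c. (x, c) \<in> r \<Longrightarrow> c \<noteq> 0 \<Longrightarrow> (inverse x, inverse c) \<in> r"
    by blast+
  have "poly_rel r w w"
    unfolding poly_rel_def
  proof
    fix \<alpha>
    have "cf w \<alpha> \<in> F" using F(2) unfolding X_def by blast
    from r0I[OF A_Const[OF this]] have "(cf w \<alpha>, cf w \<alpha>) \<in> r0" unfolding eval_cpoly_Const .
    then show "(cf w \<alpha>, cf w \<alpha>) \<in> r" using r(2) by (rule set_mp[rotated])
  qed
  moreover have "poly_rel r (mat_act g w) u"
    unfolding poly_rel_def
  proof
    fix \<alpha> show "(cf (mat_act g w) \<alpha>, cf u \<alpha>) \<in> r" 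
      using set_mp[OF r(2) r0I[OF A_Var[of \<alpha>]]] unfolding eval_cpoly_Var .
  qed
  ultimately have "\<exists>h. det h = 1 \<and> mat_act h w = u"
    using integral_orbit_point[OF r(1) r(3) r(4) w d g] by metis
  then show "u \<in> SL_orbit w" unfolding SL_orbit_def by blast
qed

theorem proposition2p10:
  fixes D :: nat
  assumes "D > 1"
  shows "almost_all_forms D (polystable D :: 'm::finite cpoly \<Rightarrow> bool)"
proof (cases "D = 2")
  case True
  then show ?thesis using almost_all_quadrics_polystable by simp
next
  case False
  then obtain d where d: "D = Suc d" "d \<ge> 2" using assms by (cases D) auto
  \<comment> \<open>Above degree \<open>m (d - 1)\<close> every monomial has an exponent of at least \<open>d\<close>.\<close>
  define e where "e = CARD('m) * (d - 1) + 1"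
  have "e + d > CARD('m) * (d - 1)" by (simp add: e_def)
  from generic_partials_generate[OF this]
  obtain f where f: "poly_fun f" "f (cf (fermat (Suc d) :: 'm cpoly)) \<noteq> 0"
    "\<And>w :: 'm cpoly. w \<in> Sym_forms (Suc d) \<Longrightarrow> f (cf w) \<noteq> 0 \<Longrightarrow> partials_generate d e w" by blast
  let ?U = "{w :: 'm cpoly. w \<in> Sym_forms D \<and> f (cf w) \<noteq> 0}"
  have "polystable D w" if "w \<in> ?U" for w
    using that SL_orbit_zariski_closed[OF f(3) _ d(2)] by (simp add: polystable_def d)
  moreover have "fermat D \<in> ?U" using f(2) fermat_Sym_forms by (simp add: d)
  ultimately show ?thesis
    unfolding almost_all_forms_def using zariski_open_nonvanishing[OF f(1), of D]
    by (intro exI[of _ ?U]) auto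
qed

end
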